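(* Let $\varphi\in L^{2}(\mathbb{R}^{2n})$ satisfy condition C. Then there exists a canonical dual $\tilde{\varphi}$ to $\varphi$ belonging to $V^{t}(\varphi)$, i.e. a function $\tilde\varphi\in V^{t}(\varphi)$ with $\langle T^{t}_{(k,l)}\tilde{\varphi},\varphi\rangle=\delta_{(k,l),(0,0)}$ for all $k,l\in\mathbb{Z}^{n}$, if and only if $\frac{1}{w_{\varphi}}\in L^{1}(\mathbb{T}^{n})$. Moreover, in this case, $K_{\tilde{\varphi}}(\xi,\eta)=\frac{1}{w_{\varphi}(\xi)}K_{\varphi}(\xi,\eta)$ for a.e. $(\xi,\eta)\in\mathbb{R}^{n}\times\mathbb{R}^{n}$.
   Context: $\mathbb{T}^{n}$ is identified with $[0,1)^{n}$ with Lebesgue measure. Twisted translation: for $\varphi\in L^{2}(\mathbb{R}^{2n})$ and $(k,l)\in\mathbb{Z}^{2n}$ (with $k,l\in\mathbb{Z}^n$), $T^{t}_{(k,l)}\varphi(x,y)=e^{\pi i(x\cdot l-y\cdot k)}\varphi(x-k,y-l)$, $(x,y)\in\mathbb{R}^{n}\times\mathbb{R}^{n}$. $V^{t}(\varphi)$ is the closed linear span of $\{T^{t}_{(k,l)}\varphi:(k,l)\in\mathbb{Z}^{2n}\}$ in $L^{2}(\mathbb{R}^{2n})$. Kernel of the Weyl transform: for $f\in L^{2}(\mathbb{R}^{2n})$, $K_{f}(\xi,\eta)=\int_{\mathbb{R}^{n}}f(x,\eta-\xi)e^{i\pi x\cdot(\xi+\eta)}dx$ (interpreted in the $L^{2}$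 sense as a partial Fourier transform; $f\mapsto K_f$ is an isometry of $L^{2}(\mathbb{R}^{2n})$). $w_{\varphi}(\xi)=\sum_{m\in\mathbb{Z}^{n}}\int_{\mathbb{R}^{n}}|K_{\varphi}(\xi+m,\eta)|^{2}d\eta$ for $\xi\in\mathbb{R}^{n}$; this is $\mathbb{Z}^{n}$-periodic and is regarded also as a function on $\mathbb{T}^{n}$; $1/w_\varphi$ is $+\infty$ where $w_\varphi=0$. Condition C: $\varphi$ satisfies condition C if for every $l\in\mathbb{Z}^{n}\setminus\{0\}$, $\sum_{m\in\mathbb{Z}^{n}}\int_{\mathbb{R}^{n}}K_{\varphi}(\xi+m,\eta)\overline{K_{\varphi}(\xi+m+l,\eta)}\,d\eta=0$ for a.e. $\xi\in\mathbb{T}^{n}$. *)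

theory Defs
  imports "HOL-Analysis.Analysis"
begin

text \<open>
  Elements of \<open>L\<^sup>2\<close> are represented by Borel measurable functions; every Lebesgue class has such a
  representative, and everything below depends only on almost-everywhere classes.
\<close>

definition square_integrable :: "('a::euclidean_space \<Rightarrow> complex) \<Rightarrow> bool" where
  "square_integrable f \<longleftrightarrow>
     f \<in> borel_measurable lborel \<and> integrable lborel (\<lambda>x. (cmod (f x))\<^sup>2)"

definition L2_inner :: "('a::euclidean_space \<Rightarrow> complex) \<Rightarrow> ('a \<Rightarrow> complex) \<Rightarrow> complex" where
  "L2_inner f g = (LINT x|lborel. f x * cnj (g x))"

text \<open>
  The squared norm takes values in \<open>[0,\<infinity>]\<close>, so that a difference which is not square integrable
  has infinite norm rather than a default value.
\<close>

definition L2_sqnorm :: "('a::euclidean_space \<Rightarrow> complex) \<Rightarrow> ennreal" where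
  "L2_sqnorm f = (\<integral>\<^sup>+x. ennreal ((cmod (f x))\<^sup>2) \<partial>lborel)"

definition L2_tendsto :: "(nat \<Rightarrow> 'a::euclidean_space \<Rightarrow> complex) \<Rightarrow> ('a \<Rightarrow> complex) \<Rightarrow> bool" where
  "L2_tendsto F f \<longleftrightarrow> (\<lambda>N. L2_sqnorm (\<lambda>x. F N x - f x)) \<longlonglongrightarrow> 0"

definition lattice_pt :: "int ^ 'n \<Rightarrow> real ^ 'n" where
  "lattice_pt m = (\<chi> i. real_of_int (m $ i))"

text \<open>The torus is \<open>[0,1)\<^sup>n\<close> with Lebesgue measure.\<close>

definition torus :: "(real ^ 'n) measure" where
  "torus = restrict_space lborel {x. \<forall>i. 0 \<le> x $ i \<and> x $ i < 1}"

definition L1_torus :: "(real ^ 'n \<Rightarrow> ennreal) \<Rightarrow> bool" where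
  "L1_torus g \<longleftrightarrow> g \<in> borel_measurable torus \<and> (\<integral>\<^sup>+\<xi>. g \<xi> \<partial>torus) < \<infinity>"

definition twisted_translation ::
  "int ^ 'n \<Rightarrow> int ^ 'n \<Rightarrow> ((real ^ 'n) \<times> (real ^ 'n) \<Rightarrow> complex) \<Rightarrow> (real ^ 'n) \<times> (real ^ 'n) \<Rightarrow> complex"
where
  "twisted_translation k l \<phi> = (\<lambda>(x, y).
     cis (pi * (x \<bullet> lattice_pt l - y \<bullet> lattice_pt k)) * \<phi> (x - lattice_pt k, y - lattice_pt l))"

definition twisted_span ::
  "((real ^ 'n) \<times> (real ^ 'n) \<Rightarrow> complex) \<Rightarrow> ((real ^ 'n) \<times> (real ^ 'n) \<Rightarrow> complex) set" where
  "twisted_span \<phi> =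
     {g. \<exists>F c. finite F \<and> g = (\<lambda>z. \<Sum>(k, l)\<in>F. c (k, l) * twisted_translation k l \<phi> z)}"

definition twisted_space ::
  "((real ^ 'n) \<times> (real ^ 'n) \<Rightarrow> complex) \<Rightarrow> ((real ^ 'n) \<times> (real ^ 'n) \<Rightarrow> complex) set" where
  "twisted_space \<phi> =
     {\<psi>. square_integrable \<psi> \<and> (\<exists>g. (\<forall>j. g j \<in> twisted_span \<phi>) \<and> L2_tendsto g \<psi>)}"

text \<open>
  The kernel of the Weyl transform is a partial Fourier transform in the \<open>L\<^sup>2\<close> (Plancherel) sense:
  for square integrable \<open>f\<close> the integrals over \<open>norm x \<le> N\<close> exist for almost every \<open>(\<xi>, \<eta>)\<close> and
  converge in \<open>L\<^sup>2\<close> as \<open>N \<rightarrow> \<infinity>\<close>. The limit is unique up to null sets, and \<open>weyl_kernel f\<close> is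
  one of its representatives.
\<close>

definition truncated_kernel ::
  "nat \<Rightarrow> ((real ^ 'n) \<times> (real ^ 'n) \<Rightarrow> complex) \<Rightarrow> (real ^ 'n) \<times> (real ^ 'n) \<Rightarrow> complex" where
  "truncated_kernel N f = (\<lambda>(\<xi>, \<eta>).
     (LINT x:cball 0 (real N)|lborel. f (x, \<eta> - \<xi>) * cis (pi * (x \<bullet> (\<xi> + \<eta>)))))"

definition weyl_kernel ::
  "((real ^ 'n) \<times> (real ^ 'n) \<Rightarrow> complex) \<Rightarrow> (real ^ 'n) \<times> (real ^ 'n) \<Rightarrow> complex" where
  "weyl_kernel f = (SOME K. square_integrable K \<and> L2_tendsto (\<lambda>N. truncated_kernel N f) K)"

definition weight :: "((real ^ 'n) \<times> (real ^ 'n) \<Rightarrow> complex) \<Rightarrow> real ^ 'n \<Rightarrow> ennreal" where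
  "weight \<phi> \<xi> = (\<Sum>\<^sub>\<infinity>m. \<integral>\<^sup>+\<eta>. ennreal ((cmod (weyl_kernel \<phi> (\<xi> + lattice_pt m, \<eta>)))\<^sup>2) \<partial>lborel)"

definition condition_C :: "((real ^ 'n) \<times> (real ^ 'n) \<Rightarrow> complex) \<Rightarrow> bool" where
  "condition_C \<phi> \<longleftrightarrow> (\<forall>l. l \<noteq> 0 \<longrightarrow> (AE \<xi> in torus.
     ((\<lambda>m. LINT \<eta>|lborel. weyl_kernel \<phi> (\<xi> + lattice_pt m, \<eta>) *
             cnj (weyl_kernel \<phi> (\<xi> + lattice_pt m + lattice_pt l, \<eta>))) has_sum 0) UNIV))"

definition canonical_dual ::
  "((real ^ 'n) \<times> (real ^ 'n) \<Rightarrow> complex) \<Rightarrow> ((real ^ 'n) \<times> (real ^ 'n) \<Rightarrow> complex) \<Rightarrow> bool" where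
  "canonical_dual \<phi> \<psi> \<longleftrightarrow> \<psi> \<in> twisted_space \<phi> \<and>
     (\<forall>k l. L2_inner (twisted_translation k l \<psi>) \<phi> = (if (k, l) = (0, 0) then 1 else 0))"

end

theory Submission
  imports Defs "HOL-Complex_Analysis.Cauchy_Integral_Theorem"
begin

text \<open>
  The Weyl kernel map \<open>f \<mapsto> K\<^sub>f\<close> is a Fourier transform in one of two variables followed by a
  measure preserving linear change of variables, hence an isometry of \<open>L\<^sup>2\<close>. It turns
  \<open>T\<^bsub>(k,l)\<^esub>\<close> into multiplication by the character \<open>exp (2 \<pi> i k \<bullet> \<xi>)\<close> and a constant of modulus
  one, combined with the shift of \<open>\<xi>\<close> by \<open>l\<close> (\<open>weyl_kernel_twisted_translation\<close>). Consequently, up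
  to constants of modulus one, the numbers \<open>\<langle>\<psi>, T\<^bsub>(k,l)\<^esub> \<phi>\<rangle>\<close>, for fixed \<open>l\<close>, are the Fourier
  coefficients of the periodic function
  \<open>[\<psi>, \<phi>]\<^sub>l(\<xi>) = \<Sum>\<^sub>m \<integral> K\<^sub>\<psi>(\<xi> + m, \<eta>) cnj (K\<^sub>\<phi>(\<xi> + m + l, \<eta>)) d\<eta>\<close>,
  and the theorem becomes a statement about functions on the torus. Here \<open>w\<^sub>\<phi> = [\<phi>, \<phi>]\<^sub>0\<close>.

  If \<open>\<psi>\<close> is a dual, then the coefficients for \<open>l = 0\<close> are those of the constant 1. An integrable
  function on the torus is determined by its Fourier coefficients (\<open>torus_fourier_unique\<close>), so
  \<open>[\<psi>, \<phi>]\<^sub>0 = 1\<close> almost everywhere. The Cauchy--Schwarz inequality gives \<open>1 \<le> w\<^sub>\<psi> w\<^sub>\<phi>\<close>, and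
  \<open>1 / w\<^sub>\<phi>\<close> is dominated by \<open>w\<^sub>\<psi>\<close>, whose integral is the squared norm of \<open>\<psi>\<close>
  (\<open>canonical_dual_imp_L1\<close>).

  Conversely, let \<open>1 / w\<^sub>\<phi>\<close> be integrable. Then \<open>1 / w\<^sub>\<phi>\<close> lies in \<open>L\<^sup>2(w\<^sub>\<phi> d\<xi>)\<close>, and trigonometric
  polynomials \<open>p\<^sub>j\<close> converge to it there. The function \<open>p\<^sub>j(\<xi>) K\<^sub>\<phi>(\<xi>, \<eta>)\<close> is the kernel of a linear
  combination of the \<open>T\<^bsub>(k,0)\<^esub> \<phi>\<close>, and its distance to \<open>K\<^sub>\<phi> / w\<^sub>\<phi>\<close> is the distance of \<open>p\<^sub>j\<close> to
  \<open>1 / w\<^sub>\<phi>\<close> in \<open>L\<^sup>2(w\<^sub>\<phi> d\<xi>)\<close>. By isometry and completeness, these combinations converge to some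
  \<open>\<psi>\<close> in the space generated by \<open>\<phi>\<close>, with \<open>K\<^sub>\<psi> = K\<^sub>\<phi> / w\<^sub>\<phi>\<close>. Now \<open>[\<psi>, \<phi>]\<^sub>l = [\<phi>, \<phi>]\<^sub>l / w\<^sub>\<phi>\<close>
  vanishes for \<open>l \<noteq> 0\<close>, which is condition C, and is 1 for \<open>l = 0\<close> (\<open>exists_canonical_dual\<close>).

  The difference of two duals lies in the closed span of the \<open>T\<^bsub>(k,l)\<^esub> \<phi>\<close> and is orthogonal to it.
  So the dual is unique (\<open>canonical_dual_unique\<close>), and the formula for the kernel of the constructed
  dual holds for every dual.

  Two results of Fourier analysis carry the argument. The first is the density of trigonometric
  polynomials in \<open>L\<^sup>2\<close> of any finite Borel measure on the unit cube, from the Stone--Weierstrass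
  theorem and inner regularity; Parseval's identity and uniqueness of Fourier coefficients follow
  from it. The second is the Plancherel theorem for functions of bounded support: if \<open>g\<close> vanishes off
  the unit cube, then the values of its Fourier transform at the points \<open>\<theta> + k\<close>, with \<open>k\<close> integral,
  are the Fourier coefficients of \<open>g(x) exp (2 \<pi> i x \<bullet> \<theta>)\<close>; it remains to integrate Parseval's
  identity over \<open>\<theta>\<close> in the torus. Truncation and completeness extend the isometry to all of \<open>L\<^sup>2\<close>.
\<close>


section \<open>Mean square norms\<close>

text \<open>
  The value \<open>\<infinity>\<close> is allowed, so that convergence can be expressed before square integrability is
  known. The triangle inequality is used in the form with the factor 2 for the squared norm.
\<close>

definition sqnorm :: "'a measure \<Rightarrow> ('a \<Rightarrow> complex) \<Rightarrow> ennreal" where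
  "sqnorm M f = (\<integral>\<^sup>+x. ennreal ((cmod (f x))\<^sup>2) \<partial>M)"

lemma L2_sqnorm_eq_sqnorm: "L2_sqnorm f = sqnorm lborel f"
  by (simp add: L2_sqnorm_def sqnorm_def)

lemma cmod_add_squared_le: "(cmod (a + b))\<^sup>2 \<le> 2 * (cmod a)\<^sup>2 + 2 * (cmod b)\<^sup>2"
proof -
  have "(cmod (a + b))\<^sup>2 \<le> (cmod a + cmod b)\<^sup>2"
    by (simp add: norm_triangle_ineq power_mono)
  also have "\<dots> \<le> 2 * (cmod a)\<^sup>2 + 2 * (cmod b)\<^sup>2"
    using sum_squares_bound[of "cmod a" "cmod b"] by (simp add: power2_sum)
  finally show ?thesis .
qed

lemma sqnorm_add:
  assumes [measurable]: "f \<in> borel_measurable M" "g \<in> borel_measurable M"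
  shows "sqnorm M (\<lambda>x. f x + g x) \<le> 2 * sqnorm M f + 2 * sqnorm M g"
proof -
  have "sqnorm M (\<lambda>x. f x + g x) \<le>
      (\<integral>\<^sup>+x. 2 * ennreal ((cmod (f x))\<^sup>2) + 2 * ennreal ((cmod (g x))\<^sup>2) \<partial>M)"
    unfolding sqnorm_def
  proof (rule nn_integral_mono)
    fix x
    have "ennreal ((cmod (f x + g x))\<^sup>2) \<le> ennreal (2 * (cmod (f x))\<^sup>2 + 2 * (cmod (g x))\<^sup>2)"
      by (intro ennreal_leI cmod_add_squared_le)
    then show "ennreal ((cmod (f x + g x))\<^sup>2) \<le> 2 * ennreal ((cmod (f x))\<^sup>2) + 2 * ennreal ((cmod (g x))\<^sup>2)"
      by (simp add: ennreal_plus ennreal_mult)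
  qed
  also have "\<dots> = 2 * sqnorm M f + 2 * sqnorm M g"
    unfolding sqnorm_def by (simp add: nn_integral_add nn_integral_cmult)
  finally show ?thesis .
qed

lemma sqnorm_cmult:
  assumes [measurable]: "f \<in> borel_measurable M"
  shows "sqnorm M (\<lambda>x. c * f x) = ennreal ((cmod c)\<^sup>2) * sqnorm M f"
  unfolding sqnorm_def by (simp add: norm_mult power_mult_distrib ennreal_mult nn_integral_cmult)

lemma sqnorm_minus_commute: "sqnorm M (\<lambda>x. f x - g x) = sqnorm M (\<lambda>x. g x - f x)"
  unfolding sqnorm_def by (simp add: norm_minus_commute)

lemma sqnorm_diff:
  assumes [measurable]: "f \<in> borel_measurable M" "g \<in> borel_measurable M"
  shows "sqnorm M (\<lambda>x. f x - g x) \<le> 2 * sqnorm M f + 2 * sqnorm M g"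
  using sqnorm_add[of f M "\<lambda>x. - g x"] by (simp add: sqnorm_def)

lemma sqnorm_triangle:
  assumes [measurable]: "f \<in> borel_measurable M" "g \<in> borel_measurable M" "h \<in> borel_measurable M"
  shows "sqnorm M (\<lambda>x. f x - h x) \<le> 2 * sqnorm M (\<lambda>x. f x - g x) + 2 * sqnorm M (\<lambda>x. g x - h x)"
  using sqnorm_add[of "\<lambda>x. f x - g x" M "\<lambda>x. g x - h x"] by simp

lemma sqnorm_cong_AE: "AE x in M. f x = g x \<Longrightarrow> sqnorm M f = sqnorm M g"
  unfolding sqnorm_def by (intro nn_integral_cong_AE) auto

text \<open>
  Dominated convergence in mean square: \<open>4 w\<^sup>2\<close> dominates the squared differences.
\<close>

lemma sqnorm_tendsto_0_dominated:
  assumes [measurable]: "f \<in> borel_measurable M" "\<And>n. s n \<in> borel_measurable M" "w \<in> borel_measurable M"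
    and lim: "AE x in M. (\<lambda>n::nat. s n x) \<longlonglongrightarrow> f x"
    and b: "\<And>n. AE x in M. cmod (s n x) \<le> w x" "AE x in M. cmod (f x) \<le> w x"
    and fin: "(\<integral>\<^sup>+x. ennreal ((w x)\<^sup>2) \<partial>M) < \<infinity>"
  shows "(\<lambda>n. sqnorm M (\<lambda>x. f x - s n x)) \<longlonglongrightarrow> 0"
proof -
  have "(\<lambda>n. (\<integral>\<^sup>+x. ennreal ((cmod (f x - s n x))\<^sup>2) \<partial>M)) \<longlonglongrightarrow> (\<integral>\<^sup>+x. 0 \<partial>M)"
  proof (rule nn_integral_dominated_convergence[where w="\<lambda>x. 4 * ennreal ((w x)\<^sup>2)"])
    show "AE x in M. ennreal ((cmod (f x - s n x))\<^sup>2) \<le> 4 * ennreal ((w x)\<^sup>2)" for n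
      using b(1)[of n] b(2)
    proof eventually_elim
      case (elim x)
      have "cmod (f x - s n x) \<le> 2 * w x"
        using norm_triangle_ineq4[of "f x" "s n x"] elim by simp
      then have "(cmod (f x - s n x))\<^sup>2 \<le> (2 * w x)\<^sup>2"
        by (intro power_mono) auto
      then have "ennreal ((cmod (f x - s n x))\<^sup>2) \<le> ennreal (4 * (w x)\<^sup>2)"
        by (intro ennreal_leI) (simp add: power_mult_distrib)
      then show ?case by (simp add: ennreal_mult)
    qed
    show "(\<integral>\<^sup>+x. 4 * ennreal ((w x)\<^sup>2) \<partial>M) < \<infinity>"
      using fin by (simp add: nn_integral_cmult ennreal_mult_less_top)
    show "AE x in M. (\<lambda>n. ennreal ((cmod (f x - s n x))\<^sup>2)) \<longlonglongrightarrow> 0"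
      using lim
    proof eventually_elim
      case (elim x)
      have "(\<lambda>n. (cmod (f x - s n x))\<^sup>2) \<longlonglongrightarrow> (cmod (f x - f x))\<^sup>2"
        by (intro tendsto_intros elim)
      then show ?case by (auto simp flip: ennreal_0 intro!: tendsto_ennrealI)
    qed
  qed auto
  then show ?thesis by (simp add: sqnorm_def)
qed

section \<open>Trigonometric polynomials\<close>

definition unit_cube :: "(real ^ 'n) set" where
  "unit_cube = {x. \<forall>i. 0 \<le> x $ i \<and> x $ i < 1}"

definition character :: "int ^ 'n \<Rightarrow> real ^ 'n \<Rightarrow> complex" where
  "character k x = cis (2 * pi * (x \<bullet> lattice_pt k))"

definition trig_polynomial :: "(real ^ 'n \<Rightarrow> complex) \<Rightarrow> bool" where
  "trig_polynomial p \<longleftrightarrow> (\<exists>F c. finite F \<and> p = (\<lambda>x. \<Sum>k\<in>F. c k * character k x))"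

lemma lattice_pt_simps [simp]:
  "lattice_pt 0 = 0" "lattice_pt (k + l) = lattice_pt k + lattice_pt l"
  "lattice_pt (- k) = - lattice_pt k" "lattice_pt (k - l) = lattice_pt k - lattice_pt l"
  "lattice_pt k $ i = of_int (k $ i)"
  by (auto simp: lattice_pt_def vec_eq_iff)

lemma lattice_pt_inner: "lattice_pt m \<bullet> lattice_pt k = of_int (\<Sum>i\<in>UNIV. m $ i * k $ i)"
  by (simp add: inner_vec_def)

lemma cis_two_pi_lattice [simp]: "cis (2 * pi * (lattice_pt m \<bullet> lattice_pt k)) = 1"
  unfolding lattice_pt_inner by (rule cis_multiple_2pi) (rule Ints_of_int)

lemma character_add: "character (k + l) x = character k x * character l x"
  by (simp add: character_def cis_mult inner_add_right algebra_simps)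

lemma character_plus: "character k (x + y) = character k x * character k y"
  by (simp add: character_def cis_mult inner_add_left algebra_simps)

lemma character_0 [simp]: "character 0 x = 1" and character_at_0 [simp]: "character k 0 = 1"
  by (simp_all add: character_def)

lemma character_uminus: "character (- k) x = cnj (character k x)"
  by (simp add: character_def cis_cnj)

lemma norm_character [simp]: "cmod (character k x) = 1"
  by (simp add: character_def)

lemma character_periodic [simp]: "character k (x + lattice_pt m) = character k x"
  unfolding character_plus by (simp add: character_def)

lemma character_measurable [measurable]: "character k \<in> borel_measurable borel"
  unfolding character_def cis.code by (intro borel_measurable_continuous_onI continuous_intros)

lemma trig_polynomial_measurable: "trig_polynomial p \<Longrightarrow> p \<in> borel_measurable borel"
  by (auto simp: trig_polynomial_def)

lemma trig_polynomial_periodic: "trig_polynomial p \<Longrightarrow> p (x + lattice_pt m) = p x"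
  by (auto simp: trig_polynomial_def)

lemma trig_polynomial_monom: "trig_polynomial (\<lambda>x. c * character k x)"
  unfolding trig_polynomial_def by (rule exI[of _ "{k}"], rule exI[of _ "\<lambda>_. c"]) auto

lemma trig_polynomial_const: "trig_polynomial (\<lambda>x. c)"
  using trig_polynomial_monom[of c 0] by simp

lemma trig_polynomial_add:
  assumes "trig_polynomial p" "trig_polynomial q" shows "trig_polynomial (\<lambda>x. p x + q x)"
proof -
  obtain F c where F: "finite F" "p = (\<lambda>x. \<Sum>k\<in>F. c k * character k x)"
    using assms(1) by (auto simp: trig_polynomial_def)
  obtain G d where G: "finite G" "q = (\<lambda>x. \<Sum>k\<in>G. d k * character k x)"
    using assms(2) by (auto simp: trig_polynomial_def)
  have "p x + q x = (\<Sum>k\<in>F\<union>G. ((if k \<in> F then c k else 0) + (if k \<in> G then d k else 0)) * character k x)" for x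
  proof -
    have "p x = (\<Sum>k\<in>F\<union>G. (if k \<in> F then c k else 0) * character k x)"
      unfolding F(2) using F(1) G(1) by (intro sum.mono_neutral_cong_left) auto
    moreover have "q x = (\<Sum>k\<in>F\<union>G. (if k \<in> G then d k else 0) * character k x)"
      unfolding G(2) using F(1) G(1) by (intro sum.mono_neutral_cong_left) auto
    ultimately show ?thesis by (simp add: sum.distrib algebra_simps)
  qed
  then show ?thesis unfolding trig_polynomial_def using F(1) G(1)
    by (intro exI[of _ "F \<union> G"] exI[of _ "\<lambda>k. (if k \<in> F then c k else 0) + (if k \<in> G then d k else 0)"]) auto
qed

lemma trig_polynomial_sum:
  "finite I \<Longrightarrow> (\<And>i. i \<in> I \<Longrightarrow> trig_polynomial (p i)) \<Longrightarrow> trig_polynomial (\<lambda>x. \<Sum>i\<in>I. p i x)"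
  by (induction rule: finite_induct) (auto intro: trig_polynomial_const trig_polynomial_add)

lemma trig_polynomial_mult:
  assumes "trig_polynomial p" "trig_polynomial q" shows "trig_polynomial (\<lambda>x. p x * q x)"
proof -
  obtain F c where F: "finite F" "p = (\<lambda>x. \<Sum>k\<in>F. c k * character k x)"
    using assms(1) by (auto simp: trig_polynomial_def)
  obtain G d where G: "finite G" "q = (\<lambda>x. \<Sum>k\<in>G. d k * character k x)"
    using assms(2) by (auto simp: trig_polynomial_def)
  have "(\<lambda>x. p x * q x) = (\<lambda>x. \<Sum>k\<in>F. \<Sum>l\<in>G. (c k * d l) * character (k + l) x)"
    by (simp add: F(2) G(2) sum_product character_add algebra_simps)
  then show ?thesis
    using F(1) G(1) by (auto intro!: trig_polynomial_sum trig_polynomial_monom)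
qed

text \<open>
  The standard embedding of the torus into \<open>\<complex>\<^sup>n\<close>. Its real and imaginary coordinates are trigonometric
  polynomials, so a polynomial on \<open>\<complex>\<^sup>n\<close> restricts to a trigonometric polynomial and the
  Stone--Weierstrass theorem becomes applicable.
\<close>

definition torus_map :: "real ^ 'n \<Rightarrow> complex ^ 'n" where
  "torus_map x = (\<chi> i. cis (2 * pi * x $ i))"

lemma character_axis: "character (axis i a) x = cis (2 * pi * (x $ i * of_int a))"
proof -
  have "lattice_pt (axis i a) = axis i (of_int a)"
    by (auto simp: vec_eq_iff axis_def)
  then show ?thesis by (simp add: character_def inner_axis)
qed

text \<open>
  Euler's formulas express the cosine and the sine of \<open>2 \<pi> x\<^sub>i\<close> by the characters belonging to
  plus and minus the \<open>i\<close>-th unit vector.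
\<close>

lemma trig_polynomial_coordinate:
  assumes "b \<in> Basis" shows "trig_polynomial (\<lambda>x::real ^ 'n. of_real (torus_map x \<bullet> b))"
proof -
  obtain i u where b: "b = axis i u" and u: "u = 1 \<or> u = \<i>"
    using assms by (auto simp: Basis_vec_def Basis_complex_def)
  have c: "character (axis i 1) x = cis (2 * pi * x $ i)"
       "character (axis i (-1)) x = cnj (cis (2 * pi * x $ i))" for x
    by (simp_all add: character_axis cis_cnj)
  have 1: "torus_map x \<bullet> b = cis (2 * pi * x $ i) \<bullet> u" for x
    by (simp add: b inner_axis torus_map_def)
  from u show ?thesis
  proof
    assume "u = 1"
    then have "(\<lambda>x. of_real (torus_map x \<bullet> b)) =
        (\<lambda>x. (1/2) * character (axis i 1) x + (1/2) * character (axis i (-1)) x)"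
      unfolding 1 c by (auto simp: complex_eq_iff inner_complex_def)
    then show ?thesis by (simp only: trig_polynomial_add trig_polynomial_monom)
  next
    assume "u = \<i>"
    then have "(\<lambda>x. of_real (torus_map x \<bullet> b)) =
        (\<lambda>x. (-\<i>/2) * character (axis i 1) x + (\<i>/2) * character (axis i (-1)) x)"
      unfolding 1 c by (auto simp: complex_eq_iff inner_complex_def)
    then show ?thesis by (simp only: trig_polynomial_add trig_polynomial_monom)
  qed
qed

lemma trig_polynomial_real_polynomial:
  assumes "real_polynomial_function (g :: complex ^ 'n \<Rightarrow> real)"
  shows "trig_polynomial (\<lambda>x. of_real (g (torus_map x)))"
  using assms
proof induction
  case (linear f)
  have "(\<lambda>x. of_real (f (torus_map x)) :: complex) = (\<lambda>x. \<Sum>b\<in>Basis. of_real (torus_map x \<bullet> b) * of_real (f b))"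
  proof
    fix x
    have "f (torus_map x) = (\<Sum>b\<in>Basis. (torus_map x \<bullet> b) *\<^sub>R f b)"
      using linear by (subst (1) euclidean_representation[symmetric, of "torus_map x"])
        (simp only: bounded_linear.linear linear_sum linear_scale)
    then show "of_real (f (torus_map x)) = (\<Sum>b\<in>Basis. of_real (torus_map x \<bullet> b) * complex_of_real (f b))"
      by simp
  qed
  then show ?case
    by (auto intro!: trig_polynomial_sum trig_polynomial_mult trig_polynomial_coordinate trig_polynomial_const)
qed (auto intro: trig_polynomial_const trig_polynomial_add trig_polynomial_mult)

lemma norm_torus_map_le: "norm (torus_map (x :: real ^ 'n)) \<le> of_nat CARD('n)"
proof -
  have "norm (torus_map x) \<le> (\<Sum>i\<in>UNIV. norm (torus_map x $ i))"
    unfolding norm_vec_def by (rule L2_set_le_sum) simp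
  then show ?thesis by (simp add: torus_map_def)
qed

lemma trig_polynomial_uniformly_approximates:
  fixes h :: "complex ^ 'n \<Rightarrow> real"
  assumes "continuous_on UNIV h" "0 < e"
  obtains p where "trig_polynomial p" "\<And>x. cmod (of_real (h (torus_map x)) - p x) < e"
proof -
  obtain g where g: "real_polynomial_function g" 
      "\<And>y. y \<in> cball 0 (of_nat CARD('n)) \<Longrightarrow> \<bar>h y - g y\<bar> < e"
    using Stone_Weierstrass_real_polynomial_function[of "cball 0 (of_nat CARD('n))" h e] assms
    by (metis compact_cball continuous_on_subset top_greatest)
  show thesis
  proof
    show "trig_polynomial (\<lambda>x. complex_of_real (g (torus_map x)))"
      by (rule trig_polynomial_real_polynomial[OF g(1)])
    show "cmod (of_real (h (torus_map x)) - of_real (g (torus_map x))) < e" for x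
      using g(2)[of "torus_map x"] norm_torus_map_le[of x]
      by (simp flip: of_real_diff)
  qed
qed


section \<open>Density of trigonometric polynomials\<close>

definition trig_approximable :: "(real ^ 'n) measure \<Rightarrow> (real ^ 'n \<Rightarrow> complex) \<Rightarrow> bool" where
  "trig_approximable M f \<longleftrightarrow>
     (\<forall>e>0. \<exists>p. trig_polynomial p \<and> sqnorm M (\<lambda>x. f x - p x) < ennreal e)"

lemma ennreal_quarter_bound:
  assumes "a < ennreal (e / 4)" "b < ennreal (e / 4)"
  shows "2 * a + 2 * b < ennreal e"
proof -
  obtain r where r: "0 \<le> r" "a = ennreal r" "r < e/4" using assms(1)
    by (cases a) (auto simp: ennreal_less_iff top_unique)
  obtain s where s: "0 \<le> s" "b = ennreal s" "s < e/4" using assms(2)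
    by (cases b) (auto simp: ennreal_less_iff top_unique)
  have "2 * a + 2 * b = ennreal (2 * r + 2 * s)"
    using r s by (simp add: ennreal_mult)
  also have "\<dots> < ennreal e" using r s by (intro ennreal_lessI) auto
  finally show ?thesis .
qed

context
  fixes M :: "(real ^ 'n) measure"
  assumes sets_M [measurable_cong]: "sets M = sets borel"
begin

lemma trig_approximable_limit:
  assumes [measurable]: "f \<in> borel_measurable M"
    and g: "\<And>e. 0 < e \<Longrightarrow> \<exists>g \<in> borel_measurable M. trig_approximable M g \<and> sqnorm M (\<lambda>x. f x - g x) < ennreal e"
  shows "trig_approximable M f"
  unfolding trig_approximable_def
proof (intro allI impI)
  fix e :: real assume "0 < e"
  then have e: "0 < e / 4" by simp
  obtain g where [measurable]: "g \<in> borel_measurable M"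
    and g: "trig_approximable M g" "sqnorm M (\<lambda>x. f x - g x) < ennreal (e / 4)"
    using g[OF e] by auto
  obtain p where p: "trig_polynomial p" "sqnorm M (\<lambda>x. g x - p x) < ennreal (e / 4)"
    using g(1)[unfolded trig_approximable_def, rule_format, OF e] by auto
  have [measurable]: "p \<in> borel_measurable borel" by (rule trig_polynomial_measurable[OF p(1)])
  have "sqnorm M (\<lambda>x. f x - p x) \<le> 2 * sqnorm M (\<lambda>x. f x - g x) + 2 * sqnorm M (\<lambda>x. g x - p x)"
    by (rule sqnorm_triangle) measurable
  also have "\<dots> < ennreal e" by (rule ennreal_quarter_bound[OF g(2) p(2)])
  finally show "\<exists>p. trig_polynomial p \<and> sqnorm M (\<lambda>x. f x - p x) < ennreal e"
    using p(1) by auto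
qed

lemma trig_approximable_limit_seq:
  assumes "f \<in> borel_measurable M" "\<And>n::nat. g n \<in> borel_measurable M" "\<And>n. trig_approximable M (g n)"
    and "(\<lambda>n. sqnorm M (\<lambda>x. f x - g n x)) \<longlonglongrightarrow> 0"
  shows "trig_approximable M f"
proof (rule trig_approximable_limit)
  fix e :: real assume "0 < e"
  then have "0 < ennreal e" by simp
  then have "\<forall>\<^sub>F n in sequentially. sqnorm M (\<lambda>x. f x - g n x) < ennreal e"
    by (rule order_tendstoD(2)[OF assms(4)])
  then obtain n where "sqnorm M (\<lambda>x. f x - g n x) < ennreal e"
    by (auto simp: eventually_sequentially)
  then show "\<exists>g\<in>borel_measurable M. trig_approximable M g \<and> sqnorm M (\<lambda>x. f x - g x) < ennreal e"
    using assms(2,3) by (intro bexI[of _ "g n"]) auto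
qed (rule assms)

lemma trig_approximable_add:
  assumes [measurable]: "f \<in> borel_measurable M" "g \<in> borel_measurable M"
    and "trig_approximable M f" "trig_approximable M g"
  shows "trig_approximable M (\<lambda>x. f x + g x)"
  unfolding trig_approximable_def
proof (intro allI impI)
  fix e :: real assume "0 < e"
  then have e: "0 < e / 4" by simp
  obtain p where p: "trig_polynomial p" "sqnorm M (\<lambda>x. f x - p x) < ennreal (e / 4)"
    using assms(3)[unfolded trig_approximable_def, rule_format, OF e] by auto
  obtain q where q: "trig_polynomial q" "sqnorm M (\<lambda>x. g x - q x) < ennreal (e / 4)"
    using assms(4)[unfolded trig_approximable_def, rule_format, OF e] by auto
  note [measurable] = trig_polynomial_measurable[OF p(1)] trig_polynomial_measurable[OF q(1)]
  have "sqnorm M (\<lambda>x. (f x + g x) - (p x + q x)) = sqnorm M (\<lambda>x. (f x - p x) + (g x - q x))"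
    by (simp add: algebra_simps)
  also have "\<dots> \<le> 2 * sqnorm M (\<lambda>x. f x - p x) + 2 * sqnorm M (\<lambda>x. g x - q x)"
    by (rule sqnorm_add) measurable
  also have "\<dots> < ennreal e" by (rule ennreal_quarter_bound[OF p(2) q(2)])
  finally show "\<exists>r. trig_polynomial r \<and> sqnorm M (\<lambda>x. (f x + g x) - r x) < ennreal e"
    using trig_polynomial_add[OF p(1) q(1)] by auto
qed

lemma trig_approximable_cmult:
  assumes [measurable]: "f \<in> borel_measurable M" and "trig_approximable M f"
  shows "trig_approximable M (\<lambda>x. c * f x)"
  unfolding trig_approximable_def
proof (intro allI impI)
  fix e :: real assume "0 < e"
  define C where "C = (cmod c)\<^sup>2 + 1"
  have C: "0 < C" unfolding C_def by (simp add: add_nonneg_pos)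
  then have e: "0 < e / C" using \<open>0 < e\<close> by simp
  then obtain p where p: "trig_polynomial p" "sqnorm M (\<lambda>x. f x - p x) < ennreal (e / C)"
    using assms(2)[unfolded trig_approximable_def, rule_format, OF e] by auto
  note [measurable] = trig_polynomial_measurable[OF p(1)]
  obtain r where r: "0 \<le> r" "sqnorm M (\<lambda>x. f x - p x) = ennreal r" "r < e / C" using p(2)
    by (cases "sqnorm M (\<lambda>x. f x - p x)") (auto simp: ennreal_less_iff top_unique)
  have "sqnorm M (\<lambda>x. c * f x - c * p x) = sqnorm M (\<lambda>x. c * (f x - p x))"
    by (simp add: algebra_simps)
  also have "\<dots> = ennreal ((cmod c)\<^sup>2 * r)"
    using r by (subst sqnorm_cmult) (auto simp: ennreal_mult)
  also have "\<dots> < ennreal e"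
  proof (rule ennreal_lessI[OF \<open>0 < e\<close>])
    have "(cmod c)\<^sup>2 * r \<le> C * r" using r(1) by (intro mult_right_mono) (auto simp: C_def)
    also have "\<dots> < e" using r(3) C by (simp add: field_simps)
    finally show "(cmod c)\<^sup>2 * r < e" .
  qed
  finally show "\<exists>r. trig_polynomial r \<and> sqnorm M (\<lambda>x. c * f x - r x) < ennreal e"
    using trig_polynomial_mult[OF trig_polynomial_const p(1)] by auto
qed

lemma trig_approximable_sum:
  assumes "finite I" "\<And>i. i \<in> I \<Longrightarrow> f i \<in> borel_measurable M" "\<And>i. i \<in> I \<Longrightarrow> trig_approximable M (f i)"
  shows "trig_approximable M (\<lambda>x. \<Sum>i\<in>I. f i x)"
  using assms
proof (induction rule: finite_induct)
  case empty
  show ?case unfolding trig_approximable_def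
    using trig_polynomial_const[of 0] by (auto intro!: exI[of _ "\<lambda>_. 0"] simp: sqnorm_def)
next
  case (insert i I)
  then show ?case by (simp add: trig_approximable_add borel_measurable_sum)
qed

lemma torus_map_measurable [measurable]: "torus_map \<in> borel_measurable M"
proof -
  have "continuous_on UNIV (torus_map :: real ^ 'n \<Rightarrow> _)"
    unfolding torus_map_def by (intro continuous_on_vec_lambda continuous_intros)
  then have "(torus_map :: real ^ 'n \<Rightarrow> _) \<in> borel_measurable borel"
    by (rule borel_measurable_continuous_onI)
  then show ?thesis by measurable
qed

lemma trig_approximable_continuous:
  fixes h :: "complex ^ 'n \<Rightarrow> real"
  assumes fin: "finite_measure M" and h: "continuous_on UNIV h"
  shows "trig_approximable M (\<lambda>x. of_real (h (torus_map x)))"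
  unfolding trig_approximable_def
proof (intro allI impI)
  interpret finite_measure M by fact
  fix e :: real assume "0 < e"
  define m where "m = measure M (space M)"
  define d where "d = sqrt (e / (m + 1))"
  have m: "0 \<le> m" by (simp add: m_def)
  then have d: "0 < d" using \<open>0 < e\<close> by (simp add: d_def)
  obtain p where p: "trig_polynomial p" "\<And>x. cmod (of_real (h (torus_map x)) - p x) < d"
    using trig_polynomial_uniformly_approximates[OF h d] by blast
  have "sqnorm M (\<lambda>x. of_real (h (torus_map x)) - p x) \<le> (\<integral>\<^sup>+x. ennreal (d\<^sup>2) \<partial>M)"
    unfolding sqnorm_def by (intro nn_integral_mono ennreal_leI power_mono less_imp_le[OF p(2)]) auto
  also have "\<dots> = ennreal (d\<^sup>2 * m)"
    by (simp add: m_def emeasure_eq_measure ennreal_mult)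
  also have "\<dots> < ennreal e"
    using m \<open>0 < e\<close> by (intro ennreal_lessI) (auto simp: d_def field_simps)
  finally show "\<exists>p. trig_polynomial p \<and> sqnorm M (\<lambda>x. of_real (h (torus_map x)) - p x) < ennreal e"
    using p(1) by auto
qed

text \<open>
  The continuous functions \<open>max 0 (1 - n * infdist y K)\<close> are bounded by 1 and converge pointwise to
  the indicator of \<open>K\<close>, because \<open>K\<close> is closed.
\<close>

lemma trig_approximable_compact:
  fixes K :: "(complex ^ 'n) set"
  assumes fin: "finite_measure M" and K: "compact K"
  shows "trig_approximable M (\<lambda>x. indicator K (torus_map x))"
proof (cases "K = {}")
  case True
  then show ?thesis unfolding trig_approximable_def
    using trig_polynomial_const[of 0] by (auto intro!: exI[of _ "\<lambda>_. 0"] simp: sqnorm_def)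
next
  case False
  interpret finite_measure M by fact
  have K' [measurable]: "K \<in> sets borel" using K by (simp add: borel_compact)
  define h where "h n y = max 0 (1 - real n * infdist y K)" for n y
  have h: "continuous_on UNIV (h n)" for n
    unfolding h_def by (intro continuous_intros)
  have [measurable]: "h n \<in> borel_measurable borel" for n
    by (rule borel_measurable_continuous_onI[OF h])
  show ?thesis
  proof (rule trig_approximable_limit_seq)
    show "trig_approximable M (\<lambda>x. of_real (h n (torus_map x)))" for n
      by (rule trig_approximable_continuous[OF fin h])
    show "(\<lambda>n. sqnorm M (\<lambda>x. indicator K (torus_map x) - of_real (h n (torus_map x)))) \<longlonglongrightarrow> 0"
    proof (rule sqnorm_tendsto_0_dominated[where w="\<lambda>_. 1"])
      have "(\<lambda>n. h n y) \<longlonglongrightarrow> indicator K y" for y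
      proof (cases "y \<in> K")
        case True
        then show ?thesis by (simp add: h_def)
      next
        case 2: False
        have "0 < infdist y K"
          using in_closed_iff_infdist_zero[OF compact_imp_closed[OF K] False, of y] 2 infdist_nonneg[of y K]
          by linarith
        then obtain N where N: "1 < real N * infdist y K"
          using reals_Archimedean3 by blast
        have "h n y = 0" if "n \<ge> N" for n
        proof -
          have "real N * infdist y K \<le> real n * infdist y K"
            using that by (intro mult_right_mono) (auto simp: infdist_nonneg)
          then show ?thesis using N by (simp add: h_def)
        qed
        then have "eventually (\<lambda>n. h n y = 0) sequentially"
          by (auto simp: eventually_sequentially)
        then show ?thesis using 2 by (simp add: tendsto_eventually)
      qed
      then have "(\<lambda>n. complex_of_real (h n y)) \<longlonglongrightarrow> of_real (indicator K y)" for y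
        by (rule tendsto_of_real)
      then show "AE x in M. (\<lambda>n. complex_of_real (h n (torus_map x))) \<longlonglongrightarrow> indicator K (torus_map x)"
        by (simp add: of_real_indicator)
      show "AE x in M. cmod (of_real (h n (torus_map x))) \<le> 1" for n
        by (auto simp: h_def infdist_nonneg)
      show "AE x in M. cmod (indicator K (torus_map x)) \<le> 1"
        by (auto simp: indicator_def)
      show "(\<integral>\<^sup>+x. ennreal (1\<^sup>2) \<partial>M) < \<infinity>" by (simp add: less_top[symmetric])
    qed measurable
  qed measurable
qed

text \<open>
  By inner regularity of the image measure under \<open>torus_map\<close>, a Borel set exceeds some compact subset
  by arbitrarily little.
\<close>

lemma trig_approximable_preimage:
  fixes B :: "(complex ^ 'n) set"
  assumes fin: "finite_measure M" and B [measurable]: "B \<in> sets borel"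
  shows "trig_approximable M (\<lambda>x. indicator B (torus_map x))"
proof (rule trig_approximable_limit)
  interpret finite_measure M by fact
  define N where "N = distr M borel (torus_map :: real ^ 'n \<Rightarrow> complex ^ 'n)"
  interpret N: finite_measure N unfolding N_def by (rule finite_measure_distr) measurable
  fix e :: real assume "0 < e"
  have sup: "emeasure N B = (SUP K \<in> {K. K \<subseteq> B \<and> compact K}. emeasure N K)"
    by (rule inner_regular) (auto simp: N_def N.emeasure_finite[unfolded N_def])
  have "\<exists>K\<in>{K. K \<subseteq> B \<and> compact K}. emeasure N B < emeasure N K + ennreal e"
  proof (rule ccontr)
    assume "\<not> ?thesis"
    then have *: "emeasure N K + ennreal e \<le> emeasure N B" if "K \<subseteq> B" "compact K" for K
      using that by (auto simp: not_less)
    have "ennreal e \<le> emeasure N B" using *[of "{}"] by auto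
    then have "emeasure N K \<le> emeasure N B - ennreal e" if "K \<subseteq> B" "compact K" for K
      using *[OF that] by (intro ennreal_le_minus_iff[THEN iffD2]) (auto simp: add.commute)
    then have "emeasure N B \<le> emeasure N B - ennreal e"
      by (subst sup, intro SUP_least) auto
    then show False
      using \<open>0 < e\<close> \<open>ennreal e \<le> emeasure N B\<close> N.emeasure_finite[of B]
      by (cases "emeasure N B") (auto simp: ennreal_minus)
  qed
  then obtain K where K: "K \<subseteq> B" "compact K" "emeasure N B < emeasure N K + ennreal e" by auto
  have [measurable]: "K \<in> sets borel" using K by (simp add: borel_compact)
  have "sqnorm M (\<lambda>x. indicator B (torus_map x) - indicator K (torus_map x)) =
      (\<integral>\<^sup>+x. indicator (B - K) (torus_map x) \<partial>M)"
    unfolding sqnorm_def using K(1) by (intro nn_integral_cong) (auto simp: indicator_def)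
  also have "\<dots> = emeasure N (B - K)"
    unfolding N_def by (simp add: nn_integral_distr flip: nn_integral_indicator)
  also have "\<dots> = emeasure N B - emeasure N K"
    using K by (intro emeasure_Diff) (auto simp: N_def N.emeasure_finite[unfolded N_def])
  also have "\<dots> < ennreal e"
  proof -
    obtain k where k: "0 \<le> k" "emeasure N K = ennreal k"
      using N.emeasure_finite[of K] by (cases "emeasure N K") auto
    obtain b where b: "0 \<le> b" "emeasure N B = ennreal b"
      using N.emeasure_finite[of B] by (cases "emeasure N B") auto
    have "ennreal b < ennreal (k + e)" using K(3) k b \<open>0 < e\<close> by simp
    then have "b - k < e" using b(1) by (simp add: ennreal_less_iff)
    then show ?thesis using k b \<open>0 < e\<close> by (simp add: ennreal_minus ennreal_lessI)
  qed
  finally show "\<exists>g\<in>borel_measurable M. trig_approximable M g \<and>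
      sqnorm M (\<lambda>x. indicator B (torus_map x) - g x) < ennreal e"
    using trig_approximable_compact[OF fin K(2)] by (intro bexI[of _ "\<lambda>x. indicator K (torus_map x)"]) auto
qed measurable

end

text \<open>
  A Borel left inverse of \<open>torus_map\<close> on the unit cube. Every Borel subset of the cube is therefore
  the preimage under \<open>torus_map\<close> of a Borel set.
\<close>

definition torus_map_inv :: "complex ^ 'n \<Rightarrow> real ^ 'n" where
  "torus_map_inv z = (\<chi> i. frac (Im (Ln (z $ i)) / (2 * pi)))"

lemma torus_map_inv:
  assumes "x \<in> unit_cube" shows "torus_map_inv (torus_map x) = x"
proof -
  have "frac (Im (Ln (cis (2 * pi * x $ i))) / (2 * pi)) = x $ i" for i
  proof -
    have x: "0 \<le> x $ i" "x $ i < 1" using assms by (auto simp: unit_cube_def)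
    have "exp (Ln (cis (2 * pi * x $ i))) = exp (\<i> * of_real (2 * pi * x $ i))"
      by (subst exp_Ln) (auto simp: cis_conv_exp)
    then obtain n :: int where "Ln (cis (2 * pi * x $ i)) = \<i> * of_real (2 * pi * x $ i) + (of_int (2 * n) * pi) * \<i>"
      using exp_eq by blast
    then have "Im (Ln (cis (2 * pi * x $ i))) = 2 * pi * x $ i + of_int (2 * n) * pi" by simp
    then have "Im (Ln (cis (2 * pi * x $ i))) / (2 * pi) = x $ i + of_int n"
      by (simp add: field_simps)
    then show ?thesis using x by (simp add: frac_unique_iff)
  qed
  then show ?thesis by (simp add: torus_map_inv_def torus_map_def vec_eq_iff)
qed

lemma measurable_vec_lambda:
  assumes "\<And>i. (\<lambda>x. f x i) \<in> borel_measurable M"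
  shows "(\<lambda>x. (\<chi> i. f x i) :: real ^ 'n) \<in> borel_measurable M"
proof (subst borel_measurable_euclidean_space, intro ballI)
  fix b :: "real ^ 'n" assume "b \<in> Basis"
  then obtain i where "b = axis i 1" by (auto simp: Basis_vec_def)
  then show "(\<lambda>x. (\<chi> i. f x i) \<bullet> b) \<in> borel_measurable M" by (simp add: inner_axis assms)
qed

lemma measurable_vec_nth [measurable]: "(\<lambda>z :: 'b::real_normed_vector ^ 'n. z $ i) \<in> borel_measurable borel"
  by (intro borel_measurable_continuous_onI continuous_intros)

lemma frac_measurable: "(frac :: real \<Rightarrow> real) \<in> borel_measurable borel"
  unfolding frac_def by measurable

lemma torus_map_inv_measurable [measurable]: "torus_map_inv \<in> borel_measurable borel"
  unfolding torus_map_inv_def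
proof (rule measurable_vec_lambda)
  note [measurable] = Ln_measurable frac_measurable
  show "(\<lambda>x :: complex ^ 'a. frac (Im (Ln (x $ i)) / (2 * pi))) \<in> borel_measurable borel" for i
    by measurable
qed

text \<open>
  Indicators of Borel sets are approximable because they agree on the cube with indicators of
  preimages under \<open>torus_map\<close>. Linear combinations give simple functions, and a square integrable
  function is a dominated limit of simple functions.
\<close>

theorem trig_approximable_square_integrable:
  fixes M :: "(real ^ 'n) measure"
  assumes sets_M [measurable_cong]: "sets M = sets borel" and fin: "finite_measure M"
    and cube: "AE x in M. x \<in> unit_cube"
    and f [measurable]: "f \<in> borel_measurable borel" and fin2: "sqnorm M f < \<infinity>"
  shows "trig_approximable M f"
proof -
  interpret finite_measure M by fact
  have ind: "trig_approximable M (indicator A)" if [measurable]: "A \<in> sets borel" for A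
  proof -
    define B where "B = torus_map_inv -` A"
    have [measurable]: "B \<in> sets borel"
      unfolding B_def using measurable_sets_borel[OF torus_map_inv_measurable that] by simp
    have "trig_approximable M (\<lambda>x. indicator B (torus_map x))"
      by (rule trig_approximable_preimage[OF sets_M fin]) measurable
    moreover have "sqnorm M (\<lambda>x. indicator B (torus_map x) - p x) = sqnorm M (\<lambda>x. indicator A x - p x)" for p
      by (rule sqnorm_cong_AE) (use cube in eventually_elim, auto simp: B_def indicator_def torus_map_inv)
    ultimately show ?thesis by (simp add: trig_approximable_def)
  qed
  obtain s where s: "\<And>i. simple_function borel (s i)" "\<And>x. (\<lambda>i. s i x) \<longlonglongrightarrow> f x"
      "\<And>i x. dist (s i x) 0 \<le> 2 * dist (f x) 0"
    using borel_measurable_implies_sequence_metric[OF f, of 0] by auto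
  have [measurable]: "s i \<in> borel_measurable borel" for i
    by (rule borel_measurable_simple_function[OF s(1)])
  show ?thesis
  proof (rule trig_approximable_limit_seq[OF sets_M])
    show "trig_approximable M (s i)" for i
    proof -
      have "s i = (\<lambda>x. \<Sum>y\<in>range (s i). y * indicator (s i -` {y}) x)"
      proof
        fix x
        have "(\<Sum>y\<in>range (s i). y * indicator (s i -` {y}) x) = (\<Sum>y\<in>range (s i). if y = s i x then y else 0)"
          by (intro sum.cong) (auto simp: indicator_def)
        then show "s i x = (\<Sum>y\<in>range (s i). y * indicator (s i -` {y}) x)"
          using simple_functionD(1)[OF s(1)[of i]] by simp
      qed
      moreover have "trig_approximable M (\<lambda>x. \<Sum>y\<in>range (s i). y * indicator (s i -` {y}) x)"
      proof (rule trig_approximable_sum[OF sets_M])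
        show "finite (range (s i))" using simple_functionD(1)[OF s(1)[of i]] by simp
        have [measurable]: "s i -` {y} \<in> sets borel" for y
          using simple_functionD(2)[OF s(1)[of i], of "{y}"] by simp
        show "trig_approximable M (\<lambda>x. y * indicator (s i -` {y}) x)" for y
          by (rule trig_approximable_cmult[OF sets_M _ ind]) measurable
        show "(\<lambda>x. y * indicator (s i -` {y}) x) \<in> borel_measurable M" for y by measurable
      qed
      ultimately show ?thesis by simp
    qed
    show "(\<lambda>i. sqnorm M (\<lambda>x. f x - s i x)) \<longlonglongrightarrow> 0"
    proof (rule sqnorm_tendsto_0_dominated[where w="\<lambda>x. 2 * cmod (f x)"])
      show "(\<integral>\<^sup>+x. ennreal ((2 * cmod (f x))\<^sup>2) \<partial>M) < \<infinity>"
        using fin2 sqnorm_cmult[of f M 2] by (simp add: sqnorm_def norm_mult ennreal_mult_less_top)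
      show "AE x in M. cmod (s n x) \<le> 2 * cmod (f x)" for n using s(3) by auto
    qed (use s(2) in auto)
  qed measurable
qed


section \<open>Inner products of square integrable functions\<close>

definition l2 :: "'a measure \<Rightarrow> ('a \<Rightarrow> complex) \<Rightarrow> bool" where
  "l2 M f \<longleftrightarrow> f \<in> borel_measurable M \<and> sqnorm M f < \<infinity>"

definition l2_inner :: "'a measure \<Rightarrow> ('a \<Rightarrow> complex) \<Rightarrow> ('a \<Rightarrow> complex) \<Rightarrow> complex" where
  "l2_inner M f g = (LINT x|M. f x * cnj (g x))"

lemma square_integrable_iff_l2: "square_integrable f \<longleftrightarrow> l2 lborel f"
  unfolding square_integrable_def l2_def sqnorm_def
  by (auto simp: integrable_iff_bounded)

lemma L2_inner_eq: "L2_inner f g = l2_inner lborel f g"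
  by (simp add: L2_inner_def l2_inner_def)

lemma l2_measurable [measurable_dest]: "l2 M f \<Longrightarrow> f \<in> borel_measurable M"
  by (simp add: l2_def)

lemma l2_finite: "l2 M f \<Longrightarrow> sqnorm M f < \<infinity>"
  by (simp add: l2_def)

lemma l2_add: assumes "l2 M f" "l2 M g" shows "l2 M (\<lambda>x. f x + g x)"
proof -
  note [measurable] = assms[THEN l2_measurable]
  have "sqnorm M (\<lambda>x. f x + g x) \<le> 2 * sqnorm M f + 2 * sqnorm M g" by (rule sqnorm_add) measurable
  also have "\<dots> < \<infinity>" using assms[THEN l2_finite] by (simp add: ennreal_mult_less_top)
  finally show ?thesis unfolding l2_def by simp
qed

lemma l2_cmult: assumes "l2 M f" shows "l2 M (\<lambda>x. c * f x)"
proof -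
  note [measurable] = assms[THEN l2_measurable]
  show ?thesis using assms by (simp add: l2_def sqnorm_cmult ennreal_mult_less_top)
qed

lemma l2_diff: assumes "l2 M f" "l2 M g" shows "l2 M (\<lambda>x. f x - g x)"
  using l2_add[OF assms(1) l2_cmult[OF assms(2), of "-1"]] by simp

lemma l2_zero [simp]: "l2 M (\<lambda>x. 0)"
  by (simp add: l2_def sqnorm_def)

lemma l2_sum: "finite I \<Longrightarrow> (\<And>i. i \<in> I \<Longrightarrow> l2 M (f i)) \<Longrightarrow> l2 M (\<lambda>x. \<Sum>i\<in>I. f i x)"
  by (induction rule: finite_induct) (auto intro: l2_add)

lemma borel_measurable_cnj [measurable (raw)]:
  "f \<in> borel_measurable M \<Longrightarrow> (\<lambda>x. cnj (f x)) \<in> borel_measurable M"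
  by (erule measurable_compose) (intro borel_measurable_continuous_onI continuous_intros)

lemma l2_integrable_mult:
  assumes "l2 M f" "l2 M g" shows "integrable M (\<lambda>x. f x * cnj (g x))"
proof (rule integrableI_bounded)
  note [measurable] = assms[THEN l2_measurable]
  show "(\<lambda>x. f x * cnj (g x)) \<in> borel_measurable M" by measurable
  have "(\<integral>\<^sup>+x. ennreal (norm (f x * cnj (g x))) \<partial>M) \<le>
      (\<integral>\<^sup>+x. ennreal ((cmod (f x))\<^sup>2) + ennreal ((cmod (g x))\<^sup>2) \<partial>M)"
  proof (rule nn_integral_mono)
    fix x
    have "2 * (cmod (f x) * cmod (g x)) \<le> (cmod (f x))\<^sup>2 + (cmod (g x))\<^sup>2"
      using sum_squares_bound[of "cmod (f x)" "cmod (g x)"] by simp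
    moreover have "0 \<le> cmod (f x) * cmod (g x)" by simp
    ultimately have "cmod (f x) * cmod (g x) \<le> (cmod (f x))\<^sup>2 + (cmod (g x))\<^sup>2" by linarith
    then show "ennreal (norm (f x * cnj (g x))) \<le> ennreal ((cmod (f x))\<^sup>2) + ennreal ((cmod (g x))\<^sup>2)"
      by (simp add: norm_mult ennreal_leI flip: ennreal_plus)
  qed
  also have "\<dots> = sqnorm M f + sqnorm M g" unfolding sqnorm_def by (rule nn_integral_add) auto
  also have "\<dots> < \<infinity>" using assms by (simp add: l2_def)
  finally show "(\<integral>\<^sup>+x. ennreal (norm (f x * cnj (g x))) \<partial>M) < \<infinity>" .
qed

lemma l2_inner_commute: "l2_inner M g f = cnj (l2_inner M f g)"
  using Bochner_Integration.integral_cnj[of M "\<lambda>x. f x * cnj (g x)"] by (simp add: l2_inner_def mult.commute)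

lemma l2_inner_diff_left:
  "l2 M f \<Longrightarrow> l2 M g \<Longrightarrow> l2 M h \<Longrightarrow> l2_inner M (\<lambda>x. f x - g x) h = l2_inner M f h - l2_inner M g h"
  unfolding l2_inner_def
  by (subst Bochner_Integration.integral_diff[symmetric]) (auto intro: l2_integrable_mult simp: algebra_simps)

lemma l2_inner_diff_right:
  "l2 M f \<Longrightarrow> l2 M g \<Longrightarrow> l2 M h \<Longrightarrow> l2_inner M h (\<lambda>x. f x - g x) = l2_inner M h f - l2_inner M h g"
  by (simp add: l2_inner_commute[of M h] l2_inner_diff_left)

lemma l2_inner_cmult_left: "l2_inner M (\<lambda>x. c * f x) h = c * l2_inner M f h"
  unfolding l2_inner_def by (simp add: mult.assoc)

lemma l2_inner_sum_left:
  "finite I \<Longrightarrow> (\<And>i. i \<in> I \<Longrightarrow> l2 M (f i)) \<Longrightarrow> l2 M h \<Longrightarrow>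
    l2_inner M (\<lambda>x. \<Sum>i\<in>I. f i x) h = (\<Sum>i\<in>I. l2_inner M (f i) h)"
  unfolding l2_inner_def by (simp add: sum_distrib_right Bochner_Integration.integral_sum l2_integrable_mult)

lemma sqnorm_eq_inner: assumes "l2 M f" shows "sqnorm M f = ennreal (Re (l2_inner M f f))"
proof -
  note [measurable] = assms[THEN l2_measurable]
  have i: "integrable M (\<lambda>x. (cmod (f x))\<^sup>2)"
    using assms by (auto simp: l2_def sqnorm_def integrable_iff_bounded)
  have "l2_inner M f f = (LINT x|M. complex_of_real ((cmod (f x))\<^sup>2))"
    unfolding l2_inner_def by (simp only: complex_norm_square)
  also have "\<dots> = of_real (LINT x|M. (cmod (f x))\<^sup>2)" by (rule integral_complex_of_real)
  finally have "Re (l2_inner M f f) = (LINT x|M. (cmod (f x))\<^sup>2)" by simp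
  then show ?thesis using i by (simp add: sqnorm_def nn_integral_eq_integral)
qed

lemma l2_inner_self_nonneg: "0 \<le> Re (l2_inner M f f)"
proof -
  have "l2_inner M f f = (LINT x|M. complex_of_real ((cmod (f x))\<^sup>2))"
    unfolding l2_inner_def by (simp only: complex_norm_square)
  also have "\<dots> = of_real (LINT x|M. (cmod (f x))\<^sup>2)" by (rule integral_complex_of_real)
  finally show ?thesis by simp
qed

lemma l2_inner_diff_self:
  assumes "l2 M f" "l2 M g"
  shows "Re (l2_inner M (\<lambda>x. f x - g x) (\<lambda>x. f x - g x)) =
    Re (l2_inner M f f) - 2 * Re (l2_inner M f g) + Re (l2_inner M g g)"
  using assms by (simp add: l2_inner_diff_left l2_inner_diff_right l2_diff l2_inner_commute[of M g f])

section \<open>Sums over a countable index\<close>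

text \<open>
  Both sides are suprema of sums over finite sets; on the right-hand side the finite initial segments
  of an enumeration suffice, by monotone convergence. This makes Tonelli's theorem available for the
  sums in the definition of the weight.
\<close>

lemma infsum_ennreal_eq_nn_integral:
  fixes f :: "'a::countable \<Rightarrow> ennreal"
  shows "infsum f UNIV = (\<integral>\<^sup>+x. f x \<partial>count_space UNIV)"
proof (rule antisym)
  have s: "infsum f UNIV = (SUP F\<in>{F. finite F}. sum f F)"
    using nonneg_infsum_complete[of UNIV f] by simp
  show "infsum f UNIV \<le> (\<integral>\<^sup>+x. f x \<partial>count_space UNIV)"
    unfolding s
  proof (rule SUP_least)
    fix F :: "'a set" assume "F \<in> {F. finite F}"
    then have "sum f F = (\<integral>\<^sup>+x. f x * indicator F x \<partial>count_space UNIV)"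
      by (simp add: nn_integral_count_space_finite flip: nn_integral_count_space_indicator)
    also have "\<dots> \<le> (\<integral>\<^sup>+x. f x \<partial>count_space UNIV)"
      by (intro nn_integral_mono) (auto simp: indicator_def)
    finally show "sum f F \<le> (\<integral>\<^sup>+x. f x \<partial>count_space UNIV)" .
  qed
  define F where "F n = {x :: 'a. to_nat x < n}" for n
  have F: "finite (F n)" for n
    unfolding F_def by (rule finite_imageD[of to_nat]) (auto intro: finite_subset[of _ "{..<n}"] simp: inj_on_def)
  have "(\<integral>\<^sup>+x. f x \<partial>count_space UNIV) = (\<integral>\<^sup>+x. (SUP n. f x * indicator (F n) x) \<partial>count_space UNIV)"
  proof (rule nn_integral_cong)
    fix x
    show "f x = (SUP n. f x * indicator (F n) x)"
    proof (rule antisym)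
      have "f x = f x * indicator (F (Suc (to_nat x))) x" by (simp add: F_def)
      also have "\<dots> \<le> (SUP n. f x * indicator (F n) x)" by (rule SUP_upper) simp
      finally show "f x \<le> (SUP n. f x * indicator (F n) x)" .
    qed (auto intro!: SUP_least simp: indicator_def)
  qed
  also have "\<dots> = (SUP n. \<integral>\<^sup>+x. f x * indicator (F n) x \<partial>count_space UNIV)"
    by (rule nn_integral_monotone_convergence_SUP)
       (auto simp: incseq_def le_fun_def F_def indicator_def)
  also have "\<dots> = (SUP n. sum f (F n))"
    using F by (simp add: nn_integral_count_space_finite flip: nn_integral_count_space_indicator)
  also have "\<dots> \<le> infsum f UNIV"
    unfolding s using F by (intro SUP_least SUP_upper) auto
  finally show "(\<integral>\<^sup>+x. f x \<partial>count_space UNIV) \<le> infsum f UNIV" .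
qed

lemma nn_integral_count_space_eq_SUP:
  fixes f :: "'a::countable \<Rightarrow> ennreal"
  shows "(\<integral>\<^sup>+x. f x \<partial>count_space UNIV) = (SUP F\<in>{F. finite F}. sum f F)"
  using nonneg_infsum_complete[of UNIV f] by (simp flip: infsum_ennreal_eq_nn_integral)

text \<open>
  This translates the unordered sums of condition C into integrals over counting measure, to which
  Fubini's theorem applies.
\<close>

lemma has_sum_imp_lebesgue_integral:
  fixes f :: "'a \<Rightarrow> complex"
  assumes "integrable (count_space UNIV) f" "(f has_sum s) UNIV"
  shows "(LINT x|count_space UNIV. f x) = s"
proof -
  have a: "Infinite_Set_Sum.abs_summable_on f UNIV"
    using assms(1) by (simp add: Infinite_Set_Sum.abs_summable_on_def)
  have "(LINT x|count_space UNIV. f x) = infsetsum f UNIV"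
    by (simp add: infsetsum_def)
  also have "\<dots> = infsum f UNIV" by (rule infsetsum_infsum[OF a])
  finally show ?thesis using infsumI[OF assms(2)] by simp
qed

section \<open>Periodization\<close>

lemma torus_eq: "torus = restrict_space lborel unit_cube"
  by (simp add: torus_def unit_cube_def)

lemma unit_cube_measurable [measurable]: "unit_cube \<in> sets borel"
proof -
  have "unit_cube = (\<Inter>i\<in>UNIV. {x :: real ^ 'n. 0 \<le> x $ i} \<inter> {x. x $ i < 1})"
    by (auto simp: unit_cube_def)
  also have "\<dots> \<in> sets borel"
    by (intro sets.countable_INT'' sets.Int borel_measurable_le borel_measurable_less) auto
  finally show ?thesis .
qed

lemma nn_integral_torus: "(\<integral>\<^sup>+x. f x \<partial>torus) = (\<integral>\<^sup>+x. f x * indicator unit_cube x \<partial>lborel)"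
  unfolding torus_eq by (rule nn_integral_restrict_space) simp

lemma integral_torus: "(LINT x|torus. f x :: complex) = (LINT x|lborel. indicator unit_cube x *\<^sub>R f x)"
  unfolding torus_eq by (rule integral_restrict_space) simp

lemma measurable_torus [measurable (raw)]: "f \<in> borel \<rightarrow>\<^sub>M N \<Longrightarrow> f \<in> torus \<rightarrow>\<^sub>M N"
  unfolding torus_eq by (rule measurable_restrict_space1) simp

lemma emeasure_unit_cube: "emeasure lborel (unit_cube :: (real ^ 'n) set) = 1"
proof -
  have b: "(\<Prod>b\<in>Basis. (One - 0 :: real ^ 'n) \<bullet> b) = 1" by (intro prod.neutral) simp
  have One: "(One :: real ^ 'n) $ i = 1" for i
    unfolding cart_eq_inner_axis by (simp add: inner_sum_left inner_Basis axis_in_Basis_iff)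
  have "box 0 One \<subseteq> (unit_cube :: (real ^ 'n) set)"
    by (auto simp: unit_cube_def mem_box_cart One less_imp_le simp del: sum_component)
  then have "emeasure lborel (box 0 One :: (real ^ 'n) set) \<le> emeasure lborel (unit_cube :: (real ^ 'n) set)"
    by (intro emeasure_mono) auto
  moreover have "(unit_cube :: (real ^ 'n) set) \<subseteq> cbox 0 One"
    by (auto simp: unit_cube_def mem_box_cart One less_imp_le simp del: sum_component)
  then have "emeasure lborel (unit_cube :: (real ^ 'n) set) \<le> emeasure lborel (cbox 0 One :: (real ^ 'n) set)"
    by (intro emeasure_mono) auto
  ultimately show ?thesis by (simp add: emeasure_lborel_box_eq emeasure_lborel_cbox_eq b)
qed

lemma finite_measure_torus: "finite_measure (torus :: (real ^ 'n) measure)"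
  by (rule finite_measureI) (simp add: torus_eq space_restrict_space emeasure_restrict_space emeasure_unit_cube)

text \<open>
  The unique integer translate of \<open>x\<close> in the cube is the vector of fractional parts.
\<close>

lemma unit_cube_translates:
  obtains m where "\<And>k. x + lattice_pt k \<in> unit_cube \<longleftrightarrow> k = m"
proof
  show "x + lattice_pt k \<in> unit_cube \<longleftrightarrow> k = (\<chi> i. - \<lfloor>x $ i\<rfloor>)" for k
  proof -
    have "0 \<le> x $ i + of_int (k $ i) \<and> x $ i + of_int (k $ i) < 1 \<longleftrightarrow> k $ i = - \<lfloor>x $ i\<rfloor>" for i
      by linarith
    then show ?thesis by (simp add: unit_cube_def vec_eq_iff)
  qed
qed

lemma nn_integral_translate:
  fixes f :: "'a::euclidean_space \<Rightarrow> ennreal"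
  assumes "f \<in> borel_measurable borel"
  shows "(\<integral>\<^sup>+x. f (x + c) \<partial>lborel) = (\<integral>\<^sup>+x. f x \<partial>lborel)"
proof -
  have "(\<integral>\<^sup>+x. f x \<partial>lborel) = (\<integral>\<^sup>+x. f x \<partial>distr lborel borel ((+) c))"
    by (simp add: lborel_distr_plus)
  also have "\<dots> = (\<integral>\<^sup>+x. f (x + c) \<partial>lborel)"
    using assms by (subst nn_integral_distr) (auto simp: add.commute)
  finally show ?thesis ..
qed

text \<open>
  Euclidean space is the disjoint union of the integer translates of the unit cube. As an identity of
  measures this yields the periodization formula for nonnegative and for integrable functions alike.
\<close>

lemma lborel_eq_periodization:
  "(lborel :: (real ^ 'n) measure) =
    distr (count_space UNIV \<Otimes>\<^sub>M torus) borel (\<lambda>(m, \<xi>). \<xi> + lattice_pt m)" (is "_ = distr ?P borel ?t")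
proof (rule measure_eqI)
  interpret T: finite_measure "torus :: (real ^ 'n) measure" by (rule finite_measure_torus)
  have t [measurable]: "?t \<in> ?P \<rightarrow>\<^sub>M borel"
    by (rule measurable_pair_measure_countable1) auto
  show "sets lborel = sets (distr ?P borel ?t)" by simp
  fix A :: "(real ^ 'n) set" assume "A \<in> sets lborel"
  then have [measurable]: "A \<in> sets borel" by simp
  define X where "X m = A \<inter> {x. x + lattice_pt (- m) \<in> unit_cube}" for m
  have X [measurable]: "X m \<in> sets borel" for m unfolding X_def by measurable
  have "emeasure (distr ?P borel ?t) A = (\<integral>\<^sup>+p. indicator A (?t p) \<partial>?P)"
    using nn_integral_distr[OF t, of "indicator A"] by simp
  also have "\<dots> = (\<integral>\<^sup>+m. \<integral>\<^sup>+\<xi>. indicator A (\<xi> + lattice_pt m) \<partial>torus \<partial>count_space UNIV)"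
    by (subst T.nn_integral_fst[symmetric]) auto
  also have "\<dots> = (\<integral>\<^sup>+m. emeasure lborel (X m) \<partial>count_space UNIV)"
  proof (rule nn_integral_cong)
    fix m :: "int ^ 'n"
    have "(\<integral>\<^sup>+\<xi>. indicator A (\<xi> + lattice_pt m) \<partial>torus) =
        (\<integral>\<^sup>+\<xi>. indicator (X m) (\<xi> + lattice_pt m) \<partial>lborel)"
      unfolding nn_integral_torus by (intro nn_integral_cong) (auto simp: X_def indicator_def)
    also have "\<dots> = (\<integral>\<^sup>+\<xi>. indicator (X m) \<xi> \<partial>lborel)" by (rule nn_integral_translate) simp
    finally show "(\<integral>\<^sup>+\<xi>. indicator A (\<xi> + lattice_pt m) \<partial>torus) = emeasure lborel (X m)" by simp
  qed
  also have "\<dots> = emeasure lborel (\<Union>m. X m)"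
  proof (rule emeasure_UN_countable[symmetric])
    show "disjoint_family X"
    proof (unfold disjoint_family_on_def, intro ballI impI)
      fix m k :: "int ^ 'n" assume mk: "m \<noteq> k"
      show "X m \<inter> X k = {}"
      proof (rule equals0I)
        fix x assume x: "x \<in> X m \<inter> X k"
        obtain a where a: "\<And>k. x + lattice_pt k \<in> unit_cube \<longleftrightarrow> k = a"
          using unit_cube_translates[of x] by metis
        have "- m = a" "- k = a" using x a[of "- m"] a[of "- k"] by (auto simp: X_def)
        then show False using mk by auto
      qed
    qed
  qed auto
  also have "(\<Union>m. X m) = A"
  proof
    show "A \<subseteq> (\<Union>m. X m)"
    proof
      fix x assume "x \<in> A"
      obtain m where m: "\<And>k. x + lattice_pt k \<in> unit_cube \<longleftrightarrow> k = m"
        using unit_cube_translates[of x] by metis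
      have "x \<in> X (- m)" using m[of m] \<open>x \<in> A\<close> by (simp add: X_def)
      then show "x \<in> (\<Union>m. X m)" by blast
    qed
  qed (auto simp: X_def)
  finally show "emeasure lborel A = emeasure (distr ?P borel ?t) A" ..
qed

lemma pair_sigma_finite_count_torus:
  "pair_sigma_finite (count_space (UNIV :: (int ^ 'n) set)) (torus :: (real ^ 'n) measure)"
  using finite_measure_torus
  by (intro pair_sigma_finite.intro sigma_finite_measure_count_space finite_measure.axioms(1))

lemma translate_measurable [measurable]:
  "(\<lambda>(m, \<xi>). \<xi> + lattice_pt m) \<in> count_space UNIV \<Otimes>\<^sub>M (torus :: (real ^ 'n) measure) \<rightarrow>\<^sub>M borel"
  by (rule measurable_pair_measure_countable1) auto

lemma nn_integral_periodize:
  fixes f :: "real ^ 'n \<Rightarrow> ennreal"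
  assumes [measurable]: "f \<in> borel_measurable borel"
  shows "(\<integral>\<^sup>+x. f x \<partial>lborel) = (\<integral>\<^sup>+\<xi>. \<integral>\<^sup>+m. f (\<xi> + lattice_pt m) \<partial>count_space UNIV \<partial>torus)"
proof -
  interpret pair_sigma_finite "count_space (UNIV :: (int ^ 'n) set)" "torus :: (real ^ 'n) measure"
    by (rule pair_sigma_finite_count_torus)
  have "(\<integral>\<^sup>+x. f x \<partial>lborel) = (\<integral>\<^sup>+p. f ((\<lambda>(m, \<xi>). \<xi> + lattice_pt m) p) \<partial>(count_space UNIV \<Otimes>\<^sub>M torus))"
    by (subst lborel_eq_periodization) (simp add: nn_integral_distr)
  also have "\<dots> = (\<integral>\<^sup>+\<xi>. \<integral>\<^sup>+m. f (\<xi> + lattice_pt m) \<partial>count_space UNIV \<partial>torus)"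
    by (subst nn_integral_snd[symmetric]) auto
  finally show ?thesis .
qed

lemma integral_periodize:
  fixes f :: "real ^ 'n \<Rightarrow> complex"
  assumes f: "integrable lborel f"
  shows "AE \<xi> in torus. integrable (count_space UNIV) (\<lambda>m. f (\<xi> + lattice_pt m))"
    and "integrable torus (\<lambda>\<xi>. LINT m|count_space UNIV. f (\<xi> + lattice_pt m))"
    and "(LINT x|lborel. f x) = (LINT \<xi>|torus. LINT m|count_space UNIV. f (\<xi> + lattice_pt m))"
proof -
  interpret pair_sigma_finite "count_space (UNIV :: (int ^ 'n) set)" "torus :: (real ^ 'n) measure"
    by (rule pair_sigma_finite_count_torus)
  have [measurable]: "f \<in> borel_measurable borel" using f by auto
  have i: "integrable (count_space UNIV \<Otimes>\<^sub>M torus) (\<lambda>(m, \<xi>). f (\<xi> + lattice_pt m))"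
    using f by (subst (asm) lborel_eq_periodization) (simp add: integrable_distr_eq case_prod_unfold)
  show "AE \<xi> in torus. integrable (count_space UNIV) (\<lambda>m. f (\<xi> + lattice_pt m))"
    by (rule AE_integrable_snd[OF i])
  show "integrable torus (\<lambda>\<xi>. LINT m|count_space UNIV. f (\<xi> + lattice_pt m))"
    by (rule integrable_snd[OF i])
  have "(LINT x|lborel. f x) = (LINT p|(count_space UNIV \<Otimes>\<^sub>M torus). (\<lambda>(m, \<xi>). f (\<xi> + lattice_pt m)) p)"
    by (subst lborel_eq_periodization) (simp add: integral_distr case_prod_unfold)
  then show "(LINT x|lborel. f x) = (LINT \<xi>|torus. LINT m|count_space UNIV. f (\<xi> + lattice_pt m))"
    by (simp add: integral_snd[OF i])
qed


section \<open>Fourier series on the torus\<close>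

lemma character_measurable' [measurable]: "character k \<in> borel_measurable torus"
  by measurable

lemma nn_integral_torus_1: "(\<integral>\<^sup>+x. 1 \<partial>(torus :: (real ^ 'n) measure)) = 1"
  unfolding nn_integral_torus by (simp add: emeasure_unit_cube)

lemma emeasure_space_torus [simp]: "emeasure torus (space (torus :: (real ^ 'n) measure)) = 1"
  using nn_integral_torus_1 by simp

lemma l2_character: "l2 torus (character k)"
  by (simp add: l2_def sqnorm_def)

lemma integrable_torus_bounded:
  fixes f :: "real ^ 'n \<Rightarrow> complex"
  assumes "f \<in> borel_measurable torus" "\<And>x. cmod (f x) \<le> B"
  shows "integrable torus f"
proof -
  interpret finite_measure "torus :: (real ^ 'n) measure" by (rule finite_measure_torus)
  show ?thesis using assms by (intro integrable_const_bound[of _ B]) auto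
qed

lemma integral_translate:
  fixes f :: "'a::euclidean_space \<Rightarrow> complex"
  assumes [measurable]: "f \<in> borel_measurable borel"
  shows "(LINT x|lborel. f (x + c)) = (LINT x|lborel. f x)"
proof -
  have "(LINT x|lborel. f x) = (LINT x|distr lborel borel ((+) c). f x)"
    by (simp add: lborel_distr_plus)
  also have "\<dots> = (LINT x|lborel. f (x + c))"
    by (subst integral_distr) (auto simp: add.commute)
  finally show ?thesis ..
qed

text \<open>
  For \<open>k \<noteq> 0\<close> choose \<open>s\<close> such that the character takes the value -1 at \<open>s\<close>. The integral of the character over
  the translated cube is minus the integral over the cube; but periodization shows that the integral
  of a periodic function over both sets is the same.
\<close>

lemma integral_character:
  fixes k :: "int ^ 'n"
  shows "(LINT x|torus. character k x) = (if k = 0 then 1 else 0)"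
proof (cases "k = 0")
  case True
  have "(LINT x|(torus :: (real ^ 'n) measure). 1 :: complex) = 1"
    using nn_integral_torus_1[where 'n='n] by (simp add: measure_def)
  then show ?thesis using True by simp
next
  case False
  then obtain i where i: "k $ i \<noteq> 0" by (auto simp: vec_eq_iff)
  \<comment> \<open>Half a period of the character in a direction in which it is not constant.\<close>
  define s :: "real ^ 'n" where "s = axis i (1 / (2 * real_of_int (k $ i)))"
  have cs: "character k s = -1"
    using i by (simp add: character_def s_def inner_axis' cis_pi)
  define f where "f x = (indicator unit_cube (x - s) *\<^sub>R character k x :: complex)" for x
  have [measurable]: "f \<in> borel_measurable borel" unfolding f_def by measurable
  have "f (x + s) = - (indicator unit_cube x *\<^sub>R character k x)" for x
    by (simp add: f_def character_plus cs)
  moreover have fi: "integrable lborel (\<lambda>x. indicator unit_cube x *\<^sub>R character k x)"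
    using integrable_torus_bounded[of "character k" 1, OF character_measurable']
    by (simp add: torus_eq integrable_restrict_space)
  ultimately have fs: "(LINT x|lborel. f (x + s)) = - (LINT x|torus. character k x)"
      "integrable lborel (\<lambda>x. f (x + s))"
    by (simp_all add: integral_torus)
  have f_int: "integrable lborel f"
  proof -
    have "integrable (distr lborel borel ((+) s)) f"
      using fs(2) by (subst integrable_distr_eq) (auto simp: add.commute)
    then show ?thesis by (simp add: lborel_distr_plus)
  qed
  have "(LINT m|count_space UNIV. f (\<xi> + lattice_pt m)) = character k \<xi>" for \<xi>
  proof -
    obtain a where a: "\<And>m. (\<xi> - s) + lattice_pt m \<in> unit_cube \<longleftrightarrow> m = a"
      using unit_cube_translates[of "\<xi> - s"] by metis
    have eq: "f (\<xi> + lattice_pt m) = (if m = a then character k \<xi> else 0)" for m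
      using a[of m] by (cases "m = a") (auto simp: f_def algebra_simps)
    have "{m. (if m = a then character k \<xi> else 0) \<noteq> 0} = {a}"
      by (auto simp: character_def)
    then show ?thesis unfolding eq
      by (subst lebesgue_integral_count_space_finite_support) auto
  qed
  then have "(LINT x|lborel. f x) = (LINT x|torus. character k x)"
    using integral_periodize(3)[OF f_int] by simp
  moreover have "(LINT x|lborel. f x) = - (LINT x|torus. character k x)"
    using integral_translate[of f s] fs(1) by simp
  ultimately show ?thesis using False by simp
qed

lemma character_orthonormal: "l2_inner torus (character k) (character l) = (if k = l then 1 else 0)"
proof -
  have "character k x * cnj (character l x) = character (k - l) x" for x
    using character_add[of k "- l" x] by (simp add: character_uminus)
  then show ?thesis by (simp add: l2_inner_def integral_character)
qed

text \<open>
  The density theorem for the measure with density \<open>w\<close> on the cube. It is applied with \<open>w = 1\<close>, with the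
  modulus of an integrable function, and with the weight of \<open>\<phi>\<close>.
\<close>

lemma trig_dense_weighted:
  fixes f :: "real ^ 'n \<Rightarrow> complex" and w :: "real ^ 'n \<Rightarrow> ennreal"
  assumes [measurable]: "w \<in> borel_measurable borel" "f \<in> borel_measurable borel"
    and w: "(\<integral>\<^sup>+x. w x \<partial>torus) < \<infinity>"
    and wf: "(\<integral>\<^sup>+x. w x * ennreal ((cmod (f x))\<^sup>2) \<partial>torus) < \<infinity>" and "0 < e"
  obtains p where "trig_polynomial p"
    "(\<integral>\<^sup>+x. w x * ennreal ((cmod (f x - p x))\<^sup>2) \<partial>torus) < ennreal e"
proof -
  define M where "M = density lborel (\<lambda>x. w x * indicator unit_cube x)"
  have sets_M: "sets M = sets borel" by (simp add: M_def)
  have nn: "(\<integral>\<^sup>+x. g x \<partial>M) = (\<integral>\<^sup>+x. w x * g x \<partial>torus)" if [measurable]: "g \<in> borel_measurable borel" for g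
    unfolding M_def nn_integral_torus by (subst nn_integral_density) (auto simp: ac_simps)
  have "finite_measure M"
  proof (rule finite_measureI)
    have "emeasure M (space M) = (\<integral>\<^sup>+x. 1 \<partial>M)" by simp
    also have "\<dots> = (\<integral>\<^sup>+x. w x \<partial>torus)" by (subst nn) auto
    finally show "emeasure M (space M) \<noteq> \<infinity>" using w by simp
  qed
  moreover have "AE x in M. x \<in> unit_cube"
    unfolding M_def by (subst AE_density) (auto simp: indicator_def)
  moreover have "sqnorm M f < \<infinity>"
    unfolding sqnorm_def using wf by (subst nn) auto
  ultimately have "trig_approximable M f"
    by (intro trig_approximable_square_integrable sets_M) auto
  then obtain p where p: "trig_polynomial p" "sqnorm M (\<lambda>x. f x - p x) < ennreal e"
    using \<open>0 < e\<close> unfolding trig_approximable_def by blast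
  have [measurable]: "p \<in> borel_measurable borel" by (rule trig_polynomial_measurable[OF p(1)])
  show thesis
    by (rule that[OF p(1)]) (use p(2) in \<open>simp add: sqnorm_def nn\<close>)
qed

lemma trig_polynomial_bounded: assumes "trig_polynomial p" obtains B where "\<And>x. cmod (p x) \<le> B"
proof -
  obtain F c where p: "finite F" "p = (\<lambda>x. \<Sum>k\<in>F. c k * character k x)"
    using assms by (auto simp: trig_polynomial_def)
  have "cmod (p x) \<le> (\<Sum>k\<in>F. cmod (c k))" for x
    unfolding p(2) by (rule order_trans[OF norm_sum]) (simp add: norm_mult)
  then show thesis using that by blast
qed

text \<open>
  With respect to the measure with density \<open>cmod P\<close>, the function \<open>f = cnj (sgn P)\<close> is square integrable and
  hence close to a trigonometric polynomial \<open>p\<close>. The integral of \<open>P p\<close> vanishes, so the integral of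
  \<open>cmod P = P f\<close> equals that of \<open>P (f - p)\<close> and is small.
\<close>

theorem torus_fourier_unique:
  fixes P :: "real ^ 'n \<Rightarrow> complex"
  assumes P [measurable]: "P \<in> borel_measurable borel" and iP: "integrable torus P"
    and zero: "\<And>k. (LINT x|torus. P x * character k x) = 0"
  shows "AE x in torus. P x = 0"
proof -
  define S where "S = (LINT x|torus. cmod (P x))"
  define f where "f x = cnj (sgn (P x))" for x
  have sgn [measurable]: "(sgn :: complex \<Rightarrow> complex) \<in> borel_measurable borel"
    unfolding sgn_div_norm by measurable
  have [measurable]: "f \<in> borel_measurable borel" unfolding f_def by measurable
  have Pf: "P x * f x = of_real (cmod (P x))" for x
  proof (cases "P x = 0")
    case False
    have "P x * cnj (P x) = of_real (cmod (P x)) * of_real (cmod (P x))"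
      using complex_norm_square[of "P x"] by (simp add: power2_eq_square)
    then show ?thesis using False by (simp add: f_def sgn_div_norm scaleR_conv_of_real field_simps)
  qed simp
  have nf: "cmod (f x) \<le> 1" for x by (simp add: f_def norm_sgn)
  have S0: "0 \<le> S" unfolding S_def by simp
  have fin: "(\<integral>\<^sup>+x. ennreal (cmod (P x)) \<partial>torus) < \<infinity>"
    using iP by (simp add: integrable_iff_bounded)
  have "S \<le> e" if "0 < e" for e
  proof -
    have "(\<integral>\<^sup>+x. ennreal (cmod (P x)) * ennreal ((cmod (f x))\<^sup>2) \<partial>torus) \<le> (\<integral>\<^sup>+x. ennreal (cmod (P x)) \<partial>torus)"
    proof (rule nn_integral_mono)
      fix x
      have "ennreal ((cmod (f x))\<^sup>2) \<le> 1" using nf[of x] by (simp add: power_le_one)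
      then show "ennreal (cmod (P x)) * ennreal ((cmod (f x))\<^sup>2) \<le> ennreal (cmod (P x))"
        using mult_left_mono[of _ 1 "ennreal (cmod (P x))"] by simp
    qed
    also note fin
    finally have fin2: "(\<integral>\<^sup>+x. ennreal (cmod (P x)) * ennreal ((cmod (f x))\<^sup>2) \<partial>torus) < \<infinity>" .
    obtain p where p: "trig_polynomial p"
      "(\<integral>\<^sup>+x. ennreal (cmod (P x)) * ennreal ((cmod (f x - p x))\<^sup>2) \<partial>torus) < ennreal e"
      by (rule trig_dense_weighted[OF _ _ fin fin2 \<open>0 < e\<close>]) auto
    have [measurable]: "p \<in> borel_measurable borel" by (rule trig_polynomial_measurable[OF p(1)])
    obtain B where B: "\<And>x. cmod (p x) \<le> B" using trig_polynomial_bounded[OF p(1)] by blast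
    have iPb: "integrable torus (\<lambda>x. P x * g x)" if [measurable]: "g \<in> borel_measurable borel" and "\<And>x. cmod (g x) \<le> C" for g C
    proof (rule Bochner_Integration.integrable_bound[of _ "\<lambda>x. C * cmod (P x)"])
      show "AE x in torus. cmod (P x * g x) \<le> norm (C * cmod (P x))"
      proof (rule AE_I2)
        fix x
        have "cmod (P x * g x) \<le> C * cmod (P x)"
          using mult_right_mono[OF that(2)[of x], of "cmod (P x)"] by (simp add: norm_mult mult.commute)
        also have "\<dots> \<le> norm (C * cmod (P x))" by simp
        finally show "cmod (P x * g x) \<le> norm (C * cmod (P x))" .
      qed
    qed (use iP in auto)
    obtain F c where Fc: "finite F" "p = (\<lambda>x. \<Sum>k\<in>F. c k * character k x)"
      using p(1) by (auto simp: trig_polynomial_def)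
    have "(LINT x|torus. P x * p x) = (LINT x|torus. (\<Sum>k\<in>F. c k * (P x * character k x)))"
      unfolding Fc(2) by (simp add: sum_distrib_left algebra_simps)
    also have "\<dots> = (\<Sum>k\<in>F. c k * (LINT x|torus. P x * character k x))"
      by (subst Bochner_Integration.integral_sum) (auto intro!: integrable_mult_right iPb[of _ 1])
    finally have Pp: "(LINT x|torus. P x * p x) = 0" by (simp add: zero)
    have i1: "integrable torus (\<lambda>x. P x * f x)" by (rule iPb[OF _ nf]) measurable
    have i2: "integrable torus (\<lambda>x. P x * p x)" by (rule iPb[OF _ B]) measurable
    have bd: "cmod (f x - p x) \<le> 1 + B" for x
      using norm_triangle_ineq4[of "f x" "p x"] nf[of x] B[of x] by linarith
    have i3: "integrable torus (\<lambda>x. P x * (f x - p x))" by (rule iPb[OF _ bd]) measurable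
    have i4: "integrable torus (\<lambda>x. cmod (P x) * (cmod (f x - p x))\<^sup>2)"
    proof -
      have "cmod (complex_of_real ((cmod (f x - p x))\<^sup>2)) \<le> (1 + B)\<^sup>2" for x
        using bd[of x] by (simp add: norm_power power_mono)
      then have "integrable torus (\<lambda>x. P x * complex_of_real ((cmod (f x - p x))\<^sup>2))"
        by (intro iPb) auto
      then have "integrable torus (\<lambda>x. cmod (P x * complex_of_real ((cmod (f x - p x))\<^sup>2)))"
        by (rule integrable_norm)
      then show ?thesis by (simp add: norm_mult norm_power)
    qed
    define R where "R = (LINT x|torus. cmod (P x) * (cmod (f x - p x))\<^sup>2)"
    have "ennreal R < ennreal e"
      using p(2) i4 by (simp add: R_def nn_integral_eq_integral flip: ennreal_mult)
    then have R: "R < e" by (simp add: R_def ennreal_less_iff)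
    have "of_real S = (LINT x|torus. P x * f x)"
      unfolding S_def Pf by simp
    also have "\<dots> = (LINT x|torus. P x * (f x - p x))"
      using i1 i2 Pp by (simp add: right_diff_distrib)
    finally have "cmod (of_real S) \<le> (LINT x|torus. cmod (P x * (f x - p x)))"
      using integral_norm_bound[of torus "\<lambda>x. P x * (f x - p x)"] by simp
    \<comment> \<open>The bound \<open>t \<le> (1 + t\<^sup>2) / 2\<close> leaves half of \<open>S\<close> on the right, which is absorbed
      on the left.\<close>
    also have "\<dots> \<le> (LINT x|torus. (1/2) * cmod (P x) + (1/2) * (cmod (P x) * (cmod (f x - p x))\<^sup>2))"
    proof (rule integral_mono)
      fix x
      have "cmod (f x - p x) \<le> (1 + (cmod (f x - p x))\<^sup>2) / 2"
        using sum_squares_bound[of 1 "cmod (f x - p x)"] by simp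
      then have "cmod (P x) * cmod (f x - p x) \<le> cmod (P x) * ((1 + (cmod (f x - p x))\<^sup>2) / 2)"
        by (rule mult_left_mono) simp
      then show "cmod (P x * (f x - p x)) \<le> (1/2) * cmod (P x) + (1/2) * (cmod (P x) * (cmod (f x - p x))\<^sup>2)"
        unfolding norm_mult by (simp add: algebra_simps add_divide_distrib)
    qed (use i3 i4 iP in auto)
    also have "\<dots> = S / 2 + R / 2"
      using i4 iP by (simp add: S_def R_def)
    finally show "S \<le> e" using R S0 by simp
  qed
  then have "S \<le> 0" by (rule dense_ge)
  then have "S = 0" using S0 by simp
  then show ?thesis
    unfolding S_def using iP by (subst (asm) integral_nonneg_eq_0_iff_AE) auto
qed

text \<open>
  For a trigonometric polynomial \<open>p\<close> with coefficients \<open>c\<^sub>k\<close>, completing the square gives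
  \<open>\<parallel>g - p\<parallel>\<^sup>2 = \<parallel>g\<parallel>\<^sup>2 - \<Sum>\<^sub>k \<bar>a\<^sub>k\<bar>\<^sup>2 + \<Sum>\<^sub>k \<bar>a\<^sub>k - c\<^sub>k\<bar>\<^sup>2\<close>, where \<open>a\<^sub>k\<close> are the Fourier
  coefficients of \<open>g\<close>. The choice \<open>c = a\<close> yields Bessel's inequality, and the density of
  trigonometric polynomials yields the reverse inequality.
\<close>

theorem torus_parseval:
  fixes g :: "real ^ 'n \<Rightarrow> complex"
  assumes g [measurable]: "g \<in> borel_measurable borel" and fin: "sqnorm torus g < \<infinity>"
  shows "(\<integral>\<^sup>+k. ennreal ((cmod (LINT x|torus. g x * character k x))\<^sup>2) \<partial>count_space UNIV) = sqnorm torus g"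
proof -
  define a where "a k = l2_inner torus g (character k)" for k
  have l2g: "l2 torus g" using fin by (simp add: l2_def)
  define G where "G = Re (l2_inner torus g g)"
  have G: "sqnorm torus g = ennreal G" "0 \<le> G"
    unfolding G_def by (auto intro: sqnorm_eq_inner l2g l2_inner_self_nonneg)
  have key: "Re (l2_inner torus (\<lambda>x. g x - p x) (\<lambda>x. g x - p x)) =
      G - (\<Sum>k\<in>F. (cmod (a k))\<^sup>2) + (\<Sum>k\<in>F. (cmod (a k - c k))\<^sup>2)" (is "?L = _")
    if F: "finite F" and p: "p = (\<lambda>x. \<Sum>k\<in>F. c k * character k x)" for F c p
  proof -
    have l2p: "l2 torus p" unfolding p by (intro l2_sum F l2_cmult l2_character)
    have ip: "l2_inner torus p h = (\<Sum>k\<in>F. c k * l2_inner torus (character k) h)" if "l2 torus h" for h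
      unfolding p using F that by (subst l2_inner_sum_left) (auto intro: l2_cmult l2_character simp: l2_inner_cmult_left)
    have "l2_inner torus (character k) p = (if k \<in> F then cnj (c k) else 0)" for k
    proof -
      have "l2_inner torus p (character k) = (\<Sum>j\<in>F. if j = k then c j else 0)"
        by (subst ip) (auto simp: l2_character character_orthonormal intro!: sum.cong)
      then show ?thesis using F by (subst l2_inner_commute) (simp add: sum.delta)
    qed
    then have pp: "l2_inner torus p p = (\<Sum>k\<in>F. c k * cnj (c k))"
      by (subst ip[OF l2p]) (auto intro!: sum.cong)
    have gp: "l2_inner torus p g = (\<Sum>k\<in>F. c k * cnj (a k))"
      unfolding ip[OF l2g] a_def l2_inner_commute[symmetric] ..
    have "?L = G - 2 * Re (l2_inner torus g p) + Re (l2_inner torus p p)"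
      unfolding G_def by (rule l2_inner_diff_self[OF l2g l2p])
    also have "\<dots> = G + (\<Sum>k\<in>F. Re (c k * cnj (c k)) - 2 * Re (c k * cnj (a k)))"
      by (subst l2_inner_commute) (simp add: gp pp sum_subtractf sum_distrib_left)
    also have "(\<Sum>k\<in>F. Re (c k * cnj (c k)) - 2 * Re (c k * cnj (a k))) =
        (\<Sum>k\<in>F. (cmod (a k - c k))\<^sup>2 - (cmod (a k))\<^sup>2)"
      by (intro sum.cong refl, unfold cmod_power2) (simp add: power2_eq_square algebra_simps)
    finally show ?thesis by (simp add: sum_subtractf)
  qed
  have bessel: "(\<Sum>k\<in>F. (cmod (a k))\<^sup>2) \<le> G" if "finite F" for F
    using key[OF that refl, of a] l2_inner_self_nonneg[of torus "\<lambda>x. g x - (\<Sum>k\<in>F. a k * character k x)"] by simp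
  have approx: "\<exists>F. finite F \<and> G \<le> (\<Sum>k\<in>F. (cmod (a k))\<^sup>2) + e" if e: "0 < e" for e
  proof -
    have 1: "(\<integral>\<^sup>+x. 1 \<partial>(torus :: (real ^ 'n) measure)) < \<infinity>"
      unfolding nn_integral_torus_1 by simp
    have 2: "(\<integral>\<^sup>+x. 1 * ennreal ((cmod (g x))\<^sup>2) \<partial>torus) < \<infinity>"
      using fin by (simp add: sqnorm_def)
    obtain p where p: "trig_polynomial p"
      "(\<integral>\<^sup>+x. 1 * ennreal ((cmod (g x - p x))\<^sup>2) \<partial>torus) < ennreal e"
      by (rule trig_dense_weighted[OF _ g 1 2 e]) simp
    obtain F c where Fc: "finite F" "p = (\<lambda>x. \<Sum>k\<in>F. c k * character k x)"
      using p(1) by (auto simp: trig_polynomial_def)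
    have "l2 torus p" unfolding Fc(2) by (intro l2_sum Fc l2_cmult l2_character)
    then have "sqnorm torus (\<lambda>x. g x - p x) = ennreal (Re (l2_inner torus (\<lambda>x. g x - p x) (\<lambda>x. g x - p x)))"
      by (intro sqnorm_eq_inner l2_diff l2g)
    then have "ennreal (Re (l2_inner torus (\<lambda>x. g x - p x) (\<lambda>x. g x - p x))) < ennreal e"
      using p(2) by (simp add: sqnorm_def)
    then have "Re (l2_inner torus (\<lambda>x. g x - p x) (\<lambda>x. g x - p x)) < e"
      by (simp add: ennreal_less_iff l2_inner_self_nonneg)
    then have "G - (\<Sum>k\<in>F. (cmod (a k))\<^sup>2) + (\<Sum>k\<in>F. (cmod (a k - c k))\<^sup>2) < e"
      unfolding key[OF Fc] .
    moreover have "0 \<le> (\<Sum>k\<in>F. (cmod (a k - c k))\<^sup>2)" by (intro sum_nonneg) simp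
    ultimately show ?thesis using Fc(1) by (intro exI[of _ F]) auto
  qed
  have "(\<integral>\<^sup>+k. ennreal ((cmod (a k))\<^sup>2) \<partial>count_space UNIV) = ennreal G"
  proof (rule antisym)
    show "(\<integral>\<^sup>+k. ennreal ((cmod (a k))\<^sup>2) \<partial>count_space UNIV) \<le> ennreal G"
      unfolding nn_integral_count_space_eq_SUP
      by (intro SUP_least) (auto simp: sum_ennreal intro!: ennreal_leI bessel)
    show "ennreal G \<le> (\<integral>\<^sup>+k. ennreal ((cmod (a k))\<^sup>2) \<partial>count_space UNIV)"
    proof (rule ennreal_le_epsilon)
      fix e :: real assume "0 < e"
      then obtain F where F: "finite F" "G \<le> (\<Sum>k\<in>F. (cmod (a k))\<^sup>2) + e" using approx by blast
      have "ennreal G \<le> ennreal ((\<Sum>k\<in>F. (cmod (a k))\<^sup>2) + e)" by (rule ennreal_leI[OF F(2)])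
      also have "\<dots> = (\<Sum>k\<in>F. ennreal ((cmod (a k))\<^sup>2)) + ennreal e"
        using \<open>0 < e\<close> by (simp add: sum_nonneg sum_ennreal)
      also have "\<dots> \<le> (\<integral>\<^sup>+k. ennreal ((cmod (a k))\<^sup>2) \<partial>count_space UNIV) + ennreal e"
        unfolding nn_integral_count_space_eq_SUP using F(1) by (intro add_right_mono SUP_upper) auto
      finally show "ennreal G \<le> (\<integral>\<^sup>+k. ennreal ((cmod (a k))\<^sup>2) \<partial>count_space UNIV) + ennreal e" .
    qed
  qed
  \<comment> \<open>The statement pairs with \<open>character k\<close> itself, not with its conjugate; \<open>k \<mapsto> - k\<close> exchanges the two.\<close>
  also have "(\<integral>\<^sup>+k. ennreal ((cmod (a k))\<^sup>2) \<partial>count_space UNIV) =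
      (\<integral>\<^sup>+k. ennreal ((cmod (a (- k)))\<^sup>2) \<partial>count_space UNIV)"
  proof -
    have "bij_betw uminus (UNIV :: (int ^ 'n) set) UNIV" by (simp add: bij_uminus)
    from nn_integral_bij_count_space[OF this, of "\<lambda>k. ennreal ((cmod (a k))\<^sup>2)"]
    show ?thesis by simp
  qed
  finally show ?thesis
    by (simp add: G a_def l2_inner_def character_uminus)
qed


section \<open>Convergence in mean square\<close>

definition l2_tendsto :: "'a measure \<Rightarrow> (nat \<Rightarrow> 'a \<Rightarrow> complex) \<Rightarrow> ('a \<Rightarrow> complex) \<Rightarrow> bool" where
  "l2_tendsto M F f \<longleftrightarrow> (\<lambda>n. sqnorm M (\<lambda>x. F n x - f x)) \<longlonglongrightarrow> 0"

lemma L2_tendsto_eq: "L2_tendsto F f \<longleftrightarrow> l2_tendsto lborel F f"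
  by (simp add: L2_tendsto_def l2_tendsto_def L2_sqnorm_eq_sqnorm)

lemma l2_tendstoI_le:
  assumes "\<And>n. sqnorm M (\<lambda>x. F n x - f x) \<le> b n" "b \<longlonglongrightarrow> 0"
  shows "l2_tendsto M F f"
  unfolding l2_tendsto_def
  by (rule tendsto_sandwich[OF _ _ tendsto_const assms(2)]) (auto simp: assms(1))

lemma tendsto_two_times_add_ennreal_0:
  fixes a b :: "nat \<Rightarrow> ennreal"
  assumes "a \<longlonglongrightarrow> 0" "b \<longlonglongrightarrow> 0" shows "(\<lambda>n. 2 * a n + 2 * b n) \<longlonglongrightarrow> 0"
proof -
  have "(\<lambda>n. 2 * a n + 2 * b n) \<longlonglongrightarrow> 2 * 0 + 2 * 0"
    by (intro tendsto_add ennreal_tendsto_cmult assms) auto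
  then show ?thesis by simp
qed

lemma sqnorm_eq_0_iff: "f \<in> borel_measurable M \<Longrightarrow> sqnorm M f = 0 \<longleftrightarrow> (AE x in M. f x = 0)"
  unfolding sqnorm_def by (subst nn_integral_0_iff_AE) auto

lemma l2_tendsto_unique:
  assumes [measurable]: "\<And>n. F n \<in> borel_measurable M" "f \<in> borel_measurable M" "g \<in> borel_measurable M"
    and "l2_tendsto M F f" "l2_tendsto M F g"
  shows "AE x in M. f x = g x"
proof -
  have "sqnorm M (\<lambda>x. f x - g x) \<le> 2 * sqnorm M (\<lambda>x. F n x - f x) + 2 * sqnorm M (\<lambda>x. F n x - g x)" for n
    using sqnorm_triangle[of f M "F n" g] by (simp add: sqnorm_minus_commute[of M f])
  moreover have "(\<lambda>n. 2 * sqnorm M (\<lambda>x. F n x - f x) + 2 * sqnorm M (\<lambda>x. F n x - g x)) \<longlonglongrightarrow> 0"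
    using assms(4,5) unfolding l2_tendsto_def by (rule tendsto_two_times_add_ennreal_0)
  ultimately have "sqnorm M (\<lambda>x. f x - g x) \<le> 0"
    by (intro LIMSEQ_le_const) auto
  then show ?thesis by (simp add: sqnorm_eq_0_iff)
qed

lemma l2_tendsto_diff:
  assumes [measurable]: "\<And>n. F n \<in> borel_measurable M" "f \<in> borel_measurable M"
      "\<And>n. G n \<in> borel_measurable M" "g \<in> borel_measurable M"
    and "l2_tendsto M F f" "l2_tendsto M G g"
  shows "l2_tendsto M (\<lambda>n x. F n x - G n x) (\<lambda>x. f x - g x)"
proof (rule l2_tendstoI_le)
  show "sqnorm M (\<lambda>x. F n x - G n x - (f x - g x)) \<le>
      2 * sqnorm M (\<lambda>x. F n x - f x) + 2 * sqnorm M (\<lambda>x. G n x - g x)" for n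
    using sqnorm_diff[of "\<lambda>x. F n x - f x" M "\<lambda>x. G n x - g x"] by (simp add: algebra_simps)
  show "(\<lambda>n. 2 * sqnorm M (\<lambda>x. F n x - f x) + 2 * sqnorm M (\<lambda>x. G n x - g x)) \<longlonglongrightarrow> 0"
    using assms(5,6) unfolding l2_tendsto_def by (rule tendsto_two_times_add_ennreal_0)
qed

lemma l2_tendsto_cmult:
  assumes [measurable]: "\<And>n. F n \<in> borel_measurable M" "f \<in> borel_measurable M"
    and "l2_tendsto M F f"
  shows "l2_tendsto M (\<lambda>n x. c * F n x) (\<lambda>x. c * f x)"
proof -
  have "(\<lambda>n. ennreal ((cmod c)\<^sup>2) * sqnorm M (\<lambda>x. F n x - f x)) \<longlonglongrightarrow> ennreal ((cmod c)\<^sup>2) * 0"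
    using assms(3) unfolding l2_tendsto_def by (intro ennreal_tendsto_cmult) auto
  moreover have "sqnorm M (\<lambda>x. c * F n x - c * f x) = ennreal ((cmod c)\<^sup>2) * sqnorm M (\<lambda>x. F n x - f x)" for n
    using sqnorm_cmult[of "\<lambda>x. F n x - f x" M c] by (simp add: right_diff_distrib)
  ultimately show ?thesis by (simp add: l2_tendsto_def)
qed

lemma l2_tendsto_cong_AE:
  assumes "\<And>n. AE x in M. F n x = G n x" "l2_tendsto M F f" shows "l2_tendsto M G f"
proof -
  have "sqnorm M (\<lambda>x. F n x - f x) = sqnorm M (\<lambda>x. G n x - f x)" for n
    using assms(1)[of n] by (intro sqnorm_cong_AE) (auto elim: eventually_mono)
  then show ?thesis using assms(2) by (simp add: l2_tendsto_def)
qed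

lemma l2_cauchy_schwarz:
  assumes "l2 M f" "l2 M g"
  shows "(cmod (l2_inner M f g))\<^sup>2 \<le> Re (l2_inner M f f) * Re (l2_inner M g g)"
proof -
  note [measurable] = assms[THEN l2_measurable]
  have "ennreal (cmod (l2_inner M f g)) \<le> (\<integral>\<^sup>+x. ennreal (cmod (f x)) * ennreal (cmod (g x)) \<partial>M)"
    using integral_norm_bound_ennreal[OF l2_integrable_mult[OF assms]]
    by (simp add: l2_inner_def norm_mult ennreal_mult)
  then have "(ennreal (cmod (l2_inner M f g)))\<^sup>2 \<le> (\<integral>\<^sup>+x. ennreal (cmod (f x)) * ennreal (cmod (g x)) \<partial>M)\<^sup>2"
    by (intro power_mono) auto
  also have "\<dots> \<le> (\<integral>\<^sup>+x. (ennreal (cmod (f x)))\<^sup>2 \<partial>M) * (\<integral>\<^sup>+x. (ennreal (cmod (g x)))\<^sup>2 \<partial>M)"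
    by (rule Cauchy_Schwarz_nn_integral) auto
  also have "\<dots> = sqnorm M f * sqnorm M g"
    by (simp add: sqnorm_def ennreal_power)
  also have "\<dots> = ennreal (Re (l2_inner M f f) * Re (l2_inner M g g))"
    using assms by (simp add: sqnorm_eq_inner ennreal_mult l2_inner_self_nonneg)
  finally show ?thesis
    by (simp add: ennreal_power l2_inner_self_nonneg)
qed

lemma l2_tendsto_inner:
  assumes F: "\<And>n. l2 M (F n)" and f: "l2 M f" and G: "\<And>n. l2 M (G n)" and g: "l2 M g"
    and lim: "l2_tendsto M F f" "l2_tendsto M G g"
  shows "(\<lambda>n. l2_inner M (F n) (G n)) \<longlonglongrightarrow> l2_inner M f g"
proof -
  define a where "a n = Re (l2_inner M (\<lambda>x. F n x - f x) (\<lambda>x. F n x - f x))" for n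
  define b where "b n = Re (l2_inner M (\<lambda>x. G n x - g x) (\<lambda>x. G n x - g x))" for n
  define A where "A = Re (l2_inner M f f)"
  define B where "B = Re (l2_inner M g g)"
  have nn: "0 \<le> a n" "0 \<le> b n" "0 \<le> A" "0 \<le> B" for n
    by (simp_all add: a_def b_def A_def B_def l2_inner_self_nonneg)
  have "(\<lambda>n. ennreal (a n)) \<longlonglongrightarrow> ennreal 0"
    using lim(1) by (simp add: l2_tendsto_def a_def sqnorm_eq_inner l2_diff F f)
  then have a: "a \<longlonglongrightarrow> 0" using nn by (subst (asm) tendsto_ennreal_iff) auto
  have "(\<lambda>n. ennreal (b n)) \<longlonglongrightarrow> ennreal 0"
    using lim(2) by (simp add: l2_tendsto_def b_def sqnorm_eq_inner l2_diff G g)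
  then have b: "b \<longlonglongrightarrow> 0" using nn by (subst (asm) tendsto_ennreal_iff) auto
  have cs: "cmod (l2_inner M u v) \<le> sqrt (Re (l2_inner M u u)) * sqrt (Re (l2_inner M v v))"
    if "l2 M u" "l2 M v" for u v
    using real_le_rsqrt[OF l2_cauchy_schwarz[OF that]] by (simp add: real_sqrt_mult)
  have bound: "cmod (l2_inner M (F n) (G n) - l2_inner M f g) \<le> sqrt (a n) * sqrt (b n) + sqrt (a n) * sqrt B + sqrt A * sqrt (b n)" for n
  proof -
    have eq: "l2_inner M (F n) (G n) - l2_inner M f g =
        l2_inner M (\<lambda>x. F n x - f x) (\<lambda>x. G n x - g x) + l2_inner M (\<lambda>x. F n x - f x) g + l2_inner M f (\<lambda>x. G n x - g x)"
      using F f G g by (simp add: l2_inner_diff_left l2_inner_diff_right l2_diff)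
    have "cmod (l2_inner M (F n) (G n) - l2_inner M f g) \<le> cmod (l2_inner M (\<lambda>x. F n x - f x) (\<lambda>x. G n x - g x)) +
        cmod (l2_inner M (\<lambda>x. F n x - f x) g) + cmod (l2_inner M f (\<lambda>x. G n x - g x))"
      unfolding eq by (rule order_trans[OF norm_triangle_ineq add_right_mono[OF norm_triangle_ineq]])
    also have "\<dots> \<le> sqrt (a n) * sqrt (b n) + sqrt (a n) * sqrt B + sqrt A * sqrt (b n)"
      unfolding a_def b_def A_def B_def by (intro add_mono cs[OF l2_diff[OF F f] l2_diff[OF G g]] cs[OF l2_diff[OF F f] g] cs[OF f l2_diff[OF G g]])
    finally show ?thesis .
  qed
  have sa: "(\<lambda>n. sqrt (a n)) \<longlonglongrightarrow> 0" using tendsto_real_sqrt[OF a] by simp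
  have sb: "(\<lambda>n. sqrt (b n)) \<longlonglongrightarrow> 0" using tendsto_real_sqrt[OF b] by simp
  have "(\<lambda>n. sqrt (a n) * sqrt (b n) + sqrt (a n) * sqrt B + sqrt A * sqrt (b n)) \<longlonglongrightarrow>
      0 * 0 + 0 * sqrt B + sqrt A * 0"
    by (intro tendsto_add tendsto_mult tendsto_const sa sb)
  then have z: "(\<lambda>n. sqrt (a n) * sqrt (b n) + sqrt (a n) * sqrt B + sqrt A * sqrt (b n)) \<longlonglongrightarrow> 0" by simp
  have "(\<lambda>n. l2_inner M (F n) (G n) - l2_inner M f g) \<longlonglongrightarrow> 0"
    by (rule Lim_null_comparison[OF _ z]) (rule always_eventually, rule allI, rule bound)
  then show ?thesis by (rule LIM_zero_cancel)
qed

lemma l2_tendsto_sqnorm: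
  assumes "\<And>n. l2 M (F n)" "l2 M f" "l2_tendsto M F f"
  shows "(\<lambda>n. sqnorm M (F n)) \<longlonglongrightarrow> sqnorm M f"
  using l2_tendsto_inner[OF assms(1,2,1,2,3,3)]
  by (auto simp: sqnorm_eq_inner[OF assms(1)] sqnorm_eq_inner[OF assms(2)] intro!: tendsto_ennrealI tendsto_Re)

text \<open>
  The Riesz--Fischer theorem: a rapidly converging subsequence converges almost everywhere, and
  Fatou's lemma turns the pointwise limit into a limit in mean square of the whole sequence.
\<close>

theorem l2_complete:
  assumes F: "\<And>n. l2 M (F n)"
    and cauchy: "\<And>e. 0 < e \<Longrightarrow> \<exists>N. \<forall>m\<ge>N. \<forall>n\<ge>N. sqnorm M (\<lambda>x. F m x - F n x) < ennreal e"
  shows "\<exists>f. l2 M f \<and> l2_tendsto M F f"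
proof -
  note [measurable] = l2_measurable[OF F]
  \<comment> \<open>Against the rate \<open>8\<^sup>-\<^sup>j\<close> the increments can still be weighted by \<open>4\<^sup>j\<close>.\<close>
  have "\<forall>j. \<exists>N. \<forall>m\<ge>N. \<forall>n\<ge>N. sqnorm M (\<lambda>x. F m x - F n x) < ennreal ((1/8)^j)"
    using cauchy by simp
  then obtain N where N: "\<And>j m n. N j \<le> m \<Longrightarrow> N j \<le> n \<Longrightarrow> sqnorm M (\<lambda>x. F m x - F n x) < ennreal ((1/8)^j)"
    by metis
  \<comment> \<open>Partial sums make the sequence of indices monotone.\<close>
  define r where "r j = (\<Sum>i\<le>j. N i)" for j
  have rN: "N j \<le> r j" for j unfolding r_def by (rule member_le_sum) auto
  have r_mono: "r i \<le> r j" if "i \<le> j" for i j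
    unfolding r_def using that by (intro sum_mono2) auto
  define d where "d j x = F (r (Suc j)) x - F (r j) x" for j x
  have [measurable]: "d j \<in> borel_measurable M" for j unfolding d_def by measurable
  have d: "sqnorm M (d j) \<le> ennreal ((1/8)^j)" for j
    unfolding d_def by (rule less_imp_le, rule N) (use rN[of j] r_mono[of j "Suc j"] in auto)
  have "(\<integral>\<^sup>+x. (\<Sum>j. ennreal (4^j * (cmod (d j x))\<^sup>2)) \<partial>M) = (\<Sum>j. \<integral>\<^sup>+x. ennreal (4^j * (cmod (d j x))\<^sup>2) \<partial>M)"
    by (rule nn_integral_suminf) measurable
  also have "\<dots> \<le> (\<Sum>j. ennreal ((1/2)^j))"
  proof (rule suminf_le)
    fix j
    have "(\<integral>\<^sup>+x. ennreal (4^j * (cmod (d j x))\<^sup>2) \<partial>M) = ennreal (4^j) * sqnorm M (d j)"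
      unfolding sqnorm_def by (subst nn_integral_cmult[symmetric]) (auto simp: ennreal_mult)
    also have "\<dots> \<le> ennreal (4^j) * ennreal ((1/8)^j)" by (intro mult_left_mono d) simp
    also have "\<dots> = ennreal ((1/2)^j)" by (simp add: power_mult_distrib[symmetric] flip: ennreal_mult)
    finally show "(\<integral>\<^sup>+x. ennreal (4^j * (cmod (d j x))\<^sup>2) \<partial>M) \<le> ennreal ((1/2)^j)" .
  qed auto
  also have "\<dots> = ennreal (\<Sum>j. (1/2)^j)"
    by (rule suminf_ennreal2) (auto intro: summable_geometric)
  also have "\<dots> < \<infinity>" by simp
  finally have "AE x in M. (\<Sum>j. ennreal (4^j * (cmod (d j x))\<^sup>2)) \<noteq> \<infinity>"
    by (intro nn_integral_PInf_AE) auto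
  then have conv: "AE x in M. convergent (\<lambda>j. F (r j) x)"
  proof eventually_elim
    case (elim x)
    then have s: "summable (\<lambda>j. 4^j * (cmod (d j x))\<^sup>2)"
      by (intro summable_suminf_not_top) auto
    have "summable (\<lambda>j. cmod (d j x))"
    proof (rule summable_comparison_test[OF _ summable_add[OF s summable_geometric[of "1/2::real"]]])
      \<comment> \<open>Increments below \<open>2\<^sup>-\<^sup>j\<close> are summable; larger ones are at most \<open>4\<^sup>j\<close> times their square.\<close>
      have "cmod (d j x) \<le> 4^j * (cmod (d j x))\<^sup>2 + (1/2)^j" for j
      proof -
        define y where "y = cmod (d j x)"
        have "0 \<le> y" by (simp add: y_def)
        show ?thesis unfolding y_def[symmetric]
        proof (cases "y \<le> (1/2)^j")
          case True
          then show "y \<le> 4^j * y\<^sup>2 + (1/2)^j" by (simp add: add_increasing)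
        next
          case False
          then have "4^j * (1/2)^j \<le> 4^j * y" by simp
          moreover have "4^j * (1/2)^j = (2::real)^j" by (simp flip: power_mult_distrib)
          moreover have "1 \<le> (2::real)^j" by simp
          ultimately have "1 \<le> 4^j * y" by linarith
          then have "1 * y \<le> (4^j * y) * y" using \<open>0 \<le> y\<close> by (rule mult_right_mono)
          then show "y \<le> 4^j * y\<^sup>2 + (1/2)^j" by (simp add: power2_eq_square mult.assoc add_increasing2)
        qed
      qed
      then show "\<exists>K. \<forall>j\<ge>K. norm (cmod (d j x)) \<le> 4^j * (cmod (d j x))\<^sup>2 + (1/2)^j" by simp
    qed simp
    then have "summable (\<lambda>j. d j x)" by (rule summable_norm_cancel)
    then have "(\<lambda>n. \<Sum>j<n. d j x) \<longlonglongrightarrow> (\<Sum>j. d j x)" by (rule summable_LIMSEQ)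
    moreover have "(\<Sum>j<n. d j x) = F (r n) x - F (r 0) x" for n
      unfolding d_def by (rule sum_lessThan_telescope)
    ultimately have "(\<lambda>n. (F (r n) x - F (r 0) x) + F (r 0) x) \<longlonglongrightarrow> (\<Sum>j. d j x) + F (r 0) x"
      by (intro tendsto_intros) simp
    then show ?case by (auto simp: convergent_def)
  qed
  define f where "f x = lim (\<lambda>j. F (r j) x)" for x
  have [measurable]: "f \<in> borel_measurable M" unfolding f_def by measurable
  have f: "AE x in M. (\<lambda>j. F (r j) x) \<longlonglongrightarrow> f x"
    using conv by eventually_elim (simp add: f_def convergent_LIMSEQ_iff)
  have fatou: "sqnorm M (\<lambda>x. F m x - f x) \<le> ennreal ((1/8)^j)" if "N j \<le> m" for j m
  proof -
    have "sqnorm M (\<lambda>x. F m x - f x) = (\<integral>\<^sup>+x. liminf (\<lambda>i. ennreal ((cmod (F m x - F (r i) x))\<^sup>2)) \<partial>M)"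
      unfolding sqnorm_def
    proof (rule nn_integral_cong_AE)
      show "AE x in M. ennreal ((cmod (F m x - f x))\<^sup>2) = liminf (\<lambda>i. ennreal ((cmod (F m x - F (r i) x))\<^sup>2))"
        using f
      proof eventually_elim
        case (elim x)
        have "(\<lambda>i. ennreal ((cmod (F m x - F (r i) x))\<^sup>2)) \<longlonglongrightarrow> ennreal ((cmod (F m x - f x))\<^sup>2)"
          by (intro tendsto_ennrealI tendsto_intros elim)
        then show ?case by (rule lim_imp_Liminf[OF trivial_limit_sequentially, symmetric])
      qed
    qed
    also have "\<dots> \<le> liminf (\<lambda>i. sqnorm M (\<lambda>x. F m x - F (r i) x))"
      unfolding sqnorm_def by (rule nn_integral_liminf) measurable
    also have "\<dots> \<le> ennreal ((1/8)^j)"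
    proof (rule Liminf_le)
      show "\<forall>\<^sub>F i in sequentially. sqnorm M (\<lambda>x. F m x - F (r i) x) \<le> ennreal ((1/8)^j)"
        using eventually_ge_at_top[of j]
        by eventually_elim (rule less_imp_le, rule N, rule that, rule order_trans[OF rN r_mono])
    qed simp
    finally show ?thesis .
  qed
  have "l2_tendsto M F f"
    unfolding l2_tendsto_def
  proof (rule order_tendstoI)
    fix e :: ennreal assume "0 < e"
    have "(\<lambda>j. ennreal ((1/8)^j)) \<longlonglongrightarrow> ennreal 0"
      by (intro tendsto_ennrealI LIMSEQ_realpow_zero) auto
    then have "\<forall>\<^sub>F j in sequentially. ennreal ((1/8)^j) < e"
      using \<open>0 < e\<close> by (intro order_tendstoD(2)) auto
    then obtain j where j: "ennreal ((1/8)^j) < e" by (auto simp: eventually_sequentially)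
    show "\<forall>\<^sub>F n in sequentially. sqnorm M (\<lambda>x. F n x - f x) < e"
      using eventually_ge_at_top[of "N j"] by eventually_elim (use fatou j in \<open>auto intro: le_less_trans\<close>)
  qed simp
  moreover have "l2 M f"
  proof -
    have "sqnorm M (\<lambda>x. F (N 0) x - f x) \<le> ennreal ((1/8)^0)" by (rule fatou) simp
    then have "l2 M (\<lambda>x. F (N 0) x - f x)"
      unfolding l2_def by (auto intro: le_less_trans)
    then have "l2 M (\<lambda>x. F (N 0) x - (F (N 0) x - f x))" by (rule l2_diff[OF F])
    then show ?thesis by simp
  qed
  ultimately show ?thesis by blast
qed

section \<open>The Plancherel theorem for functions with bounded support\<close>

definition fourier :: "('a::euclidean_space \<Rightarrow> complex) \<Rightarrow> 'a \<Rightarrow> complex" where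
  "fourier f v = (LINT x|lborel. f x * cis (2 * pi * (x \<bullet> v)))"

lemma cis_measurable [measurable]: "cis \<in> borel_measurable borel"
  by (intro borel_measurable_continuous_onI continuous_on_cis continuous_on_id)

lemma fourier_measurable [measurable]:
  assumes [measurable]: "f \<in> borel_measurable borel"
  shows "fourier f \<in> borel_measurable borel"
  unfolding fourier_def by measurable

lemma sqnorm_lborel_cube:
  assumes "\<And>x. x \<notin> unit_cube \<Longrightarrow> g x = 0"
  shows "sqnorm torus g = sqnorm lborel g"
  unfolding sqnorm_def nn_integral_torus using assms
  by (intro nn_integral_cong) (auto simp: indicator_def)

text \<open>
  On each coset \<open>\<theta> + \<int>\<^sup>n\<close> the Fourier transform of \<open>g\<close> consists of the Fourier coefficients of
  \<open>g(x) exp (2 \<pi> i x \<bullet> \<theta>)\<close>, a function on the cube with the same norm as \<open>g\<close>. Parseval's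
  identity gives the same value for the sum over every coset.
\<close>

lemma plancherel_unit_cube:
  fixes g :: "real ^ 'n \<Rightarrow> complex"
  assumes [measurable]: "g \<in> borel_measurable borel" and supp: "\<And>x. x \<notin> unit_cube \<Longrightarrow> g x = 0"
    and fin: "sqnorm lborel g < \<infinity>"
  shows "sqnorm lborel (fourier g) = sqnorm lborel g"
proof -
  interpret finite_measure "torus :: (real ^ 'n) measure" by (rule finite_measure_torus)
  define h where "h \<theta> x = g x * cis (2 * pi * (x \<bullet> \<theta>))" for \<theta> x
  have [measurable]: "h \<theta> \<in> borel_measurable borel" for \<theta> unfolding h_def by measurable
  have sh: "sqnorm torus (h \<theta>) = sqnorm lborel g" for \<theta>
  proof -
    have "sqnorm torus (h \<theta>) = sqnorm torus g" by (simp add: sqnorm_def h_def norm_mult)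
    then show ?thesis using sqnorm_lborel_cube[OF supp] by simp
  qed
  have coeff: "fourier g (\<theta> + lattice_pt k) = (LINT x|torus. h \<theta> x * character k x)" for \<theta> k
  proof -
    have "g x * cis (2 * pi * (x \<bullet> (\<theta> + lattice_pt k))) = indicator unit_cube x *\<^sub>R (h \<theta> x * character k x)" for x
      using supp[of x]
      by (cases "x \<in> unit_cube") (simp_all add: h_def character_def cis_mult inner_add_right distrib_left)
    then show ?thesis by (simp add: fourier_def integral_torus)
  qed
  have "sqnorm lborel (fourier g) =
      (\<integral>\<^sup>+\<theta>. \<integral>\<^sup>+k. ennreal ((cmod (fourier g (\<theta> + lattice_pt k)))\<^sup>2) \<partial>count_space UNIV \<partial>torus)"
    unfolding sqnorm_def by (rule nn_integral_periodize) measurable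
  also have "\<dots> = (\<integral>\<^sup>+\<theta>. sqnorm torus (h \<theta>) \<partial>(torus :: (real ^ 'n) measure))"
    unfolding coeff using fin by (intro nn_integral_cong torus_parseval) (auto simp: sh)
  also have "\<dots> = sqnorm lborel g" by (simp add: sh)
  finally show ?thesis .
qed

lemma nn_integral_affine:
  fixes t :: "'a::euclidean_space"
  assumes [measurable]: "f \<in> borel_measurable borel" and c: "c \<noteq> 0"
  shows "(\<integral>\<^sup>+x. f x \<partial>lborel) = ennreal (\<bar>c\<bar> ^ DIM('a)) * (\<integral>\<^sup>+x. f (t + c *\<^sub>R x) \<partial>lborel)"
  by (subst lborel_affine[OF c, of t]) (simp add: nn_integral_density nn_integral_distr nn_integral_cmult)

lemma integral_affine:
  fixes t :: "'a::euclidean_space" and f :: "'a \<Rightarrow> complex"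
  assumes [measurable]: "f \<in> borel_measurable borel" and c: "c \<noteq> 0"
  shows "(LINT x|lborel. f x) = complex_of_real (\<bar>c\<bar> ^ DIM('a)) * (LINT x|lborel. f (t + c *\<^sub>R x))"
  by (subst lborel_affine[OF c, of t]) (simp add: integral_density integral_distr scaleR_conv_of_real)

text \<open>
  An affine map of the form \<open>x \<mapsto> a + L x\<close> carries the unit cube onto a cube that contains the support of \<open>f\<close>.
  The powers of \<open>L\<close> from the two changes of variables cancel.
\<close>

theorem plancherel_bounded_support:
  fixes f :: "real ^ 'n \<Rightarrow> complex"
  assumes [measurable]: "f \<in> borel_measurable borel" and supp: "\<And>x. R < norm x \<Longrightarrow> f x = 0"
    and fin: "sqnorm lborel f < \<infinity>"
  shows "sqnorm lborel (fourier f) = sqnorm lborel f"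
proof -
  \<comment> \<open>The cube \<open>[-r, r)\<^sup>n\<close> with edge length \<open>L = 2 r\<close> contains the support.\<close>
  define r where "r = max R 0 + 1"
  define L where "L = 2 * r"
  have r: "0 < r" "R < r" and L: "0 < L" by (auto simp: r_def L_def)
  define a :: "real ^ 'n" where "a = (\<chi> i. - r)"
  define D where "D = L ^ DIM(real ^ 'n)"
  have D: "0 < D" using L by (simp add: D_def)
  define g where "g x = f (a + L *\<^sub>R x)" for x
  have [measurable]: "g \<in> borel_measurable borel" unfolding g_def by measurable
  have g_supp: "g x = 0" if x: "x \<notin> unit_cube" for x
  proof -
    obtain i where i: "x $ i < 0 \<or> 1 \<le> x $ i" using x unfolding unit_cube_def by (auto simp: not_le not_less)
    have "r \<le> \<bar>(a + L *\<^sub>R x) $ i\<bar>"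
    proof (cases "x $ i < 0")
      case True
      then have "L * x $ i \<le> 0" using L by (simp add: mult_nonneg_nonpos)
      then show ?thesis by (simp add: a_def)
    next
      case False
      then have "L * 1 \<le> L * x $ i" using i L by (intro mult_left_mono) auto
      then show ?thesis by (simp add: a_def L_def)
    qed
    also have "\<dots> \<le> norm (a + L *\<^sub>R x)" by (rule component_le_norm_cart)
    finally show ?thesis unfolding g_def using r by (intro supp) auto
  qed
  have nf: "sqnorm lborel f = ennreal D * sqnorm lborel g"
    unfolding sqnorm_def g_def D_def using L
    by (subst nn_integral_affine[where c=L and t=a]) auto
  then have fg: "sqnorm lborel g < \<infinity>"
    using fin D by (auto simp: ennreal_mult_less_top ennreal_mult_eq_top_iff less_top[symmetric])
  have ft: "fourier f v = of_real D * (cis (2 * pi * (a \<bullet> v)) * fourier g (0 + L *\<^sub>R v))" for v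
  proof -
    have "fourier f v = of_real D * (LINT x|lborel. g x * cis (2 * pi * ((a + L *\<^sub>R x) \<bullet> v)))"
      unfolding fourier_def g_def D_def using L by (subst integral_affine[where c=L and t=a]) auto
    also have "(LINT x|lborel. g x * cis (2 * pi * ((a + L *\<^sub>R x) \<bullet> v))) =
        (LINT x|lborel. cis (2 * pi * (a \<bullet> v)) * (g x * cis (2 * pi * (x \<bullet> (0 + L *\<^sub>R v)))))"
      by (intro Bochner_Integration.integral_cong) (auto simp: inner_add_left distrib_left algebra_simps simp flip: cis_mult)
    finally show ?thesis by (simp add: fourier_def)
  qed
  have "sqnorm lborel (fourier f) = (\<integral>\<^sup>+v. ennreal (D\<^sup>2) * ennreal ((cmod (fourier g (0 + L *\<^sub>R v)))\<^sup>2) \<partial>lborel)"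
    unfolding sqnorm_def ft using D by (simp add: norm_mult power_mult_distrib ennreal_mult)
  also have "\<dots> = ennreal (D\<^sup>2) * (\<integral>\<^sup>+v. ennreal ((cmod (fourier g (0 + L *\<^sub>R v)))\<^sup>2) \<partial>lborel)"
    by (rule nn_integral_cmult) measurable
  also have "\<dots> = ennreal D * (ennreal D * (\<integral>\<^sup>+v. ennreal ((cmod (fourier g (0 + L *\<^sub>R v)))\<^sup>2) \<partial>lborel))"
    using D by (simp add: power2_eq_square ennreal_mult mult.assoc)
  also have "ennreal D * (\<integral>\<^sup>+v. ennreal ((cmod (fourier g (0 + L *\<^sub>R v)))\<^sup>2) \<partial>lborel) = sqnorm lborel (fourier g)"
    unfolding sqnorm_def D_def using L
    by (subst (2) nn_integral_affine[where c=L and t=0]) auto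
  also have "\<dots> = sqnorm lborel g" by (rule plancherel_unit_cube[OF _ g_supp fg]) measurable
  finally show ?thesis by (simp add: nf)
qed


section \<open>The kernel of the Weyl transform\<close>

text \<open>
  The defining integral of the kernel without truncation. For square integrable \<open>f\<close> of bounded
  support in the first variable it converges absolutely for almost every \<open>(\<xi>, \<eta>)\<close>; elsewhere its
  value is the default of the integral.
\<close>

definition direct_kernel ::
  "((real ^ 'n) \<times> (real ^ 'n) \<Rightarrow> complex) \<Rightarrow> (real ^ 'n) \<times> (real ^ 'n) \<Rightarrow> complex" where
  "direct_kernel f = (\<lambda>(\<xi>, \<eta>). LINT x|lborel. f (x, \<eta> - \<xi>) * cis (pi * (x \<bullet> (\<xi> + \<eta>))))"

definition truncate_fst :: "real \<Rightarrow> ((real ^ 'n) \<times> (real ^ 'n) \<Rightarrow> complex) \<Rightarrow> (real ^ 'n) \<times> (real ^ 'n) \<Rightarrow> complex" where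
  "truncate_fst R f = (\<lambda>(x, y). if norm x \<le> R then f (x, y) else 0)"

lemma truncated_kernel_eq: "truncated_kernel N f = direct_kernel (truncate_fst (real N) f)"
  unfolding truncated_kernel_def direct_kernel_def truncate_fst_def set_lebesgue_integral_def
  by (intro ext) (auto intro!: Bochner_Integration.integral_cong simp: indicator_def)

lemma truncate_fst_measurable [measurable]:
  assumes [measurable]: "f \<in> borel_measurable borel"
  shows "truncate_fst R f \<in> borel_measurable borel"
proof -
  have [measurable]: "(\<lambda>z :: (real ^ 'n) \<times> (real ^ 'n). norm (fst z)) \<in> borel_measurable borel"
    by (intro borel_measurable_continuous_onI continuous_intros)
  have "truncate_fst R f = (\<lambda>z. if norm (fst z) \<le> R then f z else 0)"
    by (auto simp: truncate_fst_def)
  then show ?thesis by simp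
qed

lemma truncate_fst_l2: assumes "l2 lborel f" shows "l2 lborel (truncate_fst R f)"
proof -
  have [measurable]: "f \<in> borel_measurable borel" using assms by (simp add: l2_def)
  have "sqnorm lborel (truncate_fst R f) \<le> sqnorm lborel f"
    unfolding sqnorm_def truncate_fst_def by (intro nn_integral_mono) auto
  then show ?thesis using assms by (auto simp: l2_def intro: le_less_trans)
qed

lemma truncate_fst_tendsto: assumes "l2 lborel f" shows "l2_tendsto lborel (\<lambda>N. truncate_fst (real N) f) f"
proof -
  have [measurable]: "f \<in> borel_measurable borel" using assms by (simp add: l2_def)
  have "(\<lambda>N. sqnorm lborel (\<lambda>z. f z - truncate_fst (real N) f z)) \<longlonglongrightarrow> 0"
  proof (rule sqnorm_tendsto_0_dominated[where w="\<lambda>z. cmod (f z)"])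
    show "AE z in lborel. (\<lambda>N. truncate_fst (real N) f z) \<longlonglongrightarrow> f z"
    proof (rule AE_I2)
      fix z :: "(real ^ 'a) \<times> (real ^ 'a)"
      obtain N0 where "norm (fst z) \<le> real N0" using real_arch_simple by blast
      then have "truncate_fst (real N) f z = f z" if "N0 \<le> N" for N
        using that by (cases z) (auto simp: truncate_fst_def)
      then show "(\<lambda>N. truncate_fst (real N) f z) \<longlonglongrightarrow> f z"
        by (intro tendsto_eventually) (auto simp: eventually_sequentially)
    qed
    show "AE z in lborel. cmod (truncate_fst (real n) f z) \<le> cmod (f z)" for n
      by (auto simp: truncate_fst_def)
    show "(\<integral>\<^sup>+ z. ennreal ((cmod (f z))\<^sup>2) \<partial>lborel) < \<infinity>"
      using assms by (simp add: l2_def sqnorm_def)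
  qed auto
  then show ?thesis by (simp add: l2_tendsto_def sqnorm_minus_commute[of _ "f"])
qed

lemma nn_integral_lborel_pair:
  fixes f :: "'a::euclidean_space \<times> 'b::euclidean_space \<Rightarrow> ennreal"
  assumes [measurable]: "f \<in> borel_measurable borel"
  shows "(\<integral>\<^sup>+z. f z \<partial>lborel) = (\<integral>\<^sup>+x. \<integral>\<^sup>+y. f (x, y) \<partial>lborel \<partial>lborel)"
    and "(\<integral>\<^sup>+z. f z \<partial>lborel) = (\<integral>\<^sup>+y. \<integral>\<^sup>+x. f (x, y) \<partial>lborel \<partial>lborel)"
proof -
  have [measurable]: "f \<in> borel_measurable (lborel \<Otimes>\<^sub>M lborel)"
    using assms by (simp add: lborel_prod)
  show "(\<integral>\<^sup>+z. f z \<partial>lborel) = (\<integral>\<^sup>+x. \<integral>\<^sup>+y. f (x, y) \<partial>lborel \<partial>lborel)"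
    by (subst lborel_prod[symmetric], subst lborel.nn_integral_fst[symmetric]) auto
  show "(\<integral>\<^sup>+z. f z \<partial>lborel) = (\<integral>\<^sup>+y. \<integral>\<^sup>+x. f (x, y) \<partial>lborel \<partial>lborel)"
    by (subst lborel_prod[symmetric], subst lborel_pair.nn_integral_snd[symmetric]) auto
qed

lemma sqnorm_fibres:
  fixes f :: "'a::euclidean_space \<times> 'b::euclidean_space \<Rightarrow> complex"
  assumes [measurable]: "f \<in> borel_measurable borel"
  shows "sqnorm lborel f = (\<integral>\<^sup>+u. sqnorm lborel (\<lambda>x. f (x, u)) \<partial>lborel)"
  unfolding sqnorm_def by (rule nn_integral_lborel_pair(2)) measurable

text \<open>
  In the coordinates \<open>u = \<eta> - \<xi>\<close> and \<open>v = (\<xi> + \<eta>) / 2\<close> the kernel is the Fourier transform in the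
  first variable, evaluated at \<open>v\<close>.
\<close>

lemma direct_kernel_sheared:
  "direct_kernel f (\<xi>, u + \<xi>) = fourier (\<lambda>x. f (x, u)) (\<xi> + (1/2) *\<^sub>R u)"
proof -
  have "pi * (x \<bullet> (\<xi> + (u + \<xi>))) = 2 * pi * (x \<bullet> (\<xi> + (1/2) *\<^sub>R u))" for x
    by (simp only: inner_add_right inner_scaleR_right) (simp add: algebra_simps)
  then show ?thesis
    unfolding direct_kernel_def fourier_def by (simp only: prod.case add_diff_cancel_right')
qed

lemma direct_kernel_measurable [measurable]:
  assumes [measurable]: "f \<in> borel_measurable borel"
  shows "direct_kernel f \<in> borel_measurable borel"
proof -
  have [measurable]: "f \<in> borel_measurable (borel \<Otimes>\<^sub>M borel)" using assms by (simp add: borel_prod)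
  have "direct_kernel f \<in> borel_measurable (borel \<Otimes>\<^sub>M borel)"
    unfolding direct_kernel_def by measurable
  then show ?thesis by (simp add: borel_prod)
qed

text \<open>
  Truncations have bounded support in the first variable, and twisted translations preserve this
  property, although they move the ball of truncation.
\<close>

definition fst_bounded :: "((real ^ 'n) \<times> (real ^ 'n) \<Rightarrow> complex) \<Rightarrow> bool" where
  "fst_bounded f \<longleftrightarrow> (\<exists>R. \<forall>x y. R < norm x \<longrightarrow> f (x, y) = 0)"

lemma fst_bounded_truncate: "fst_bounded (truncate_fst R f)"
  unfolding fst_bounded_def truncate_fst_def by (rule exI[of _ R]) auto

lemma fst_bounded_diff:
  assumes "fst_bounded f" "fst_bounded g" shows "fst_bounded (\<lambda>z. f z - c * g z)"
proof -
  obtain R where "\<And>x y. R < norm x \<Longrightarrow> f (x, y) = 0"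
    using assms(1) unfolding fst_bounded_def by blast
  moreover obtain S where "\<And>x y. S < norm x \<Longrightarrow> g (x, y) = 0"
    using assms(2) unfolding fst_bounded_def by blast
  ultimately show ?thesis unfolding fst_bounded_def by (intro exI[of _ "max R S"]) auto
qed

lemma AE_fibre_l2: assumes "l2 lborel f" shows "AE u in lborel. sqnorm lborel (\<lambda>x. f (x, u)) < \<infinity>"
proof -
  have [measurable]: "f \<in> borel_measurable borel" using assms by (simp add: l2_def)
  then have [measurable]: "f \<in> borel_measurable (borel \<Otimes>\<^sub>M borel)" by (simp add: borel_prod)
  have "(\<integral>\<^sup>+u. sqnorm lborel (\<lambda>x. f (x, u)) \<partial>lborel) = sqnorm lborel f"
    by (rule sqnorm_fibres[symmetric]) measurable
  then have "(\<integral>\<^sup>+u. sqnorm lborel (\<lambda>x. f (x, u)) \<partial>lborel) \<noteq> \<infinity>" using assms by (simp add: l2_def)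
  then have "AE u in lborel. sqnorm lborel (\<lambda>x. f (x, u)) \<noteq> \<infinity>"
    by (intro nn_integral_PInf_AE) (auto simp: sqnorm_def)
  then show ?thesis by (simp add: less_top[symmetric])
qed

text \<open>
  Both coordinate changes in \<open>direct_kernel_sheared\<close> are translations in one variable with the other
  one fixed, so Tonelli's theorem reduces the claim to Plancherel's theorem on almost every fibre.
\<close>

lemma sqnorm_direct_kernel:
  assumes f: "l2 lborel f" and bd: "fst_bounded f"
  shows "sqnorm lborel (direct_kernel f) = sqnorm lborel f"
proof -
  have [measurable]: "f \<in> borel_measurable borel" using f by (simp add: l2_def)
  then have [measurable]: "f \<in> borel_measurable (borel \<Otimes>\<^sub>M borel)" by (simp add: borel_prod)
  have [measurable]: "direct_kernel f \<in> borel_measurable (borel \<Otimes>\<^sub>M borel)"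
    using direct_kernel_measurable[of f] by (simp add: borel_prod)
  define K where "K z = ennreal ((cmod (direct_kernel f z))\<^sup>2)" for z
  have [measurable]: "K \<in> borel_measurable borel" "K \<in> borel_measurable (borel \<Otimes>\<^sub>M borel)"
    unfolding K_def by measurable
  have "sqnorm lborel (direct_kernel f) = (\<integral>\<^sup>+\<xi>. \<integral>\<^sup>+\<eta>. K (\<xi>, \<eta>) \<partial>lborel \<partial>lborel)"
    unfolding sqnorm_def K_def[symmetric] by (rule nn_integral_lborel_pair(1)) measurable
  also have "\<dots> = (\<integral>\<^sup>+\<xi>. \<integral>\<^sup>+u. K (\<xi>, u + \<xi>) \<partial>lborel \<partial>lborel)"
    by (intro nn_integral_cong nn_integral_translate[symmetric]) measurable
  also have "\<dots> = (\<integral>\<^sup>+u. \<integral>\<^sup>+\<xi>. K (\<xi>, u + \<xi>) \<partial>lborel \<partial>lborel)"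
    by (rule lborel_pair.Fubini') measurable
  also have "\<dots> = (\<integral>\<^sup>+u. sqnorm lborel (\<lambda>x. f (x, u)) \<partial>lborel)"
  proof (rule nn_integral_cong_AE)
    show "AE u in lborel. (\<integral>\<^sup>+\<xi>. K (\<xi>, u + \<xi>) \<partial>lborel) = sqnorm lborel (\<lambda>x. f (x, u))"
      using AE_fibre_l2[OF f]
    proof eventually_elim
      case (elim u)
      have [measurable]: "fourier (\<lambda>x. f (x, u)) \<in> borel_measurable borel"
        by (rule fourier_measurable) measurable
      have "(\<integral>\<^sup>+\<xi>. K (\<xi>, u + \<xi>) \<partial>lborel) = sqnorm lborel (fourier (\<lambda>x. f (x, u)))"
        unfolding K_def direct_kernel_sheared sqnorm_def by (rule nn_integral_translate) measurable
      also have "\<dots> = sqnorm lborel (\<lambda>x. f (x, u))"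
        using bd elim by (auto simp: fst_bounded_def intro!: plancherel_bounded_support)
      finally show ?case .
    qed
  qed
  also have "\<dots> = sqnorm lborel f"
    by (rule sqnorm_fibres[symmetric]) measurable
  finally show ?thesis .
qed

lemma direct_kernel_l2: "l2 lborel f \<Longrightarrow> fst_bounded f \<Longrightarrow> l2 lborel (direct_kernel f)"
  using direct_kernel_measurable[of f] sqnorm_direct_kernel[of f] by (auto simp: l2_def)

lemma integrable_bounded_support:
  fixes g :: "real ^ 'n \<Rightarrow> complex"
  assumes [measurable]: "g \<in> borel_measurable borel" and "sqnorm lborel g < \<infinity>" "\<And>x. R < norm x \<Longrightarrow> g x = 0"
  shows "integrable lborel g"
proof -
  have "l2 lborel (\<lambda>x :: real ^ 'n. indicator (cball 0 R) x)"
  proof -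
    have "sqnorm lborel (\<lambda>x :: real ^ 'n. indicator (cball 0 R) x) = (\<integral>\<^sup>+x. indicator (cball (0 :: real ^ 'n) R) x \<partial>lborel)"
      unfolding sqnorm_def by (rule nn_integral_cong) (simp add: indicator_def)
    also have "\<dots> = emeasure lborel (cball (0 :: real ^ 'n) R)" by simp
    also have "\<dots> < \<infinity>" by (rule emeasure_lborel_cball_finite)
    finally show ?thesis unfolding l2_def by (intro conjI borel_measurable_indicator) auto
  qed
  then have "integrable lborel (\<lambda>x. g x * cnj (indicator (cball 0 R) x))"
    using assms(1,2) by (intro l2_integrable_mult) (auto simp: l2_def)
  moreover have "g x * cnj (indicator (cball 0 R) x) = g x" for x
    using assms(3)[of x] by (auto simp: indicator_def)
  ultimately show ?thesis by simp
qed

lemma AE_sheared: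
  fixes P :: "real ^ 'n \<Rightarrow> bool"
  assumes [measurable]: "Measurable.pred borel P" and P: "AE u in lborel. P u"
  shows "AE z in lborel. P (snd z - fst z)"
proof -
  have "AE \<xi> in lborel. AE \<eta> in lborel. P (\<eta> - \<xi>)"
  proof (rule AE_I2)
    fix \<xi> :: "real ^ 'n"
    have "AE u in distr lborel borel ((+) (- \<xi>)). P u" using P by (subst lborel_distr_plus)
    then have "AE \<eta> in lborel. P (- \<xi> + \<eta>)" by (rule AE_distrD[rotated]) simp
    then show "AE \<eta> in lborel. P (\<eta> - \<xi>)" by simp
  qed
  then have "AE z in lborel \<Otimes>\<^sub>M lborel. P (snd z - fst z)"
  proof (intro lborel_pair.AE_pair_measure)
    have "(\<lambda>z. snd z - fst z) \<in> lborel \<Otimes>\<^sub>M lborel \<rightarrow>\<^sub>M (borel :: (real ^ 'n) measure)" by measurable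
    then have "Measurable.pred (lborel \<Otimes>\<^sub>M lborel) (\<lambda>z. P (snd z - fst z))"
      by (rule measurable_compose[OF _ assms(1)])
    then show "{z \<in> space (lborel \<Otimes>\<^sub>M lborel). P (snd z - fst z)} \<in> sets (lborel \<Otimes>\<^sub>M lborel)"
      unfolding pred_def .
  qed simp
  then show ?thesis unfolding lborel_prod .
qed

text \<open>
  The identity can fail at points where one of the two integrals diverges, but these form a null set.
\<close>

lemma direct_kernel_linear:
  assumes f: "l2 lborel f" "fst_bounded f" and g: "l2 lborel g" "fst_bounded g"
  shows "AE z in lborel. direct_kernel (\<lambda>z. f z - c * g z) z = direct_kernel f z - c * direct_kernel g z"
proof -
  have m: "f \<in> borel_measurable borel" "g \<in> borel_measurable borel" using f g by (simp_all add: l2_def)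
  then have m': "f \<in> borel_measurable (borel \<Otimes>\<^sub>M borel)" "g \<in> borel_measurable (borel \<Otimes>\<^sub>M borel)"
    by (simp_all add: borel_prod)
  note [measurable] = m m'
  have 1: "AE z in lborel. sqnorm lborel (\<lambda>x. f (x, snd z - fst z)) < \<infinity>"
    by (rule AE_sheared[OF _ AE_fibre_l2[OF f(1)]]) (unfold sqnorm_def, measurable)
  have 2: "AE z in lborel. sqnorm lborel (\<lambda>x. g (x, snd z - fst z)) < \<infinity>"
    by (rule AE_sheared[OF _ AE_fibre_l2[OF g(1)]]) (unfold sqnorm_def, measurable)
  show ?thesis using 1 2
  proof eventually_elim
    case (elim z)
    obtain \<xi> \<eta> where z: "z = (\<xi>, \<eta>)" by (cases z)
    have i: "integrable lborel (\<lambda>x. h (x, \<eta> - \<xi>) * cis (pi * (x \<bullet> (\<xi> + \<eta>))))"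
      if h: "sqnorm lborel (\<lambda>x. h (x, \<eta> - \<xi>)) < \<infinity>" "fst_bounded h" and [measurable]: "h \<in> borel_measurable (borel \<Otimes>\<^sub>M borel)" for h
    proof -
      obtain R where R: "\<And>x y. R < norm x \<Longrightarrow> h (x, y) = 0" using h(2) unfolding fst_bounded_def by blast
      show ?thesis
      proof (rule integrable_bounded_support[of _ R])
        show "sqnorm lborel (\<lambda>x. h (x, \<eta> - \<xi>) * cis (pi * (x \<bullet> (\<xi> + \<eta>)))) < \<infinity>"
          using h(1) by (simp add: sqnorm_def norm_mult)
      qed (use R in auto)
    qed
    show ?case
      using i[OF _ f(2) m'(1)] i[OF _ g(2) m'(2)] elim
      by (simp add: z direct_kernel_def left_diff_distrib mult.assoc)
  qed
qed

text \<open>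
  The truncations of \<open>f\<close> form a Cauchy sequence and \<open>direct_kernel\<close> is isometric on them, so
  completeness provides the limit that the definition of \<open>weyl_kernel\<close> selects.
\<close>

theorem weyl_kernel_exists:
  assumes f: "l2 lborel f"
  shows "l2 lborel (weyl_kernel f)" "l2_tendsto lborel (\<lambda>N. direct_kernel (truncate_fst (real N) f)) (weyl_kernel f)"
proof -
  have t: "l2 lborel (truncate_fst R f)" for R by (rule truncate_fst_l2[OF f])
  have dt: "l2 lborel (direct_kernel (truncate_fst R f))" for R
    by (intro direct_kernel_l2 t fst_bounded_truncate)
  have iso: "sqnorm lborel (\<lambda>z. direct_kernel (truncate_fst R f) z - direct_kernel (truncate_fst S f) z) =
      sqnorm lborel (\<lambda>z. truncate_fst R f z - truncate_fst S f z)" for R S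
  proof -
    have "sqnorm lborel (\<lambda>z. direct_kernel (truncate_fst R f) z - 1 * direct_kernel (truncate_fst S f) z) =
      sqnorm lborel (direct_kernel (\<lambda>z. truncate_fst R f z - 1 * truncate_fst S f z))"
      by (rule sqnorm_cong_AE, rule AE_symmetric, rule direct_kernel_linear) (intro t fst_bounded_truncate)+
    also have "\<dots> = sqnorm lborel (\<lambda>z. truncate_fst R f z - 1 * truncate_fst S f z)"
      by (intro sqnorm_direct_kernel l2_diff l2_cmult t fst_bounded_diff fst_bounded_truncate)
    finally show ?thesis by simp
  qed
  have "\<exists>K. l2 lborel K \<and> l2_tendsto lborel (\<lambda>N. direct_kernel (truncate_fst (real N) f)) K"
  proof (rule l2_complete[OF dt])
    fix e :: real assume "0 < e"
    then have "0 < ennreal (e / 4)" by simp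
    then have "\<forall>\<^sub>F N in sequentially. sqnorm lborel (\<lambda>z. truncate_fst (real N) f z - f z) < ennreal (e / 4)"
      using truncate_fst_tendsto[OF f] unfolding l2_tendsto_def by (intro order_tendstoD(2)) auto
    then obtain N0 where N0: "\<And>N. N0 \<le> N \<Longrightarrow> sqnorm lborel (\<lambda>z. truncate_fst (real N) f z - f z) < ennreal (e / 4)"
      by (auto simp: eventually_sequentially)
    have "sqnorm lborel (\<lambda>z. truncate_fst (real m) f z - truncate_fst (real n) f z) < ennreal e" if "N0 \<le> m" "N0 \<le> n" for m n
    proof -
      have "sqnorm lborel (\<lambda>z. truncate_fst (real m) f z - truncate_fst (real n) f z) \<le>
          2 * sqnorm lborel (\<lambda>z. truncate_fst (real m) f z - f z) + 2 * sqnorm lborel (\<lambda>z. f z - truncate_fst (real n) f z)"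
        by (intro sqnorm_triangle l2_measurable t f)
      also have "\<dots> < ennreal e"
        unfolding sqnorm_minus_commute[of lborel f] by (intro ennreal_quarter_bound N0 that)
      finally show ?thesis .
    qed
    then show "\<exists>N. \<forall>m\<ge>N. \<forall>n\<ge>N. sqnorm lborel (\<lambda>z. direct_kernel (truncate_fst (real m) f) z - direct_kernel (truncate_fst (real n) f) z) < ennreal e"
      unfolding iso by blast
  qed
  then have "\<exists>K. square_integrable K \<and> L2_tendsto (\<lambda>N. truncated_kernel N f) K"
    by (simp add: square_integrable_iff_l2 L2_tendsto_eq truncated_kernel_eq)
  from someI_ex[OF this, folded weyl_kernel_def]
  show "l2 lborel (weyl_kernel f)" "l2_tendsto lborel (\<lambda>N. direct_kernel (truncate_fst (real N) f)) (weyl_kernel f)"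
    by (simp_all add: square_integrable_iff_l2 L2_tendsto_eq truncated_kernel_eq)
qed

lemmas weyl_kernel_l2 = weyl_kernel_exists(1)

lemma sqnorm_weyl_kernel:
  assumes f: "l2 lborel f" shows "sqnorm lborel (weyl_kernel f) = sqnorm lborel f"
proof (rule LIMSEQ_unique)
  have "(\<lambda>N. sqnorm lborel (direct_kernel (truncate_fst (real N) f))) \<longlonglongrightarrow> sqnorm lborel (weyl_kernel f)"
    by (intro l2_tendsto_sqnorm weyl_kernel_exists f direct_kernel_l2 truncate_fst_l2 fst_bounded_truncate)
  then show "(\<lambda>N. sqnorm lborel (truncate_fst (real N) f)) \<longlonglongrightarrow> sqnorm lborel (weyl_kernel f)"
    by (simp add: sqnorm_direct_kernel truncate_fst_l2[OF f] fst_bounded_truncate)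
  show "(\<lambda>N. sqnorm lborel (truncate_fst (real N) f)) \<longlonglongrightarrow> sqnorm lborel f"
    by (intro l2_tendsto_sqnorm truncate_fst_l2 truncate_fst_tendsto f)
qed

lemma weyl_kernel_linear:
  assumes f: "l2 lborel f" and g: "l2 lborel g"
  shows "AE z in lborel. weyl_kernel (\<lambda>z. f z - c * g z) z = weyl_kernel f z - c * weyl_kernel g z"
proof (rule l2_tendsto_unique)
  define h where "h = (\<lambda>z. f z - c * g z)"
  have h: "l2 lborel h" unfolding h_def by (intro l2_diff l2_cmult f g)
  have dt: "l2 lborel (direct_kernel (truncate_fst R u))" if "l2 lborel u" for R u
    by (intro direct_kernel_l2 truncate_fst_l2 that fst_bounded_truncate)
  show "direct_kernel (truncate_fst (real N) h) \<in> borel_measurable lborel" for N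
    by (rule l2_measurable[OF dt[OF h]])
  show "weyl_kernel (\<lambda>z. f z - c * g z) \<in> borel_measurable lborel"
    using l2_measurable[OF weyl_kernel_l2[OF h]] by (simp add: h_def)
  show "(\<lambda>z. weyl_kernel f z - c * weyl_kernel g z) \<in> borel_measurable lborel"
    by (intro l2_measurable[of lborel] l2_diff l2_cmult weyl_kernel_l2 f g)
  show "l2_tendsto lborel (\<lambda>N. direct_kernel (truncate_fst (real N) h)) (weyl_kernel (\<lambda>z. f z - c * g z))"
    using weyl_kernel_exists(2)[OF h] by (simp add: h_def)
  show "l2_tendsto lborel (\<lambda>N. direct_kernel (truncate_fst (real N) h)) (\<lambda>z. weyl_kernel f z - c * weyl_kernel g z)"
  proof (rule l2_tendsto_cong_AE)
    show "l2_tendsto lborel (\<lambda>N z. direct_kernel (truncate_fst (real N) f) z - c * direct_kernel (truncate_fst (real N) g) z)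
        (\<lambda>z. weyl_kernel f z - c * weyl_kernel g z)"
      by (rule l2_tendsto_diff l2_tendsto_cmult l2_measurable l2_cmult dt f g weyl_kernel_exists)+
    have t: "truncate_fst R h = (\<lambda>z. truncate_fst R f z - c * truncate_fst R g z)" for R
      by (auto simp: truncate_fst_def h_def)
    show "AE z in lborel. direct_kernel (truncate_fst (real N) f) z - c * direct_kernel (truncate_fst (real N) g) z =
        direct_kernel (truncate_fst (real N) h) z" for N
      unfolding t by (rule AE_symmetric, rule direct_kernel_linear) (intro truncate_fst_l2 f g fst_bounded_truncate)+
  qed
qed

lemma sqnorm_weyl_kernel_diff:
  assumes f: "l2 lborel f" and g: "l2 lborel g"
  shows "sqnorm lborel (\<lambda>z. weyl_kernel f z - c * weyl_kernel g z) = sqnorm lborel (\<lambda>z. f z - c * g z)"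
proof -
  have "sqnorm lborel (\<lambda>z. weyl_kernel f z - c * weyl_kernel g z) = sqnorm lborel (weyl_kernel (\<lambda>z. f z - c * g z))"
    by (rule sqnorm_cong_AE, rule AE_symmetric, rule weyl_kernel_linear[OF f g])
  also have "\<dots> = sqnorm lborel (\<lambda>z. f z - c * g z)"
    by (intro sqnorm_weyl_kernel l2_diff l2_cmult f g)
  finally show ?thesis .
qed

text \<open>
  Polarization: an isometry preserves the squared norms of \<open>f - c g\<close> for \<open>c\<close> among 1, -1, \<open>\<i>\<close>
  and \<open>- \<i>\<close>, and these determine the inner product.
\<close>

theorem l2_inner_weyl_kernel:
  assumes f: "l2 lborel f" and g: "l2 lborel g"
  shows "l2_inner lborel (weyl_kernel f) (weyl_kernel g) = l2_inner lborel f g"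
proof -
  have expand: "Re (l2_inner M (\<lambda>x. u x - c * v x) (\<lambda>x. u x - c * v x)) =
      Re (l2_inner M u u) - 2 * Re (cnj c * l2_inner M u v) + (cmod c)\<^sup>2 * Re (l2_inner M v v)"
    if "l2 M u" "l2 M v" for M :: "'z measure" and u v c
  proof -
    have "l2_inner M u (\<lambda>x. c * v x) = cnj c * l2_inner M u v"
      by (simp add: l2_inner_commute[of M u] l2_inner_cmult_left)
    moreover have "l2_inner M (\<lambda>x. c * v x) (\<lambda>x. c * v x) = c * (cnj c * l2_inner M v v)"
      by (simp add: l2_inner_cmult_left l2_inner_commute[of M v "\<lambda>x. c * v x"] l2_inner_commute[of M v v, symmetric])
    moreover have "c * (cnj c * l2_inner M v v) = of_real ((cmod c)\<^sup>2) * l2_inner M v v"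
      by (simp only: complex_norm_square mult.assoc)
    ultimately show ?thesis
      using that by (simp add: l2_inner_diff_self l2_cmult)
  qed
  have "Re (l2_inner lborel (\<lambda>x. weyl_kernel f x - c * weyl_kernel g x) (\<lambda>x. weyl_kernel f x - c * weyl_kernel g x)) =
      Re (l2_inner lborel (\<lambda>x. f x - c * g x) (\<lambda>x. f x - c * g x))" for c
    using sqnorm_weyl_kernel_diff[OF f g, of c]
    by (simp add: sqnorm_eq_inner l2_diff l2_cmult weyl_kernel_l2 f g l2_inner_self_nonneg)
  then have *: "Re (l2_inner lborel (weyl_kernel f) (weyl_kernel f)) -
        2 * Re (cnj c * l2_inner lborel (weyl_kernel f) (weyl_kernel g)) +
        (cmod c)\<^sup>2 * Re (l2_inner lborel (weyl_kernel g) (weyl_kernel g)) =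
      Re (l2_inner lborel f f) - 2 * Re (cnj c * l2_inner lborel f g) + (cmod c)\<^sup>2 * Re (l2_inner lborel g g)" for c
    by (simp add: expand weyl_kernel_l2 f g)
  show ?thesis
    using *[of 1] *[of "-1"] *[of \<i>] *[of "-\<i>"] by (intro complex_eqI) auto
qed

lemma weyl_kernel_cong_AE:
  assumes "l2 lborel f" "l2 lborel g" "AE z in lborel. f z = g z"
  shows "AE z in lborel. weyl_kernel f z = weyl_kernel g z"
proof -
  have m: "l2 lborel (\<lambda>z. weyl_kernel f z - 1 * weyl_kernel g z)"
    by (intro l2_diff l2_cmult weyl_kernel_l2 assms)
  have m2: "l2 lborel (\<lambda>z. f z - 1 * g z)" by (intro l2_diff l2_cmult assms)
  have "sqnorm lborel (\<lambda>z. f z - 1 * g z) = 0"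
    using assms(3) l2_measurable[OF m2] by (subst sqnorm_eq_0_iff) auto
  then have "sqnorm lborel (\<lambda>z. weyl_kernel f z - 1 * weyl_kernel g z) = 0"
    using sqnorm_weyl_kernel_diff[OF assms(1,2), of 1] by simp
  then show ?thesis using l2_measurable[OF m] by (subst (asm) sqnorm_eq_0_iff) auto
qed

lemma weyl_kernel_tendsto:
  assumes "\<And>n. l2 lborel (F n)" "l2 lborel f" "l2_tendsto lborel F f"
  shows "l2_tendsto lborel (\<lambda>n. weyl_kernel (F n)) (weyl_kernel f)"
  using assms(3) sqnorm_weyl_kernel_diff[OF assms(1,2), of _ 1] by (simp add: l2_tendsto_def)

lemma weyl_kernel_cmult:
  assumes "l2 lborel f"
  shows "AE z in lborel. weyl_kernel (\<lambda>z. c * f z) z = c * weyl_kernel f z"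
proof -
  have "sqnorm lborel (weyl_kernel (\<lambda>z. 0 :: complex) :: (real ^ 'a) \<times> (real ^ 'a) \<Rightarrow> complex) = 0"
    by (simp add: sqnorm_weyl_kernel) (simp add: sqnorm_def)
  then have "AE z in lborel. weyl_kernel (\<lambda>z. 0 :: complex) (z :: (real ^ 'a) \<times> (real ^ 'a)) = 0"
    using l2_measurable[OF weyl_kernel_l2[OF l2_zero]] by (subst (asm) sqnorm_eq_0_iff) auto
  with weyl_kernel_linear[OF l2_zero assms, of "- c"] show ?thesis by eventually_elim simp
qed

lemma weyl_kernel_sum:
  assumes "finite I" "\<And>i. i \<in> I \<Longrightarrow> l2 lborel (f i)"
  shows "AE z in lborel. weyl_kernel (\<lambda>z. \<Sum>i\<in>I. f i z) z = (\<Sum>i\<in>I. weyl_kernel (f i) z)"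
  using assms
proof (induction rule: finite_induct)
  case empty
  show ?case using weyl_kernel_cmult[OF l2_zero, of 0] by simp
next
  case (insert i I)
  have "l2 lborel (\<lambda>z. \<Sum>i\<in>I. f i z)" using insert by (intro l2_sum) auto
  from weyl_kernel_linear[OF insert.prems[of i] this, of "-1"]
  show ?case using insert.IH[OF insert.prems] insert.hyps by (auto elim: eventually_elim2)
qed


section \<open>Twisted translations\<close>

lemma twisted_translation_apply:
  "twisted_translation k l f (x, y) =
    cis (pi * (x \<bullet> lattice_pt l - y \<bullet> lattice_pt k)) * f ((x, y) - (lattice_pt k, lattice_pt l))"
  by (simp add: twisted_translation_def)

lemma twisted_translation_measurable [measurable]:
  assumes [measurable]: "f \<in> borel_measurable borel"
  shows "twisted_translation k l f \<in> borel_measurable borel"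
proof -
  have [measurable]: "f \<in> borel_measurable (borel \<Otimes>\<^sub>M borel)" using assms by (simp add: borel_prod)
  have "twisted_translation k l f \<in> borel_measurable (borel \<Otimes>\<^sub>M borel)"
    unfolding twisted_translation_def by measurable
  then show ?thesis by (simp add: borel_prod)
qed

lemma sqnorm_twisted_translation:
  assumes [measurable]: "f \<in> borel_measurable borel"
  shows "sqnorm lborel (twisted_translation k l f) = sqnorm lborel f"
proof -
  have "sqnorm lborel (twisted_translation k l f) =
      (\<integral>\<^sup>+z. ennreal ((cmod (f (z + (- (lattice_pt k, lattice_pt l)))))\<^sup>2) \<partial>lborel)"
    unfolding sqnorm_def by (intro nn_integral_cong) (auto simp: twisted_translation_apply norm_mult)
  also have "\<dots> = sqnorm lborel f"
    unfolding sqnorm_def by (rule nn_integral_translate) measurable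
  finally show ?thesis .
qed

lemma twisted_translation_l2: "l2 lborel f \<Longrightarrow> l2 lborel (twisted_translation k l f)"
  using sqnorm_twisted_translation[of f k l] twisted_translation_measurable[of f k l] by (auto simp: l2_def)

lemma twisted_translation_diff:
  "twisted_translation k l (\<lambda>z. f z - g z) = (\<lambda>z. twisted_translation k l f z - twisted_translation k l g z)"
  by (auto simp: twisted_translation_apply right_diff_distrib)

lemma l2_inner_twisted_translation:
  assumes f: "l2 lborel f" and g: "l2 lborel g"
  shows "l2_inner lborel (twisted_translation k l f) g = l2_inner lborel f (twisted_translation (- k) (- l) g)"
proof -
  have [measurable]: "f \<in> borel_measurable borel" "g \<in> borel_measurable borel" using f g by (simp_all add: l2_def)
  have "l2_inner lborel (twisted_translation k l f) g =
      (LINT z|lborel. twisted_translation k l f (z + (lattice_pt k, lattice_pt l)) * cnj (g (z + (lattice_pt k, lattice_pt l))))"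
    unfolding l2_inner_def by (rule integral_translate[symmetric]) measurable
  also have "\<dots> = l2_inner lborel f (twisted_translation (- k) (- l) g)"
    unfolding l2_inner_def
  proof (rule Bochner_Integration.integral_cong)
    fix z :: "(real ^ 'a) \<times> (real ^ 'a)"
    obtain x y where z: "z = (x, y)" by (cases z)
    have "(x + lattice_pt k) \<bullet> lattice_pt l - (y + lattice_pt l) \<bullet> lattice_pt k = x \<bullet> lattice_pt l - y \<bullet> lattice_pt k"
      by (simp add: inner_add_left inner_commute[of "lattice_pt l" "lattice_pt k"])
    then show "twisted_translation k l f (z + (lattice_pt k, lattice_pt l)) * cnj (g (z + (lattice_pt k, lattice_pt l))) =
        f z * cnj (twisted_translation (- k) (- l) g z)"
      by (simp add: z twisted_translation_apply cis_cnj right_diff_distrib)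
  qed simp
  finally show ?thesis .
qed

text \<open>
  The operator on kernels that corresponds to \<open>twisted_translation k l\<close>.
\<close>

definition modulated_shift :: "int ^ 'n \<Rightarrow> int ^ 'n \<Rightarrow> ((real ^ 'n) \<times> (real ^ 'n) \<Rightarrow> complex) \<Rightarrow> (real ^ 'n) \<times> (real ^ 'n) \<Rightarrow> complex" where
  "modulated_shift k l K =
    (\<lambda>z. cis (pi * (lattice_pt k \<bullet> lattice_pt l)) * character k (fst z) * K (z + (lattice_pt l, 0)))"

lemma borel_measurable_fst:
  fixes a :: "'a::euclidean_space \<Rightarrow> 'b::topological_space"
  assumes "a \<in> borel_measurable borel"
  shows "(\<lambda>z :: 'a \<times> 'c::euclidean_space. a (fst z)) \<in> borel_measurable borel"
proof -
  have "(fst :: 'a \<times> 'c \<Rightarrow> 'a) \<in> borel_measurable borel"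
    by (intro borel_measurable_continuous_onI continuous_intros)
  then show ?thesis by (rule measurable_compose[OF _ assms])
qed

lemma modulated_shift_measurable [measurable]:
  fixes K :: "(real ^ 'n) \<times> (real ^ 'n) \<Rightarrow> complex"
  assumes [measurable]: "K \<in> borel_measurable borel"
  shows "modulated_shift k l K \<in> borel_measurable borel"
proof -
  have [measurable]: "(\<lambda>z :: (real ^ 'n) \<times> (real ^ 'n). character k (fst z)) \<in> borel_measurable borel"
    by (rule borel_measurable_fst) measurable
  show ?thesis unfolding modulated_shift_def by measurable
qed

lemma sqnorm_modulated_shift:
  assumes [measurable]: "K \<in> borel_measurable borel"
  shows "sqnorm lborel (modulated_shift k l K) = sqnorm lborel K"
proof -
  have "sqnorm lborel (modulated_shift k l K) = (\<integral>\<^sup>+z. ennreal ((cmod (K (z + (lattice_pt l, 0))))\<^sup>2) \<partial>lborel)"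
    unfolding sqnorm_def by (intro nn_integral_cong) (auto simp: modulated_shift_def norm_mult)
  also have "\<dots> = sqnorm lborel K"
    unfolding sqnorm_def by (rule nn_integral_translate) measurable
  finally show ?thesis .
qed

lemma modulated_shift_l2: "l2 lborel K \<Longrightarrow> l2 lborel (modulated_shift k l K)"
  using sqnorm_modulated_shift[of K k l] modulated_shift_measurable[of K k l] by (auto simp: l2_def)

text \<open>
  Substitute \<open>x + k\<close> for \<open>x\<close>. The exponent splits into a part that is constant in \<open>x\<close>, which is the
  modulation, and the exponent of the kernel at \<open>(\<xi> + l, \<eta>)\<close>; moreover \<open>\<eta> - \<xi> - l = \<eta> - (\<xi> + l)\<close>.
\<close>

lemma direct_kernel_twisted_translation:
  assumes [measurable]: "f \<in> borel_measurable borel"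
  shows "direct_kernel (twisted_translation k l f) = modulated_shift k l (direct_kernel f)"
proof
  fix z :: "(real ^ 'a) \<times> (real ^ 'a)"
  obtain \<xi> \<eta> where z: "z = (\<xi>, \<eta>)" by (cases z)
  have [measurable]: "f \<in> borel_measurable (borel \<Otimes>\<^sub>M borel)" using assms by (simp add: borel_prod)
  define u where "u = \<eta> - \<xi>"
  define c where "c = cis (pi * (lattice_pt k \<bullet> lattice_pt l)) * character k \<xi>"
  define h where "h x = cis (pi * (x \<bullet> lattice_pt l - u \<bullet> lattice_pt k)) * f (x - lattice_pt k, u - lattice_pt l) *
      cis (pi * (x \<bullet> (\<xi> + \<eta>)))" for x
  have [measurable]: "h \<in> borel_measurable borel" unfolding h_def by measurable
  have "direct_kernel (twisted_translation k l f) z = (LINT x|lborel. h x)"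
    by (simp add: z direct_kernel_def twisted_translation_def h_def u_def)
  also have "\<dots> = (LINT x|lborel. h (x + lattice_pt k))"
    by (rule integral_translate[symmetric]) measurable
  also have "\<dots> = (LINT x|lborel. c * (f (x, \<eta> - (\<xi> + lattice_pt l)) * cis (pi * (x \<bullet> (\<xi> + lattice_pt l + \<eta>)))))"
  proof (rule Bochner_Integration.integral_cong)
    fix x
    have e: "pi * ((x + lattice_pt k) \<bullet> lattice_pt l - u \<bullet> lattice_pt k) + pi * ((x + lattice_pt k) \<bullet> (\<xi> + \<eta>)) =
        (pi * (lattice_pt k \<bullet> lattice_pt l) + 2 * pi * (\<xi> \<bullet> lattice_pt k)) + pi * (x \<bullet> (\<xi> + lattice_pt l + \<eta>))"
      by (simp add: u_def inner_add_left inner_add_right inner_diff_left inner_commute algebra_simps)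
    have "h (x + lattice_pt k) = (cis (pi * ((x + lattice_pt k) \<bullet> lattice_pt l - u \<bullet> lattice_pt k)) *
        cis (pi * ((x + lattice_pt k) \<bullet> (\<xi> + \<eta>)))) * f (x, u - lattice_pt l)"
      by (simp add: h_def)
    also have "\<dots> = c * cis (pi * (x \<bullet> (\<xi> + lattice_pt l + \<eta>))) * f (x, u - lattice_pt l)"
      unfolding c_def character_def cis_mult e ..
    also have "u - lattice_pt l = \<eta> - (\<xi> + lattice_pt l)" by (simp add: u_def)
    finally show "h (x + lattice_pt k) = c * (f (x, \<eta> - (\<xi> + lattice_pt l)) * cis (pi * (x \<bullet> (\<xi> + lattice_pt l + \<eta>))))"
      by (simp add: ac_simps)
  qed simp
  also have "\<dots> = modulated_shift k l (direct_kernel f) z"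
    by (simp add: z c_def modulated_shift_def direct_kernel_def)
  finally show "direct_kernel (twisted_translation k l f) z = modulated_shift k l (direct_kernel f) z" .
qed

lemma fst_bounded_twisted_translation:
  assumes "fst_bounded f" shows "fst_bounded (twisted_translation k l f)"
proof -
  obtain R where R: "\<And>x y. R < norm x \<Longrightarrow> f (x, y) = 0"
    using assms unfolding fst_bounded_def by blast
  have "f (x - lattice_pt k, y) = 0" if "R + norm (lattice_pt k) < norm x" for x y
    using that norm_triangle_ineq2[of x "lattice_pt k"] by (intro R) linarith
  then show ?thesis unfolding fst_bounded_def twisted_translation_def
    by (intro exI[of _ "R + norm (lattice_pt k)"]) simp
qed

lemma weyl_kernel_fst_bounded:
  assumes f: "l2 lborel f" and b: "fst_bounded f"
  shows "AE z in lborel. weyl_kernel f z = direct_kernel f z"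
proof (rule l2_tendsto_unique)
  obtain R where R: "\<And>x y. R < norm x \<Longrightarrow> f (x, y) = 0"
    using b unfolding fst_bounded_def by blast
  have t: "truncate_fst (real N) f = f" if "R \<le> real N" for N
    using R that by (fastforce simp: truncate_fst_def)
  show "l2_tendsto lborel (\<lambda>N. direct_kernel (truncate_fst (real N) f)) (direct_kernel f)"
    unfolding l2_tendsto_def
  proof (rule tendsto_eventually)
    obtain N0 where "R \<le> real N0" using real_arch_simple by blast
    then have "sqnorm lborel (\<lambda>z. direct_kernel (truncate_fst (real N) f) z - direct_kernel f z) = 0" if "N0 \<le> N" for N
      using that by (subst t) (auto simp: sqnorm_def)
    then show "\<forall>\<^sub>F N in sequentially. sqnorm lborel (\<lambda>z. direct_kernel (truncate_fst (real N) f) z - direct_kernel f z) = 0"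
      by (auto simp: eventually_sequentially)
  qed
  show "l2_tendsto lborel (\<lambda>N. direct_kernel (truncate_fst (real N) f)) (weyl_kernel f)"
    by (rule weyl_kernel_exists(2)[OF f])
qed (intro l2_measurable[of lborel] weyl_kernel_l2 direct_kernel_l2 truncate_fst_l2 fst_bounded_truncate f b)+

text \<open>
  Truncation does not commute with the translation in \<open>x\<close>. The functions
  \<open>twisted_translation k l (truncate_fst N f)\<close> have bounded support in the first variable, so their kernels are
  explicit, and these kernels converge to both sides.
\<close>

theorem weyl_kernel_twisted_translation:
  assumes f: "l2 lborel f"
  shows "AE z in lborel. weyl_kernel (twisted_translation k l f) z = modulated_shift k l (weyl_kernel f) z"
proof (rule l2_tendsto_unique)
  let ?F = "\<lambda>N. direct_kernel (twisted_translation k l (truncate_fst (real N) f))"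
  have t: "l2 lborel (truncate_fst R f)" for R by (rule truncate_fst_l2[OF f])
  have m: "u \<in> borel_measurable borel" if "l2 lborel u" for u :: "(real ^ 'a) \<times> (real ^ 'a) \<Rightarrow> complex"
    using that by (simp add: l2_def)
  have Tt: "l2 lborel (twisted_translation k l (truncate_fst R f))" "fst_bounded (twisted_translation k l (truncate_fst R f))" for R
    by (intro twisted_translation_l2 t fst_bounded_twisted_translation fst_bounded_truncate)+
  have lim: "l2_tendsto lborel (\<lambda>N. twisted_translation k l (truncate_fst (real N) f)) (twisted_translation k l f)"
  proof -
    have "sqnorm lborel (\<lambda>z. twisted_translation k l (truncate_fst (real N) f) z - twisted_translation k l f z) =
        sqnorm lborel (\<lambda>z. truncate_fst (real N) f z - f z)" for N
      unfolding twisted_translation_diff[symmetric]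
      by (rule sqnorm_twisted_translation) (intro m l2_diff t f)
    then show ?thesis using truncate_fst_tendsto[OF f] by (simp add: l2_tendsto_def)
  qed
  show "l2_tendsto lborel ?F (weyl_kernel (twisted_translation k l f))"
  proof (rule l2_tendsto_cong_AE)
    show "l2_tendsto lborel (\<lambda>N. weyl_kernel (twisted_translation k l (truncate_fst (real N) f))) (weyl_kernel (twisted_translation k l f))"
      by (intro weyl_kernel_tendsto Tt twisted_translation_l2 f lim)
    show "AE z in lborel. weyl_kernel (twisted_translation k l (truncate_fst (real N) f)) z = ?F N z" for N
      by (intro weyl_kernel_fst_bounded Tt)
  qed
  show "l2_tendsto lborel ?F (modulated_shift k l (weyl_kernel f))"
  proof -
    have "sqnorm lborel (\<lambda>z. ?F N z - modulated_shift k l (weyl_kernel f) z) =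
        sqnorm lborel (\<lambda>z. direct_kernel (truncate_fst (real N) f) z - weyl_kernel f z)" for N
    proof -
      have "sqnorm lborel (\<lambda>z. ?F N z - modulated_shift k l (weyl_kernel f) z) =
          sqnorm lborel (modulated_shift k l (\<lambda>z. direct_kernel (truncate_fst (real N) f) z - weyl_kernel f z))"
        by (simp add: direct_kernel_twisted_translation m[OF t] modulated_shift_def right_diff_distrib)
      also have "\<dots> = sqnorm lborel (\<lambda>z. direct_kernel (truncate_fst (real N) f) z - weyl_kernel f z)"
        by (intro sqnorm_modulated_shift m l2_diff direct_kernel_l2 t fst_bounded_truncate weyl_kernel_l2 f)
      finally show ?thesis .
    qed
    then show ?thesis using weyl_kernel_exists(2)[OF f] by (simp add: l2_tendsto_def)
  qed
  show "?F N \<in> borel_measurable lborel" for N by (intro l2_measurable[of lborel] direct_kernel_l2 Tt)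
  show "weyl_kernel (twisted_translation k l f) \<in> borel_measurable lborel"
    by (intro l2_measurable[of lborel] weyl_kernel_l2 twisted_translation_l2 f)
  show "modulated_shift k l (weyl_kernel f) \<in> borel_measurable lborel"
    by (intro l2_measurable[of lborel] modulated_shift_l2 weyl_kernel_l2 f)
qed

section \<open>The space generated by twisted translates\<close>

lemma twisted_span_l2:
  assumes \<phi>: "l2 lborel \<phi>" and g: "g \<in> twisted_span \<phi>" shows "l2 lborel g"
proof -
  obtain F c where F: "finite F" "g = (\<lambda>z. \<Sum>(k, l)\<in>F. c (k, l) * twisted_translation k l \<phi> z)"
    using g by (auto simp: twisted_span_def)
  show ?thesis unfolding F(2) case_prod_beta
    by (intro l2_sum F(1) l2_cmult twisted_translation_l2 \<phi>)
qed

lemma l2_inner_twisted_span_eq_0: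
  assumes \<phi>: "l2 lborel \<phi>" and h: "l2 lborel h" and g: "g \<in> twisted_span \<phi>"
    and orth: "\<And>k l. l2_inner lborel h (twisted_translation k l \<phi>) = 0"
  shows "l2_inner lborel h g = 0"
proof -
  obtain F c where F: "finite F" "g = (\<lambda>z. \<Sum>(k, l)\<in>F. c (k, l) * twisted_translation k l \<phi> z)"
    using g by (auto simp: twisted_span_def)
  have orth': "l2_inner lborel (twisted_translation k l \<phi>) h = 0" for k l
    using orth[of k l] by (subst l2_inner_commute) simp
  have "l2_inner lborel g h = (\<Sum>p\<in>F. l2_inner lborel (\<lambda>z. c (fst p, snd p) * twisted_translation (fst p) (snd p) \<phi> z) h)"
    unfolding F(2) case_prod_beta by (intro l2_inner_sum_left F(1) l2_cmult twisted_translation_l2 \<phi> h)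
  also have "\<dots> = 0" by (simp only: l2_inner_cmult_left orth' mult_zero_right sum.neutral_const)
  finally show ?thesis by (subst l2_inner_commute) simp
qed

lemma canonical_dual_l2: "canonical_dual \<phi> \<psi> \<Longrightarrow> l2 lborel \<psi>"
  by (auto simp: canonical_dual_def twisted_space_def square_integrable_iff_l2)

lemma canonical_dual_inner:
  assumes \<phi>: "l2 lborel \<phi>" and d: "canonical_dual \<phi> \<psi>"
  shows "l2_inner lborel \<psi> (twisted_translation k l \<phi>) = (if (k, l) = (0, 0) then 1 else 0)"
proof -
  have "l2_inner lborel \<psi> (twisted_translation k l \<phi>) = l2_inner lborel (twisted_translation (- k) (- l) \<psi>) \<phi>"
    by (subst l2_inner_twisted_translation[OF canonical_dual_l2[OF d] \<phi>]) simp
  also have "\<dots> = (if (- k, - l) = (0, 0) then 1 else 0)"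
    using d unfolding canonical_dual_def L2_inner_eq by blast
  finally show ?thesis by simp
qed

text \<open>
  The difference \<open>h\<close> of two duals is orthogonal to all translates of \<open>\<phi>\<close> by biorthogonality, and it is
  a limit of linear combinations of them. Hence \<open>h\<close> is orthogonal to itself.
\<close>

lemma canonical_dual_unique:
  assumes \<phi>: "l2 lborel \<phi>" and d: "canonical_dual \<phi> \<psi>\<^sub>1" "canonical_dual \<phi> \<psi>\<^sub>2"
  shows "AE z in lborel. \<psi>\<^sub>1 z = \<psi>\<^sub>2 z"
proof -
  note l = canonical_dual_l2[OF d(1)] canonical_dual_l2[OF d(2)]
  define h where "h z = \<psi>\<^sub>1 z - \<psi>\<^sub>2 z" for z
  have h: "l2 lborel h" unfolding h_def by (intro l2_diff l)
  have orth: "l2_inner lborel h (twisted_translation k l \<phi>) = 0" for k l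
    unfolding h_def using canonical_dual_inner[OF \<phi> d(1)] canonical_dual_inner[OF \<phi> d(2)]
    by (simp add: l2_inner_diff_left l twisted_translation_l2 \<phi>)
  obtain G\<^sub>1 where G1: "\<And>j. G\<^sub>1 j \<in> twisted_span \<phi>" "l2_tendsto lborel G\<^sub>1 \<psi>\<^sub>1"
    using d(1) by (auto simp: canonical_dual_def twisted_space_def L2_tendsto_eq)
  obtain G\<^sub>2 where G2: "\<And>j. G\<^sub>2 j \<in> twisted_span \<phi>" "l2_tendsto lborel G\<^sub>2 \<psi>\<^sub>2"
    using d(2) by (auto simp: canonical_dual_def twisted_space_def L2_tendsto_eq)
  note G = twisted_span_l2[OF \<phi> G1(1)] twisted_span_l2[OF \<phi> G2(1)]
  have lim: "l2_tendsto lborel (\<lambda>j z. G\<^sub>1 j z - G\<^sub>2 j z) h"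
    unfolding h_def by (rule l2_tendsto_diff) (intro l2_measurable[of lborel] G l G1(2) G2(2))+
  have "(\<lambda>j. l2_inner lborel h (\<lambda>z. G\<^sub>1 j z - G\<^sub>2 j z)) \<longlonglongrightarrow> l2_inner lborel h h"
  proof (rule l2_tendsto_inner[OF h h l2_diff[OF G] h _ lim])
    show "l2_tendsto lborel (\<lambda>j. h) h" by (simp add: l2_tendsto_def sqnorm_def)
  qed
  moreover have "l2_inner lborel h (\<lambda>z. G\<^sub>1 j z - G\<^sub>2 j z) = 0" for j
    using l2_inner_twisted_span_eq_0[OF \<phi> h G1(1) orth] l2_inner_twisted_span_eq_0[OF \<phi> h G2(1) orth]
    by (simp add: l2_inner_diff_right G h)
  ultimately have "l2_inner lborel h h = 0" by (simp add: LIMSEQ_const_iff)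
  then have "sqnorm lborel h = 0" by (simp add: sqnorm_eq_inner h)
  then have "AE z in lborel. h z = 0" using l2_measurable[OF h] by (simp add: sqnorm_eq_0_iff)
  then show ?thesis by eventually_elim (simp add: h_def)
qed

section \<open>Folding onto the torus\<close>

lemma integral_lborel_pair:
  fixes f :: "'a::euclidean_space \<times> 'b::euclidean_space \<Rightarrow> complex"
  assumes "integrable lborel f"
  shows "integrable lborel (\<lambda>x. LINT y|lborel. f (x, y))"
    and "(LINT z|lborel. f z) = (LINT x|lborel. LINT y|lborel. f (x, y))"
proof -
  have i: "integrable (lborel \<Otimes>\<^sub>M lborel) f" using assms by (simp add: lborel_prod)
  show "integrable lborel (\<lambda>x. LINT y|lborel. f (x, y))" by (rule lborel_pair.integrable_fst'[OF i])
  show "(LINT z|lborel. f z) = (LINT x|lborel. LINT y|lborel. f (x, y))"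
    using lborel_pair.integral_fst'[OF i] by (simp add: lborel_prod)
qed

text \<open>
  Fubini's theorem in \<open>\<eta>\<close> followed by periodization in \<open>\<xi>\<close> rewrites an inner product as the integral over the
  torus of a sum over the integer lattice.
\<close>

lemma l2_inner_fold:
  fixes A B :: "(real ^ 'n) \<times> (real ^ 'n) \<Rightarrow> complex"
  assumes A: "l2 lborel A" and B: "l2 lborel B"
  defines "H \<equiv> \<lambda>\<xi>. LINT \<eta>|lborel. A (\<xi>, \<eta>) * cnj (B (\<xi>, \<eta>))"
  shows "AE \<xi> in torus. integrable (count_space UNIV) (\<lambda>m. H (\<xi> + lattice_pt m))"
    and "integrable torus (\<lambda>\<xi>. LINT m|count_space UNIV. H (\<xi> + lattice_pt m))"
    and "l2_inner lborel A B = (LINT \<xi>|torus. LINT m|count_space UNIV. H (\<xi> + lattice_pt m))"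
proof -
  have i: "integrable lborel H"
    unfolding H_def using integral_lborel_pair(1)[OF l2_integrable_mult[OF A B]] .
  show "AE \<xi> in torus. integrable (count_space UNIV) (\<lambda>m. H (\<xi> + lattice_pt m))"
    and "integrable torus (\<lambda>\<xi>. LINT m|count_space UNIV. H (\<xi> + lattice_pt m))"
    by (rule integral_periodize[OF i])+
  have "l2_inner lborel A B = (LINT \<xi>|lborel. H \<xi>)"
    unfolding l2_inner_def H_def using integral_lborel_pair(2)[OF l2_integrable_mult[OF A B]] .
  then show "l2_inner lborel A B = (LINT \<xi>|torus. LINT m|count_space UNIV. H (\<xi> + lattice_pt m))"
    using integral_periodize(3)[OF i] by simp
qed

lemma borel_measurable_sum_translates:
  fixes H :: "real ^ 'n \<Rightarrow> complex"
  assumes [measurable]: "H \<in> borel_measurable borel"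
  shows "(\<lambda>\<xi>. LINT m|count_space UNIV. H (\<xi> + lattice_pt m)) \<in> borel_measurable borel"
proof -
  interpret sigma_finite_measure "count_space (UNIV :: (int ^ 'n) set)"
    by (rule sigma_finite_measure_count_space)
  have "(\<lambda>(m, \<xi>). H (\<xi> + lattice_pt m)) \<in> borel_measurable (count_space UNIV \<Otimes>\<^sub>M borel)"
    by (rule measurable_pair_measure_countable1) auto
  from borel_measurable_lebesgue_integral[OF measurable_pair_swap[OF this, unfolded prod.case]]
  show ?thesis .
qed

section \<open>The weight\<close>

lemma weight_eq_nn_integral:
  "weight \<phi> \<xi> = (\<integral>\<^sup>+m. \<integral>\<^sup>+\<eta>. ennreal ((cmod (weyl_kernel \<phi> (\<xi> + lattice_pt m, \<eta>)))\<^sup>2) \<partial>lborel \<partial>count_space UNIV)"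
  unfolding weight_def by (rule infsum_ennreal_eq_nn_integral)

lemma weight_periodic:
  fixes k :: "int ^ 'n"
  shows "weight \<phi> (\<xi> + lattice_pt k) = weight \<phi> \<xi>"
proof -
  have b: "bij_betw (\<lambda>m. k + m) (UNIV :: (int ^ 'n) set) UNIV" by (simp add: bij_plus)
  show ?thesis
    unfolding weight_eq_nn_integral
    using nn_integral_bij_count_space[OF b, of "\<lambda>m. \<integral>\<^sup>+\<eta>. ennreal ((cmod (weyl_kernel \<phi> (\<xi> + lattice_pt m, \<eta>)))\<^sup>2) \<partial>lborel"]
    by (simp add: add.assoc)
qed

context
  fixes \<phi> :: "(real ^ 'n) \<times> (real ^ 'n) \<Rightarrow> complex"
  assumes \<phi>: "l2 lborel \<phi>"
begin

lemma weyl_kernel_measurable [measurable]: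
  "weyl_kernel \<phi> \<in> borel_measurable borel" "weyl_kernel \<phi> \<in> borel_measurable (borel \<Otimes>\<^sub>M borel)"
  using l2_measurable[OF weyl_kernel_l2[OF \<phi>]] by (simp_all add: borel_prod)

lemma weight_measurable [measurable]: "weight \<phi> \<in> borel_measurable borel"
proof -
  interpret sigma_finite_measure "count_space (UNIV :: (int ^ 'n) set)"
    by (rule sigma_finite_measure_count_space)
  have "(\<lambda>(m, \<xi>). \<integral>\<^sup>+\<eta>. ennreal ((cmod (weyl_kernel \<phi> (\<xi> + lattice_pt m, \<eta>)))\<^sup>2) \<partial>lborel)
      \<in> borel_measurable (count_space UNIV \<Otimes>\<^sub>M borel)"
    by (rule measurable_pair_measure_countable1) auto
  from measurable_pair_swap[OF this, unfolded prod.case]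
  have "(\<lambda>\<xi>. \<integral>\<^sup>+m. \<integral>\<^sup>+\<eta>. ennreal ((cmod (weyl_kernel \<phi> (\<xi> + lattice_pt m, \<eta>)))\<^sup>2) \<partial>lborel \<partial>count_space UNIV)
      \<in> borel_measurable borel"
    by (rule borel_measurable_nn_integral)
  then show ?thesis by (simp add: weight_eq_nn_integral[abs_def])
qed

text \<open>
  Multiplication of the kernel by a periodic function of \<open>\<xi>\<close> identifies \<open>L\<^sup>2\<close> of the torus with
  weight \<open>weight \<phi>\<close> with a space of kernels.
\<close>

lemma sqnorm_multiple_of_kernel:
  assumes [measurable]: "a \<in> borel_measurable borel" and per: "\<And>\<xi> m. a (\<xi> + lattice_pt m) = a \<xi>"
  shows "sqnorm lborel (\<lambda>z. a (fst z) * weyl_kernel \<phi> z) =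
    (\<integral>\<^sup>+\<xi>. weight \<phi> \<xi> * ennreal ((cmod (a \<xi>))\<^sup>2) \<partial>torus)"
proof -
  note [measurable] = borel_measurable_fst[OF assms(1)]
  define J where "J \<xi> = (\<integral>\<^sup>+\<eta>. ennreal ((cmod (weyl_kernel \<phi> (\<xi>, \<eta>)))\<^sup>2) \<partial>lborel)" for \<xi>
  have [measurable]: "J \<in> borel_measurable borel" unfolding J_def by measurable
  have "sqnorm lborel (\<lambda>z. a (fst z) * weyl_kernel \<phi> z) =
      (\<integral>\<^sup>+\<xi>. \<integral>\<^sup>+\<eta>. ennreal ((cmod (a \<xi> * weyl_kernel \<phi> (\<xi>, \<eta>)))\<^sup>2) \<partial>lborel \<partial>lborel)"
    unfolding sqnorm_def by (subst nn_integral_lborel_pair(1)) auto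
  also have "\<dots> = (\<integral>\<^sup>+\<xi>. ennreal ((cmod (a \<xi>))\<^sup>2) * J \<xi> \<partial>lborel)"
    unfolding J_def by (simp add: norm_mult power_mult_distrib ennreal_mult nn_integral_cmult)
  also have "\<dots> = (\<integral>\<^sup>+\<xi>. \<integral>\<^sup>+m. ennreal ((cmod (a \<xi>))\<^sup>2) * J (\<xi> + lattice_pt m) \<partial>count_space UNIV \<partial>torus)"
    by (subst nn_integral_periodize) (auto simp: per)
  also have "\<dots> = (\<integral>\<^sup>+\<xi>. weight \<phi> \<xi> * ennreal ((cmod (a \<xi>))\<^sup>2) \<partial>torus)"
    by (simp add: nn_integral_cmult weight_eq_nn_integral J_def mult.commute)
  finally show ?thesis .
qed

lemma nn_integral_weight: "(\<integral>\<^sup>+\<xi>. weight \<phi> \<xi> \<partial>torus) = sqnorm lborel \<phi>"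
  using sqnorm_multiple_of_kernel[of "\<lambda>_. 1"] sqnorm_weyl_kernel[OF \<phi>] by simp

lemma AE_weight_finite: "AE \<xi> in torus. weight \<phi> \<xi> < \<infinity>"
proof -
  have "AE \<xi> in torus. weight \<phi> \<xi> \<noteq> \<infinity>"
    using \<phi> nn_integral_weight by (intro nn_integral_PInf_AE) (auto simp: l2_def)
  then show ?thesis by (simp add: less_top[symmetric])
qed

lemma integral_kernel_eq_weight:
  assumes fin: "weight \<phi> \<xi> < \<infinity>"
  shows "(LINT m|count_space UNIV. LINT \<eta>|lborel. weyl_kernel \<phi> (\<xi> + lattice_pt m, \<eta>) *
    cnj (weyl_kernel \<phi> (\<xi> + lattice_pt m, \<eta>))) = of_real (enn2real (weight \<phi> \<xi>))"
proof -
  define c where "c m = (\<integral>\<^sup>+\<eta>. ennreal ((cmod (weyl_kernel \<phi> (\<xi> + lattice_pt m, \<eta>)))\<^sup>2) \<partial>lborel)" for m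
  have w: "weight \<phi> \<xi> = (\<integral>\<^sup>+m. c m \<partial>count_space UNIV)"
    by (simp add: weight_eq_nn_integral c_def)
  have "AE m in count_space UNIV. c m \<noteq> \<infinity>"
    using fin w by (intro nn_integral_PInf_AE) auto
  then have c: "c m = ennreal (enn2real (c m))" for m by (auto simp: AE_count_space less_top)
  have inner: "(LINT \<eta>|lborel. weyl_kernel \<phi> (\<xi> + lattice_pt m, \<eta>) * cnj (weyl_kernel \<phi> (\<xi> + lattice_pt m, \<eta>))) =
      complex_of_real (enn2real (c m))" for m
  proof -
    have "(LINT \<eta>|lborel. weyl_kernel \<phi> (\<xi> + lattice_pt m, \<eta>) * cnj (weyl_kernel \<phi> (\<xi> + lattice_pt m, \<eta>))) =
        (LINT \<eta>|lborel. complex_of_real ((cmod (weyl_kernel \<phi> (\<xi> + lattice_pt m, \<eta>)))\<^sup>2))"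
      by (simp only: complex_norm_square)
    also have "\<dots> = of_real (LINT \<eta>|lborel. (cmod (weyl_kernel \<phi> (\<xi> + lattice_pt m, \<eta>)))\<^sup>2)"
      by (rule integral_complex_of_real)
    also have "(LINT \<eta>|lborel. (cmod (weyl_kernel \<phi> (\<xi> + lattice_pt m, \<eta>)))\<^sup>2) = enn2real (c m)"
      unfolding c_def by (rule integral_eq_nn_integral) auto
    finally show ?thesis .
  qed
  have "(LINT m|count_space UNIV. enn2real (c m)) = enn2real (\<integral>\<^sup>+m. ennreal (enn2real (c m)) \<partial>count_space UNIV)"
    by (rule integral_eq_nn_integral) auto
  also have "\<dots> = enn2real (weight \<phi> \<xi>)" by (simp add: w c[symmetric])
  finally show ?thesis unfolding inner by (simp add: integral_complex_of_real)
qed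

end

text \<open>
  The Cauchy--Schwarz inequality for functions of \<open>(m, \<eta>)\<close>: the hypothesis evaluates an inner
  product, and the two weights are the squared norms.
\<close>

lemma one_le_weight_mult_weight:
  fixes \<phi> \<psi> :: "(real ^ 'n) \<times> (real ^ 'n) \<Rightarrow> complex"
  assumes \<phi>: "l2 lborel \<phi>" and \<psi>: "l2 lborel \<psi>"
    and P: "(LINT m|count_space UNIV. LINT \<eta>|lborel. weyl_kernel \<psi> (\<xi> + lattice_pt m, \<eta>) *
      cnj (weyl_kernel \<phi> (\<xi> + lattice_pt m, \<eta>))) = 1"
  shows "1 \<le> weight \<psi> \<xi> * weight \<phi> \<xi>"
proof -
  note [measurable] = weyl_kernel_measurable[OF \<phi>] weyl_kernel_measurable[OF \<psi>]
  let ?M = "count_space (UNIV :: (int ^ 'n) set) \<Otimes>\<^sub>M (lborel :: (real ^ 'n) measure)"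
  define a where "a p = ennreal (cmod (weyl_kernel \<psi> (\<xi> + lattice_pt (fst p), snd p)))" for p
  define b where "b p = ennreal (cmod (weyl_kernel \<phi> (\<xi> + lattice_pt (fst p), snd p)))" for p
  have [measurable]: "a \<in> borel_measurable ?M" "b \<in> borel_measurable ?M"
    unfolding a_def b_def by (rule measurable_pair_measure_countable1; simp)+
  have h: "ennreal (cmod (LINT m|M. f m)) \<le> (\<integral>\<^sup>+m. ennreal (cmod (f m)) \<partial>M)" for M :: "'z measure" and f
    by (cases "integrable M f") (auto simp: integral_norm_bound_ennreal not_integrable_integral_eq)
  have "1 \<le> (\<integral>\<^sup>+m. ennreal (cmod (LINT \<eta>|lborel. weyl_kernel \<psi> (\<xi> + lattice_pt m, \<eta>) *
      cnj (weyl_kernel \<phi> (\<xi> + lattice_pt m, \<eta>)))) \<partial>count_space UNIV)"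
    using h[of "count_space UNIV" "\<lambda>m. LINT \<eta>|lborel. weyl_kernel \<psi> (\<xi> + lattice_pt m, \<eta>) *
      cnj (weyl_kernel \<phi> (\<xi> + lattice_pt m, \<eta>))"] by (simp add: P)
  also have "\<dots> \<le> (\<integral>\<^sup>+m. \<integral>\<^sup>+\<eta>. a (m, \<eta>) * b (m, \<eta>) \<partial>lborel \<partial>count_space UNIV)"
    by (rule nn_integral_mono, rule order_trans[OF h]) (simp add: a_def b_def norm_mult ennreal_mult)
  also have "\<dots> = (\<integral>\<^sup>+p. a p * b p \<partial>?M)"
    by (subst lborel.nn_integral_fst[symmetric]) auto
  finally have "1\<^sup>2 \<le> (\<integral>\<^sup>+p. a p * b p \<partial>?M)\<^sup>2" by (intro power_mono) auto
  also have "\<dots> \<le> (\<integral>\<^sup>+p. (a p)\<^sup>2 \<partial>?M) * (\<integral>\<^sup>+p. (b p)\<^sup>2 \<partial>?M)"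
    by (rule Cauchy_Schwarz_nn_integral) auto
  also have "(\<integral>\<^sup>+p. (a p)\<^sup>2 \<partial>?M) = weight \<psi> \<xi>"
    by (subst lborel.nn_integral_fst[symmetric]) (auto simp: a_def weight_eq_nn_integral ennreal_power)
  also have "(\<integral>\<^sup>+p. (b p)\<^sup>2 \<partial>?M) = weight \<phi> \<xi>"
    by (subst lborel.nn_integral_fst[symmetric]) (auto simp: b_def weight_eq_nn_integral ennreal_power)
  finally show ?thesis by simp
qed

section \<open>Biorthogonality forces the weight to be invertible\<close>

text \<open>
  Biorthogonality to the translates \<open>T\<^bsub>(k,0)\<^esub> \<phi>\<close> prescribes all Fourier coefficients of the function
  \<open>P = [\<psi>, \<phi>]\<^sub>0\<close>, so \<open>P = 1\<close> almost everywhere, and then \<open>1 / weight \<phi> \<le> weight \<psi>\<close>.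
\<close>

lemma canonical_dual_imp_L1:
  fixes \<phi> \<psi> :: "(real ^ 'n) \<times> (real ^ 'n) \<Rightarrow> complex"
  assumes \<phi>: "l2 lborel \<phi>" and d: "canonical_dual \<phi> \<psi>"
  shows "L1_torus (\<lambda>\<xi>. 1 / weight \<phi> \<xi>)"
proof -
  note \<psi> = canonical_dual_l2[OF d]
  note [measurable] = weyl_kernel_measurable[OF \<phi>] weyl_kernel_measurable[OF \<psi>] weight_measurable[OF \<phi>]
  define H where "H \<xi> = (LINT \<eta>|lborel. weyl_kernel \<psi> (\<xi>, \<eta>) * cnj (weyl_kernel \<phi> (\<xi>, \<eta>)))" for \<xi>
  have [measurable]: "H \<in> borel_measurable borel" unfolding H_def by measurable
  define P where "P \<xi> = (LINT m|count_space UNIV. H (\<xi> + lattice_pt m))" for \<xi>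
  have [measurable]: "P \<in> borel_measurable borel"
    unfolding P_def by (rule borel_measurable_sum_translates) measurable
  have iP: "integrable torus P"
    unfolding P_def[abs_def] H_def[abs_def] by (rule l2_inner_fold(2)[OF weyl_kernel_l2[OF \<psi>] weyl_kernel_l2[OF \<phi>]])
  have coeff: "(LINT \<xi>|torus. P \<xi> * character k \<xi>) = (if k = 0 then 1 else 0)" for k
  proof -
    \<comment> \<open>The second argument of the inner product is conjugated, so \<open>- k\<close> produces the character \<open>k\<close>.\<close>
    have "(if k = 0 then 1 else 0) = l2_inner lborel \<psi> (twisted_translation (- k) 0 \<phi>)"
      by (simp add: canonical_dual_inner[OF \<phi> d])
    also have "\<dots> = l2_inner lborel (weyl_kernel \<psi>) (weyl_kernel (twisted_translation (- k) 0 \<phi>))"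
      by (rule l2_inner_weyl_kernel[symmetric]) (intro \<psi> twisted_translation_l2 \<phi>)+
    also have "\<dots> = l2_inner lborel (weyl_kernel \<psi>) (modulated_shift (- k) 0 (weyl_kernel \<phi>))"
      unfolding l2_inner_def
    proof (rule integral_cong_AE)
      show "AE z in lborel. weyl_kernel \<psi> z * cnj (weyl_kernel (twisted_translation (- k) 0 \<phi>) z) =
          weyl_kernel \<psi> z * cnj (modulated_shift (- k) 0 (weyl_kernel \<phi>) z)"
        using weyl_kernel_twisted_translation[OF \<phi>, of "- k" 0] by eventually_elim simp
    qed (use weyl_kernel_measurable(1)[OF twisted_translation_l2[OF \<phi>]] in measurable)
    also have "\<dots> = (LINT \<xi>|torus. LINT m|count_space UNIV. LINT \<eta>|lborel. weyl_kernel \<psi> (\<xi> + lattice_pt m, \<eta>) *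
        cnj (modulated_shift (- k) 0 (weyl_kernel \<phi>) (\<xi> + lattice_pt m, \<eta>)))"
      by (rule l2_inner_fold(3)) (intro modulated_shift_l2 weyl_kernel_l2 \<phi> \<psi>)+
    also have "\<dots> = (LINT \<xi>|torus. P \<xi> * character k \<xi>)"
    proof (rule Bochner_Integration.integral_cong)
      fix \<xi> :: "real ^ 'n"
      have eq: "weyl_kernel \<psi> (\<xi> + lattice_pt m, \<eta>) * cnj (modulated_shift (- k) 0 (weyl_kernel \<phi>) (\<xi> + lattice_pt m, \<eta>)) =
          (weyl_kernel \<psi> (\<xi> + lattice_pt m, \<eta>) * cnj (weyl_kernel \<phi> (\<xi> + lattice_pt m, \<eta>))) * character k \<xi>" for m \<eta>
        by (simp add: modulated_shift_def character_uminus flip: zero_prod_def)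
      show "(LINT m|count_space UNIV. LINT \<eta>|lborel. weyl_kernel \<psi> (\<xi> + lattice_pt m, \<eta>) *
          cnj (modulated_shift (- k) 0 (weyl_kernel \<phi>) (\<xi> + lattice_pt m, \<eta>))) = P \<xi> * character k \<xi>"
        by (simp only: eq P_def H_def integral_mult_left_zero)
    qed simp
    finally show ?thesis by simp
  qed
  have "AE \<xi> in torus. P \<xi> - 1 = 0"
  proof (rule torus_fourier_unique)
    show "integrable torus (\<lambda>\<xi>. P \<xi> - 1)"
      using iP integrable_torus_bounded[of "\<lambda>_. 1" 1] by auto
    fix k :: "int ^ 'n"
    have i1: "integrable torus (\<lambda>\<xi>. P \<xi> * character k \<xi>)"
      by (rule Bochner_Integration.integrable_bound[OF iP]) (auto simp: norm_mult)
    have "integrable torus (character k)"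
      by (rule integrable_torus_bounded[of _ 1]) auto
    then have "(LINT \<xi>|torus. (P \<xi> - 1) * character k \<xi>) =
        (LINT \<xi>|torus. P \<xi> * character k \<xi>) - (LINT \<xi>|torus. character k \<xi>)"
      using i1 by (simp add: left_diff_distrib)
    then show "(LINT \<xi>|torus. (P \<xi> - 1) * character k \<xi>) = 0"
      by (simp add: coeff integral_character)
  qed measurable
  then have "AE \<xi> in torus. 1 / weight \<phi> \<xi> \<le> weight \<psi> \<xi>"
  proof eventually_elim
    case (elim \<xi>)
    then have "1 \<le> weight \<psi> \<xi> * weight \<phi> \<xi>"
      by (intro one_le_weight_mult_weight \<phi> \<psi>) (simp add: P_def H_def)
    then show ?case
    proof (cases "weight \<phi> \<xi>" rule: ennreal_cases)
      case (real r)
      then have "r \<noteq> 0" using \<open>1 \<le> weight \<psi> \<xi> * weight \<phi> \<xi>\<close> by auto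
      have "1 / weight \<phi> \<xi> \<le> (weight \<psi> \<xi> * weight \<phi> \<xi>) / weight \<phi> \<xi>"
        by (rule divide_right_mono_ennreal) fact
      also have "\<dots> = weight \<psi> \<xi>" using real \<open>r \<noteq> 0\<close>
        by (simp add: ennreal_mult_divide_eq)
      finally show ?thesis .
    qed simp
  qed
  then have "(\<integral>\<^sup>+\<xi>. 1 / weight \<phi> \<xi> \<partial>torus) \<le> (\<integral>\<^sup>+\<xi>. weight \<psi> \<xi> \<partial>torus)"
    by (rule nn_integral_mono_AE)
  also have "\<dots> < \<infinity>" using nn_integral_weight[OF \<psi>] \<psi> by (simp add: l2_def)
  finally show ?thesis unfolding L1_torus_def by simp
qed

section \<open>Construction of the dual\<close>

lemma weyl_kernel_closed_range:
  assumes F: "\<And>n. l2 lborel (F n)" and \<Phi>: "l2 lborel \<Phi>"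
    and lim: "l2_tendsto lborel (\<lambda>n. weyl_kernel (F n)) \<Phi>"
  shows "\<exists>\<psi>. l2 lborel \<psi> \<and> l2_tendsto lborel F \<psi> \<and> (AE z in lborel. weyl_kernel \<psi> z = \<Phi> z)"
proof -
  have "\<exists>\<psi>. l2 lborel \<psi> \<and> l2_tendsto lborel F \<psi>"
  proof (rule l2_complete[OF F])
    fix e :: real assume "0 < e"
    then have "0 < ennreal (e / 4)" by simp
    then have "\<forall>\<^sub>F n in sequentially. sqnorm lborel (\<lambda>z. weyl_kernel (F n) z - \<Phi> z) < ennreal (e / 4)"
      using lim unfolding l2_tendsto_def by (intro order_tendstoD(2)) auto
    then obtain N where N: "\<And>n. N \<le> n \<Longrightarrow> sqnorm lborel (\<lambda>z. weyl_kernel (F n) z - \<Phi> z) < ennreal (e / 4)"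
      by (auto simp: eventually_sequentially)
    have "sqnorm lborel (\<lambda>z. F m z - F n z) < ennreal e" if "N \<le> m" "N \<le> n" for m n
    proof -
      have "sqnorm lborel (\<lambda>z. F m z - F n z) = sqnorm lborel (\<lambda>z. weyl_kernel (F m) z - weyl_kernel (F n) z)"
        using sqnorm_weyl_kernel_diff[OF F F, of m 1 n] by simp
      also have "\<dots> \<le> 2 * sqnorm lborel (\<lambda>z. weyl_kernel (F m) z - \<Phi> z) + 2 * sqnorm lborel (\<lambda>z. \<Phi> z - weyl_kernel (F n) z)"
        by (intro sqnorm_triangle l2_measurable weyl_kernel_l2 F \<Phi>)
      also have "\<dots> < ennreal e"
        unfolding sqnorm_minus_commute[of lborel \<Phi>] by (intro ennreal_quarter_bound N that)
      finally show ?thesis .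
    qed
    then show "\<exists>N. \<forall>m\<ge>N. \<forall>n\<ge>N. sqnorm lborel (\<lambda>z. F m z - F n z) < ennreal e" by blast
  qed
  then obtain \<psi> where \<psi>: "l2 lborel \<psi>" "l2_tendsto lborel F \<psi>" by blast
  have "AE z in lborel. weyl_kernel \<psi> z = \<Phi> z"
    by (rule l2_tendsto_unique[OF _ _ _ weyl_kernel_tendsto[OF F \<psi>] lim])
       (intro l2_measurable[of lborel] weyl_kernel_l2 F \<psi> \<Phi>)+
  then show ?thesis using \<psi> by blast
qed

text \<open>
  Translations with \<open>l = 0\<close> act on kernels by characters of \<open>\<xi>\<close> alone.
\<close>

lemma weyl_kernel_trig_combination:
  assumes \<phi>: "l2 lborel \<phi>" and p: "trig_polynomial p"
  shows "\<exists>g\<in>twisted_span \<phi>. AE z in lborel. weyl_kernel g z = p (fst z) * weyl_kernel \<phi> z"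
proof -
  obtain F c where Fc: "finite F" "p = (\<lambda>x. \<Sum>k\<in>F. c k * character k x)"
    using p by (auto simp: trig_polynomial_def)
  define g where "g = (\<lambda>z. \<Sum>k\<in>F. c k * twisted_translation k 0 \<phi> z)"
  have "g = (\<lambda>z. \<Sum>(k, l)\<in>F \<times> {0}. c (fst (k, l)) * twisted_translation k l \<phi> z)"
    unfolding g_def by (simp flip: sum.cartesian_product)
  then have "g \<in> twisted_span \<phi>"
    unfolding twisted_span_def using Fc(1)
    by (intro CollectI exI[of _ "F \<times> {0}"] exI[of _ "\<lambda>q. c (fst q)"]) simp
  moreover have "AE z in lborel. weyl_kernel g z = p (fst z) * weyl_kernel \<phi> z"
  proof -
    have 1: "AE z in lborel. weyl_kernel g z = (\<Sum>k\<in>F. weyl_kernel (\<lambda>z. c k * twisted_translation k 0 \<phi> z) z)"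
      unfolding g_def by (intro weyl_kernel_sum Fc(1) l2_cmult twisted_translation_l2 \<phi>)
    have 2: "AE z in lborel. \<forall>k\<in>F. weyl_kernel (\<lambda>z. c k * twisted_translation k 0 \<phi> z) z = c k * weyl_kernel (twisted_translation k 0 \<phi>) z"
      by (rule AE_finite_allI[OF Fc(1)]) (intro weyl_kernel_cmult twisted_translation_l2 \<phi>)
    have 3: "AE z in lborel. \<forall>k\<in>F. weyl_kernel (twisted_translation k 0 \<phi>) z = modulated_shift k 0 (weyl_kernel \<phi>) z"
      by (rule AE_finite_allI[OF Fc(1)]) (rule weyl_kernel_twisted_translation[OF \<phi>])
    show ?thesis using 1 2 3
    proof eventually_elim
      case (elim z)
      then have "weyl_kernel g z = (\<Sum>k\<in>F. c k * modulated_shift k 0 (weyl_kernel \<phi>) z)" by simp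
      also have "\<dots> = (\<Sum>k\<in>F. c k * character k (fst z) * weyl_kernel \<phi> z)"
        by (intro sum.cong) (auto simp: modulated_shift_def simp flip: zero_prod_def)
      finally show ?case by (simp add: Fc(2) sum_distrib_right)
    qed
  qed
  ultimately show ?thesis by blast
qed

text \<open>
  Equality holds for \<open>0 < w < \<infinity>\<close>. For \<open>w = 0\<close> the right-hand side is infinite, and for
  \<open>w = \<infinity>\<close> both sides vanish.
\<close>

lemma weight_times_inverse_square_le:
  fixes w :: ennreal shows "w * ennreal ((enn2real (1 / w))\<^sup>2) \<le> 1 / w"
proof (cases w rule: ennreal_cases)
  case (real r)
  show ?thesis
  proof (cases "r = 0")
    case False
    then have "1 / w = ennreal (1 / r)" using real by (simp add: divide_ennreal flip: ennreal_1)
    moreover have "r * (1 / r)\<^sup>2 = 1 / r" using False by (simp add: power2_eq_square)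
    ultimately show ?thesis using real by (simp flip: ennreal_mult)
  qed (use real in simp)
qed simp

text \<open>
  The kernel \<open>\<Phi> = K\<^sub>\<phi> / w\<^sub>\<phi>\<close> is square integrable, its squared norm being at most the integral of
  \<open>1 / w\<^sub>\<phi>\<close>. It is a limit of kernels of linear combinations of translates, so it is the kernel of
  an element \<open>\<psi>\<close> of the generated space. Since \<open>1 / w\<^sub>\<phi>\<close> is periodic, it can be pulled out of the
  sum over \<open>m\<close> in \<open>[\<psi>, \<phi>]\<^sub>l\<close>. What remains is the sum of condition C if \<open>l \<noteq> 0\<close>, and the weight itself
  if \<open>l = 0\<close>.
\<close>

lemma exists_canonical_dual:
  fixes \<phi> :: "(real ^ 'n) \<times> (real ^ 'n) \<Rightarrow> complex"
  assumes \<phi>: "l2 lborel \<phi>" and C: "condition_C \<phi>" and L1: "L1_torus (\<lambda>\<xi>. 1 / weight \<phi> \<xi>)"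
  shows "\<exists>\<psi>. canonical_dual \<phi> \<psi> \<and>
    (AE z in lborel. weyl_kernel \<psi> z = of_real (enn2real (1 / weight \<phi> (fst z))) * weyl_kernel \<phi> z)"
proof -
  note [measurable] = weyl_kernel_measurable[OF \<phi>] weight_measurable[OF \<phi>]
  define q where "q \<xi> = complex_of_real (enn2real (1 / weight \<phi> \<xi>))" for \<xi>
  have [measurable]: "q \<in> borel_measurable borel" unfolding q_def by measurable
  have q_per: "q (\<xi> + lattice_pt m) = q \<xi>" for \<xi> m by (simp add: q_def weight_periodic)
  define \<Phi> where "\<Phi> z = q (fst z) * weyl_kernel \<phi> z" for z
  have [measurable]: "\<Phi> \<in> borel_measurable borel"
    unfolding \<Phi>_def using borel_measurable_fst[of q] by measurable
  have wq: "(\<integral>\<^sup>+\<xi>. weight \<phi> \<xi> * ennreal ((cmod (q \<xi>))\<^sup>2) \<partial>torus) < \<infinity>"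
  proof -
    have "(\<integral>\<^sup>+\<xi>. weight \<phi> \<xi> * ennreal ((cmod (q \<xi>))\<^sup>2) \<partial>torus) \<le> (\<integral>\<^sup>+\<xi>. 1 / weight \<phi> \<xi> \<partial>torus)"
      by (intro nn_integral_mono) (simp add: q_def weight_times_inverse_square_le)
    also have "\<dots> < \<infinity>" using L1 by (simp add: L1_torus_def)
    finally show ?thesis .
  qed
  have \<Phi>: "l2 lborel \<Phi>"
    using sqnorm_multiple_of_kernel[OF \<phi>, of q] wq by (simp add: l2_def q_per \<Phi>_def[abs_def, symmetric])
  have w_fin: "(\<integral>\<^sup>+\<xi>. weight \<phi> \<xi> \<partial>torus) < \<infinity>"
    using nn_integral_weight[OF \<phi>] \<phi> by (simp add: l2_def)

  have "\<exists>g\<in>twisted_span \<phi>. sqnorm lborel (\<lambda>z. weyl_kernel g z - \<Phi> z) \<le> ennreal (1 / real (Suc j))" for j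
  proof -
    obtain p where p: "trig_polynomial p"
      "(\<integral>\<^sup>+\<xi>. weight \<phi> \<xi> * ennreal ((cmod (q \<xi> - p \<xi>))\<^sup>2) \<partial>torus) < ennreal (1 / real (Suc j))"
      by (rule trig_dense_weighted[OF _ _ w_fin wq, of "1 / real (Suc j)"]) auto
    have [measurable]: "p \<in> borel_measurable borel" by (rule trig_polynomial_measurable[OF p(1)])
    obtain g where g: "g \<in> twisted_span \<phi>" "AE z in lborel. weyl_kernel g z = p (fst z) * weyl_kernel \<phi> z"
      using weyl_kernel_trig_combination[OF \<phi> p(1)] by blast
    have "sqnorm lborel (\<lambda>z. weyl_kernel g z - \<Phi> z) = sqnorm lborel (\<lambda>z. (p (fst z) - q (fst z)) * weyl_kernel \<phi> z)"
      by (rule sqnorm_cong_AE) (use g(2) in eventually_elim, simp add: \<Phi>_def left_diff_distrib)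
    also have "\<dots> = (\<integral>\<^sup>+\<xi>. weight \<phi> \<xi> * ennreal ((cmod (p \<xi> - q \<xi>))\<^sup>2) \<partial>torus)"
      by (rule sqnorm_multiple_of_kernel[OF \<phi>]) (auto simp: q_per trig_polynomial_periodic[OF p(1)])
    also have "\<dots> \<le> ennreal (1 / real (Suc j))"
      using p(2) by (simp add: norm_minus_commute)
    finally show ?thesis using g(1) by blast
  qed
  then obtain g where g: "\<And>j. g j \<in> twisted_span \<phi>"
      "\<And>j. sqnorm lborel (\<lambda>z. weyl_kernel (g j) z - \<Phi> z) \<le> ennreal (1 / real (Suc j))"
    by metis
  have "(\<lambda>j. ennreal (1 / real (Suc j))) \<longlonglongrightarrow> ennreal 0"
    by (intro tendsto_ennrealI LIMSEQ_Suc lim_1_over_n)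
  then have "l2_tendsto lborel (\<lambda>j. weyl_kernel (g j)) \<Phi>"
    by (intro l2_tendstoI_le[OF g(2)]) simp
  then obtain \<psi> where \<psi>: "l2 lborel \<psi>" "l2_tendsto lborel g \<psi>" "AE z in lborel. weyl_kernel \<psi> z = \<Phi> z"
    using weyl_kernel_closed_range[of g, OF twisted_span_l2[OF \<phi> g(1)] \<Phi>] by blast
  have "\<psi> \<in> twisted_space \<phi>"
    using \<psi>(1,2) g(1) by (auto simp: twisted_space_def square_integrable_iff_l2 L2_tendsto_eq)
  moreover have "l2_inner lborel (twisted_translation k l \<psi>) \<phi> = (if (k, l) = (0, 0) then 1 else 0)" for k l
  proof -
    define c where "c = cnj (cis (pi * (lattice_pt (- k) \<bullet> lattice_pt (- l))))"
    define B where "B \<xi> = (LINT \<eta>|lborel. weyl_kernel \<phi> (\<xi>, \<eta>) * cnj (weyl_kernel \<phi> (\<xi> + lattice_pt (- l), \<eta>)))" for \<xi>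
    have "l2_inner lborel (twisted_translation k l \<psi>) \<phi> = l2_inner lborel \<psi> (twisted_translation (- k) (- l) \<phi>)"
      by (rule l2_inner_twisted_translation[OF \<psi>(1) \<phi>])
    also have "\<dots> = l2_inner lborel (weyl_kernel \<psi>) (weyl_kernel (twisted_translation (- k) (- l) \<phi>))"
      by (rule l2_inner_weyl_kernel[symmetric]) (intro \<psi>(1) twisted_translation_l2 \<phi>)+
    also have "\<dots> = l2_inner lborel \<Phi> (modulated_shift (- k) (- l) (weyl_kernel \<phi>))"
      unfolding l2_inner_def
    proof (rule integral_cong_AE)
      show "AE z in lborel. weyl_kernel \<psi> z * cnj (weyl_kernel (twisted_translation (- k) (- l) \<phi>) z) =
          \<Phi> z * cnj (modulated_shift (- k) (- l) (weyl_kernel \<phi>) z)"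
        using weyl_kernel_twisted_translation[OF \<phi>, of "- k" "- l"] \<psi>(3) by eventually_elim simp
    qed (use weyl_kernel_measurable(1)[OF twisted_translation_l2[OF \<phi>]] weyl_kernel_measurable(1)[OF \<psi>(1)] in measurable)
    also have "\<dots> = (LINT \<xi>|torus. LINT m|count_space UNIV. LINT \<eta>|lborel. \<Phi> (\<xi> + lattice_pt m, \<eta>) *
        cnj (modulated_shift (- k) (- l) (weyl_kernel \<phi>) (\<xi> + lattice_pt m, \<eta>)))"
      by (rule l2_inner_fold(3)) (intro modulated_shift_l2 weyl_kernel_l2 \<phi> \<Phi>)+
    also have "\<dots> = (LINT \<xi>|torus. c * q \<xi> * character k \<xi> * (LINT m|count_space UNIV. B (\<xi> + lattice_pt m)))"
    proof (rule Bochner_Integration.integral_cong)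
      fix \<xi> :: "real ^ 'n"
      have "\<Phi> (\<xi> + lattice_pt m, \<eta>) * cnj (modulated_shift (- k) (- l) (weyl_kernel \<phi>) (\<xi> + lattice_pt m, \<eta>)) =
          c * q \<xi> * character k \<xi> * (weyl_kernel \<phi> (\<xi> + lattice_pt m, \<eta>) * cnj (weyl_kernel \<phi> (\<xi> + lattice_pt m + lattice_pt (- l), \<eta>)))" for m \<eta>
        unfolding \<Phi>_def modulated_shift_def c_def fst_conv q_per character_periodic
        by (simp add: character_uminus)
      then show "(LINT m|count_space UNIV. LINT \<eta>|lborel. \<Phi> (\<xi> + lattice_pt m, \<eta>) *
          cnj (modulated_shift (- k) (- l) (weyl_kernel \<phi>) (\<xi> + lattice_pt m, \<eta>))) =
          c * q \<xi> * character k \<xi> * (LINT m|count_space UNIV. B (\<xi> + lattice_pt m))"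
        unfolding B_def by (simp only: integral_mult_right_zero)
    qed simp
    also have "\<dots> = (if (k, l) = (0, 0) then 1 else 0)"
    proof (cases "l = 0")
      case False
      have "l2 lborel (modulated_shift 0 (- l) (weyl_kernel \<phi>))"
        by (intro modulated_shift_l2 weyl_kernel_l2 \<phi>)
      from l2_inner_fold(1)[OF weyl_kernel_l2[OF \<phi>] this]
      have iB: "AE \<xi> in torus. integrable (count_space UNIV) (\<lambda>m. B (\<xi> + lattice_pt m))"
        by (simp add: modulated_shift_def B_def)
      have "AE \<xi> in torus. ((\<lambda>m. B (\<xi> + lattice_pt m)) has_sum 0) UNIV"
        using C[unfolded condition_C_def, rule_format, of "- l"] False by (simp add: B_def)
      with iB have "AE \<xi> in torus. c * q \<xi> * character k \<xi> * (LINT m|count_space UNIV. B (\<xi> + lattice_pt m)) = 0"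
        by eventually_elim (simp add: has_sum_imp_lebesgue_integral)
      then have "(LINT \<xi>|torus. c * q \<xi> * character k \<xi> * (LINT m|count_space UNIV. B (\<xi> + lattice_pt m))) = 0"
        by (rule integral_eq_zero_AE)
      then show ?thesis using False by simp
    next
      case True
      then have c: "c = 1" by (simp add: c_def)
      have pos: "AE \<xi> in torus. 1 / weight \<phi> \<xi> \<noteq> \<infinity>"
        using L1 by (intro nn_integral_PInf_AE) (auto simp: L1_torus_def)
      have ae: "AE \<xi> in torus. c * q \<xi> * character k \<xi> * (LINT m|count_space UNIV. B (\<xi> + lattice_pt m)) = character k \<xi>"
        using pos AE_weight_finite[OF \<phi>]
      proof eventually_elim
        case (elim \<xi>)
        have "(LINT m|count_space UNIV. B (\<xi> + lattice_pt m)) = of_real (enn2real (weight \<phi> \<xi>))"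
          using integral_kernel_eq_weight[OF \<phi>, of \<xi>] elim True by (simp add: B_def)
        moreover have "enn2real (1 / weight \<phi> \<xi>) * enn2real (weight \<phi> \<xi>) = 1"
        proof -
          obtain r where r: "0 \<le> r" "weight \<phi> \<xi> = ennreal r" using elim by (cases "weight \<phi> \<xi>") auto
          with elim have "r \<noteq> 0" by (auto simp: ennreal_divide_zero)
          with r have "1 / weight \<phi> \<xi> = ennreal (1 / r)" by (simp add: divide_ennreal flip: ennreal_1)
          with r \<open>r \<noteq> 0\<close> show ?thesis by simp
        qed
        then have "q \<xi> * of_real (enn2real (weight \<phi> \<xi>)) = 1"
          unfolding q_def by (metis of_real_1 of_real_mult)
        ultimately show ?case by (simp add: c ac_simps)
      qed
      have "(LINT \<xi>|torus. c * q \<xi> * character k \<xi> * (LINT m|count_space UNIV. B (\<xi> + lattice_pt m))) = (LINT \<xi>|torus. character k \<xi>)"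
      proof (rule integral_cong_AE[OF _ _ ae])
        have "B \<in> borel_measurable borel" unfolding B_def by measurable
        note [measurable] = borel_measurable_sum_translates[OF this]
        show "(\<lambda>\<xi>. c * q \<xi> * character k \<xi> * (LINT m|count_space UNIV. B (\<xi> + lattice_pt m))) \<in> borel_measurable torus"
          by measurable
      qed measurable
      then show ?thesis using True by (simp add: integral_character)
    qed
    finally show ?thesis .
  qed
  ultimately have "canonical_dual \<phi> \<psi>" by (simp add: canonical_dual_def L2_inner_eq)
  then show ?thesis using \<psi>(3) by (auto simp: \<Phi>_def q_def)
qed

theorem theorem3p1:
  fixes \<phi> :: "(real ^ 'n) \<times> (real ^ 'n) \<Rightarrow> complex"
  assumes "square_integrable \<phi>"
    and "condition_C \<phi>"
  shows "((\<exists>\<psi>. canonical_dual \<phi> \<psi>) \<longleftrightarrow> L1_torus (\<lambda>\<xi>. 1 / weight \<phi> \<xi>)) \<and>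
    (\<forall>\<psi>. canonical_dual \<phi> \<psi> \<longrightarrow>
      (AE (\<xi>, \<eta>) in lborel.
        weyl_kernel \<psi> (\<xi>, \<eta>) = of_real (enn2real (1 / weight \<phi> \<xi>)) * weyl_kernel \<phi> (\<xi>, \<eta>)))"
proof -
  have \<phi>: "l2 lborel \<phi>" using assms(1) by (simp add: square_integrable_iff_l2)
  have "AE (\<xi>, \<eta>) in lborel. weyl_kernel \<psi> (\<xi>, \<eta>) = of_real (enn2real (1 / weight \<phi> \<xi>)) * weyl_kernel \<phi> (\<xi>, \<eta>)"
    if d: "canonical_dual \<phi> \<psi>" for \<psi>
  proof -
    obtain \<psi>\<^sub>0 where d0: "canonical_dual \<phi> \<psi>\<^sub>0"
      "AE z in lborel. weyl_kernel \<psi>\<^sub>0 z = of_real (enn2real (1 / weight \<phi> (fst z))) * weyl_kernel \<phi> z"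
      using exists_canonical_dual[OF \<phi> assms(2) canonical_dual_imp_L1[OF \<phi> d]] by blast
    have "AE z in lborel. weyl_kernel \<psi> z = weyl_kernel \<psi>\<^sub>0 z"
      by (intro weyl_kernel_cong_AE canonical_dual_l2[OF d] canonical_dual_l2[OF d0(1)]
          canonical_dual_unique[OF \<phi> d d0(1)])
    with d0(2) show ?thesis by eventually_elim (auto split: prod.splits)
  qed
  then show ?thesis
    using canonical_dual_imp_L1[OF \<phi>] exists_canonical_dual[OF \<phi> assms(2)] by blast
qed

end
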